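(* Let $X$ be a connected compact Kähler manifold on which $T=S^1$ acts by holomorphic transformations with non-empty fixed point set $Z=X^T$. With the notation of the context, for each $p\ge 0$ and each integer $s$, $$\Phi_Z\circ i_Z^*\Big(\bigoplus_{0\le i\le p}H_T^{i,i+s}(X)\Big)=F_pH^s(K_Z^* ).$$
   Context: For $M=X$ or $M=Z$ ($Z$ is a closed complex submanifold of $X$, possibly disconnected), $A^{p,q}(M)$ denotes the smooth complex-valued forms of type $(p,q)$ and $H^{p,q}(M)=H^q(M,\Omega_M^p)$ Dolbeault cohomology. $i_Z:Z\to X$ is the inclusion, and $i_Z^*$ denotes any map induced by pullback of forms along $i_Z$. Koszul complex. Identify $\mathrm{Lie}(T)$ with $\mathbb{R}$ by a fixed generator $1$. Let $W$ be the holomorphic, i.e. type $(1,0)$, component of the real vector field on $X$ generated by $1\in\mathrm{Lie}(T)$; its zero set is $Z$. Put $K_X^s=\bigoplus_{q-p=s}A^{p,q}(X)$ with differential $D=\bar\partial-i_W:K_X^s\to K_X^{s+1}$, where $i_W$ is contraction; then $D^2=0$, and $H^s(K_X^* )$ denotes the cohomology. On $Z$ the same construction has $i_W=0$: $K_Z^s=\bigoplus_{q-p=s}A^{p,q}(Z)$ with $D=\bar\partial$, so $H^s(K_Z^* )=\bigoplus_{q-p=s}H^{p,q}(Z)$. Filtrations. The subspaces $F_p=\bigoplus_{r\le p}A^{r,*}(X)$ are $D$-stable; $F_pH^s(K_X^* )$ is the subspace of classes in $H^s(K_X^* )$ represented by $D$-closed elements of $K_X^s\cap F_p$. The map $i_Z^*:H^s(K_X^*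 )\to H^s(K_Z^* )$ is an isomorphism, and $F_pH^s(K_Z^* )$ denotes the filtration transported from $X$, i.e. $F_pH^s(K_Z^* ):=i_Z^*\big(F_pH^s(K_X^* )\big)$ (not the filtration of $K_Z^*$ by form type on $Z$). Equivariant Dolbeault cohomology. Let $\mathbb{C}[t]$ be the algebra of complex polynomial functions on $\mathrm{Lie}(T)$, with $t$ the coordinate satisfying $t(1)=1$, and give $t$ bidegree $(1,1)$. Put $A_T^{p,q}(M)=\bigoplus_{i\ge 0}(A^{p-i,q-i}(M))^T t^i$, i.e. polynomial maps $f=\sum_i w_it^i$ from $\mathrm{Lie}(T)$ to $T$-invariant forms, with differential $\bar\partial_T:A_T^{p,q}(M)\to A_T^{p,q+1}(M)$, $(\bar\partial_Tf)(x)=\bar\partial(f(x))-i_{W_x}f(x)$, where $W_x$ is the $(1,0)$-component of the vector field on $M$ generated by $x\in\mathrm{Lie}(T)$ (zero when $M=Z$). $H_T^{p,q}(M)$ is the $q$-th cohomology of $(A_T^{p,*}(M),\bar\partial_T)$. In the claim, $i_Z^*:H_T^{i,i+s}(X)\to H_T^{i,i+s}(Z)$ is pullback, and $\Phi_Z:\bigoplus_i H_T^{i,i+s}(Z)\to H^s(K_Z^* )$ is the map induced by evaluation $f\mapsto f(1)$. *)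

theory Defs
  imports
    "HOL-Analysis.Analysis"
    "HOL-Library.Function_Algebras"
    "HOL-Library.Set_Algebras"
    "HOL-Library.FuncSet"
begin

section \<open>Calculus on coordinate subspaces\<close>

definition coord_space :: "'n set \<Rightarrow> (complex ^ 'n::finite) set" where
  "coord_space J = {z. \<forall>i. i \<notin> J \<longrightarrow> z $ i = 0}"

definition dir_deriv :: "('e::real_normed_vector \<Rightarrow> 'f::real_normed_vector) \<Rightarrow> 'e \<Rightarrow> 'e \<Rightarrow> 'f" where
  "dir_deriv f z v = vector_derivative (\<lambda>t. f (z + t *\<^sub>R v)) (at 0)"

text \<open>
  Smoothness on a relatively open subset \<open>S\<close> of a real subspace \<open>L\<close>: all iterated
  directional derivatives along \<open>L\<close> exist and are continuous on \<open>S\<close>.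
\<close>

primrec Ck_on :: "nat \<Rightarrow> 'e::real_normed_vector set \<Rightarrow> 'e set \<Rightarrow> ('e \<Rightarrow> 'f::real_normed_vector) \<Rightarrow> bool" where
  "Ck_on 0 L S f \<longleftrightarrow> continuous_on S f"
| "Ck_on (Suc k) L S f \<longleftrightarrow> continuous_on S f \<and>
     (\<forall>v\<in>L. (\<forall>z\<in>S. (\<lambda>t::real. f (z + t *\<^sub>R v)) differentiable (at 0)) \<and>
            Ck_on k L S (\<lambda>z. dir_deriv f z v))"

definition smooth_on :: "'e::real_normed_vector set \<Rightarrow> 'e set \<Rightarrow> ('e \<Rightarrow> 'f::real_normed_vector) \<Rightarrow> bool" where
  "smooth_on L S f \<longleftrightarrow> (\<forall>k. Ck_on k L S f)"

text \<open>Holomorphic maps: smooth maps whose differential is complex linear.\<close>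

definition holo_on :: "(complex ^ 'n::finite) set \<Rightarrow> (complex ^ 'n) set \<Rightarrow> (complex ^ 'n \<Rightarrow> complex ^ 'm::finite) \<Rightarrow> bool" where
  "holo_on L S f \<longleftrightarrow> smooth_on L S f \<and>
     (\<forall>z\<in>S. \<exists>f'. (f has_derivative f') (at z within S) \<and> (\<forall>a v. f' (a *s v) = a *s f' v))"


section \<open>Complex manifolds\<close>

text \<open>
  A chart \<open>c\<close> maps \<open>cdom c\<close> onto an open subset of \<open>coord_space (cdirs c)\<close>, a copy of
  \<open>\<complex>\<^sup>d\<close> with \<open>d = card (cdirs c)\<close>.  So \<open>CARD('n)\<close> only bounds the dimension; points and
  manifolds whose components have different dimensions are included.
  Values of \<open>coord c\<close> outside \<open>cdom c\<close> are irrelevant.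
\<close>

record ('a, 'n::finite) chart =
  cdom :: "'a set"
  coord :: "'a \<Rightarrow> complex ^ 'n"
  cdirs :: "'n set"

definition cimg :: "('a, 'n::finite) chart \<Rightarrow> (complex ^ 'n) set" where
  "cimg c = coord c ` cdom c"

definition cinv :: "('a, 'n::finite) chart \<Rightarrow> complex ^ 'n \<Rightarrow> 'a" where
  "cinv c = inv_into (cdom c) (coord c)"

abbreviation ctan :: "('a, 'n::finite) chart \<Rightarrow> (complex ^ 'n) set" where
  "ctan c \<equiv> coord_space (cdirs c)"

definition is_chart :: "'a::topological_space set \<Rightarrow> ('a, 'n::finite) chart \<Rightarrow> bool" where
  "is_chart M c \<longleftrightarrow> openin (top_of_set M) (cdom c) \<and>
     openin (top_of_set (ctan c)) (cimg c) \<and>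
     homeomorphism (cdom c) (cimg c) (coord c) (cinv c)"

definition compatible :: "('a, 'n::finite) chart \<Rightarrow> ('a, 'n) chart \<Rightarrow> bool" where
  "compatible c d \<longleftrightarrow>
     holo_on (ctan c) (coord c ` (cdom c \<inter> cdom d)) (coord d \<circ> cinv c) \<and>
     holo_on (ctan d) (coord d ` (cdom c \<inter> cdom d)) (coord c \<circ> cinv d)"

text \<open>\<open>A\<close> is a maximal holomorphic atlas of \<open>M\<close>; the Hausdorff axiom is in the sort of \<open>'a\<close>.\<close>

definition complex_manifold :: "'a::t2_space set \<Rightarrow> ('a, 'n::finite) chart set \<Rightarrow> bool" where
  "complex_manifold M A \<longleftrightarrow>
     second_countable (top_of_set M) \<and>
     (\<forall>c\<in>A. is_chart M c) \<and>
     M = (\<Union>c\<in>A. cdom c) \<and>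
     (\<forall>c\<in>A. \<forall>d\<in>A. compatible c d) \<and>
     (\<forall>c. is_chart M c \<and> (\<forall>d\<in>A. compatible c d) \<longrightarrow> c \<in> A)"

definition holo_map :: "'a::topological_space set \<Rightarrow> ('a, 'n::finite) chart set \<Rightarrow>
    'b::topological_space set \<Rightarrow> ('b, 'm::finite) chart set \<Rightarrow> ('a \<Rightarrow> 'b) \<Rightarrow> bool" where
  "holo_map M A N B f \<longleftrightarrow> continuous_on M f \<and> f ` M \<subseteq> N \<and>
     (\<forall>c\<in>A. \<forall>d\<in>B. holo_on (ctan c) {z \<in> cimg c. f (cinv c z) \<in> cdom d} (coord d \<circ> f \<circ> cinv c))"

text \<open>
  The atlas induced on a complex submanifold \<open>Z\<close>: restrictions of the charts in which \<open>Z\<close>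
  is a coordinate slice.
\<close>

definition sub_atlas :: "('a, 'n::finite) chart set \<Rightarrow> 'a set \<Rightarrow> ('a, 'n) chart set" where
  "sub_atlas A Z = {c\<lparr>cdom := cdom c \<inter> Z, cdirs := J\<rparr> | c J.
     c \<in> A \<and> J \<subseteq> cdirs c \<and> coord c ` (cdom c \<inter> Z) = cimg c \<inter> coord_space J}"


section \<open>Differential forms\<close>

text \<open>
  A complex-valued form of mixed degree is the family of its local expressions:
  \<open>\<omega> c z [v\<^sub>1, \<dots>, v\<^sub>k]\<close> is the value of the degree-\<open>k\<close> component at the point \<open>cinv c z\<close> on the
  tangent vectors with coordinates \<open>v\<^sub>1, \<dots>, v\<^sub>k \<in> ctan c\<close> in the chart \<open>c\<close>.  It is set to \<open>0\<close>
  on arguments that are not meaningful, so that equality of forms is equality of functions.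
\<close>

type_synonym ('a, 'n) form = "('a, 'n) chart \<Rightarrow> complex ^ 'n \<Rightarrow> (complex ^ 'n) list \<Rightarrow> complex"

definition meaningful :: "('a, 'n::finite) chart set \<Rightarrow> ('a, 'n) chart \<Rightarrow> complex ^ 'n \<Rightarrow> (complex ^ 'n) list \<Rightarrow> bool" where
  "meaningful A c z vs \<longleftrightarrow> c \<in> A \<and> z \<in> cimg c \<and> set vs \<subseteq> ctan c"

definition multilinear_alternating :: "(complex ^ 'n::finite) set \<Rightarrow> ((complex ^ 'n) list \<Rightarrow> complex) \<Rightarrow> bool" where
  "multilinear_alternating L \<alpha> \<longleftrightarrow>
     (\<forall>us v w ws a b. set us \<subseteq> L \<and> v \<in> L \<and> w \<in> L \<and> set ws \<subseteq> L \<longrightarrow>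
        \<alpha> (us @ (a *\<^sub>R v + b *\<^sub>R w) # ws) =
          complex_of_real a * \<alpha> (us @ v # ws) + complex_of_real b * \<alpha> (us @ w # ws)) \<and>
     (\<forall>vs. set vs \<subseteq> L \<and> \<not> distinct vs \<longrightarrow> \<alpha> vs = 0)"

definition forms :: "('a, 'n::finite) chart set \<Rightarrow> ('a, 'n) form set" where
  "forms A = {\<omega>.
     (\<forall>c z vs. \<not> meaningful A c z vs \<longrightarrow> \<omega> c z vs = 0) \<and>
     (\<forall>c\<in>A. \<forall>z\<in>cimg c. multilinear_alternating (ctan c) (\<omega> c z)) \<and>
     (\<forall>c\<in>A. \<forall>vs. set vs \<subseteq> ctan c \<longrightarrow> smooth_on (ctan c) (cimg c) (\<lambda>z. \<omega> c z vs)) \<and>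
     (\<forall>c\<in>A. \<forall>d\<in>A. \<forall>x \<in> cdom c \<inter> cdom d. \<forall>vs. set vs \<subseteq> ctan c \<longrightarrow>
        \<omega> c (coord c x) vs = \<omega> d (coord d x) (map (dir_deriv (coord d \<circ> cinv c) (coord c x)) vs))}"

text \<open>
  Complex multilinear extension to \<open>TM \<otimes> \<complex>\<close>, evaluated on the \<open>(1,0)\<close>-components
  \<open>(v - \<i> \<otimes> Jv)/2\<close> (for entries \<open>(True, v)\<close>) and the \<open>(0,1)\<close>-components
  \<open>(v + \<i> \<otimes> Jv)/2\<close> (for entries \<open>(False, v)\<close>) of real tangent vectors; \<open>J\<close> is \<open>v \<mapsto> \<i> *s v\<close>.
\<close>

fun ext_eval :: "((complex ^ 'n::finite) list \<Rightarrow> complex) \<Rightarrow> (bool \<times> (complex ^ 'n)) list \<Rightarrow> complex" where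
  "ext_eval \<alpha> [] = \<alpha> []"
| "ext_eval \<alpha> ((e, v) # xs) =
     (ext_eval (\<lambda>vs. \<alpha> (v # vs)) xs
      + (if e then - \<i> else \<i>) * ext_eval (\<lambda>vs. \<alpha> ((\<i> *s v) # vs)) xs) / 2"

text \<open>
  Type \<open>(p,q)\<close>: the extension vanishes unless it is fed exactly \<open>p\<close> vectors of type \<open>(1,0)\<close>
  and \<open>q\<close> of type \<open>(0,1)\<close>.  This forces degree \<open>p + q\<close>, and gives \<open>0\<close> if \<open>p < 0\<close> or \<open>q < 0\<close>.
\<close>

definition forms_pq :: "('a, 'n::finite) chart set \<Rightarrow> int \<Rightarrow> int \<Rightarrow> ('a, 'n) form set" where
  "forms_pq A p q = {\<omega> \<in> forms A. \<forall>c\<in>A. \<forall>z\<in>cimg c. \<forall>xs. snd ` set xs \<subseteq> ctan c \<longrightarrow>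
     ext_eval (\<omega> c z) xs \<noteq> 0 \<longrightarrow>
       int (length (filter fst xs)) = p \<and> int (length (filter (\<lambda>x. \<not> fst x) xs)) = q}"

definition form_scale :: "complex \<Rightarrow> ('a, 'n::finite) form \<Rightarrow> ('a, 'n) form" where
  "form_scale a \<omega> = (\<lambda>c z vs. a * \<omega> c z vs)"

text \<open>Pullback along \<open>f\<close>; the result does not depend on the chosen chart \<open>d\<close>.\<close>

definition pullback :: "('a, 'n::finite) chart set \<Rightarrow> ('b, 'm::finite) chart set \<Rightarrow> ('a \<Rightarrow> 'b) \<Rightarrow>
    ('b, 'm) form \<Rightarrow> ('a, 'n) form" where
  "pullback A B f \<omega> = (\<lambda>c z vs. if meaningful A c z vs then
      (let d = (SOME d. d \<in> B \<and> f (cinv c z) \<in> cdom d); F = coord d \<circ> f \<circ> cinv c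
       in \<omega> d (F z) (map (dir_deriv F z) vs)) else 0)"

definition drop_nth :: "nat \<Rightarrow> 'b list \<Rightarrow> 'b list" where
  "drop_nth j vs = take j vs @ drop (Suc j) vs"

definition ext_d :: "('a, 'n::finite) chart set \<Rightarrow> ('a, 'n) form \<Rightarrow> ('a, 'n) form" where
  "ext_d A \<omega> = (\<lambda>c z vs. if meaningful A c z vs then
      (\<Sum>j<length vs. (-1) ^ j * dir_deriv (\<lambda>y. \<omega> c y (drop_nth j vs)) z (vs ! j)) else 0)"

text \<open>\<open>dbar_dir f z v\<close> is \<open>\<Sum>\<^sub>k (\<partial>f/\<partial>\<bar>z\<^sub>k) \<bar>v\<^sub>k\<close>.\<close>

definition dbar_dir :: "(complex ^ 'n::finite \<Rightarrow> complex) \<Rightarrow> complex ^ 'n \<Rightarrow> complex ^ 'n \<Rightarrow> complex" where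
  "dbar_dir f z v = (dir_deriv f z v + \<i> * dir_deriv f z (\<i> *s v)) / 2"

definition dbar :: "('a, 'n::finite) chart set \<Rightarrow> ('a, 'n) form \<Rightarrow> ('a, 'n) form" where
  "dbar A \<omega> = (\<lambda>c z vs. if meaningful A c z vs then
      (\<Sum>j<length vs. (-1) ^ j * dbar_dir (\<lambda>y. \<omega> c y (drop_nth j vs)) z (vs ! j)) else 0)"

text \<open>Existence of a Kaehler form: a closed real \<open>(1,1)\<close>-form with \<open>\<omega>(v, Jv) > 0\<close> for \<open>v \<noteq> 0\<close>.\<close>

definition kaehler :: "('a, 'n::finite) chart set \<Rightarrow> bool" where
  "kaehler A \<longleftrightarrow> (\<exists>\<omega> \<in> forms_pq A 1 1. ext_d A \<omega> = 0 \<and>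
     (\<forall>c\<in>A. \<forall>z\<in>cimg c.
        (\<forall>v\<in>ctan c. \<forall>w\<in>ctan c. \<omega> c z [v, w] \<in> \<real>) \<and>
        (\<forall>v\<in>ctan c. v \<noteq> 0 \<longrightarrow> 0 < Re (\<omega> c z [v, \<i> *s v]))))"


section \<open>Circle actions\<close>

text \<open>\<open>T\<close> is the unit circle in \<open>\<complex>\<close>; the action is smooth and each element acts holomorphically.\<close>

definition holo_circle_action :: "'a::topological_space set \<Rightarrow> ('a, 'n::finite) chart set \<Rightarrow>
    (complex \<Rightarrow> 'a \<Rightarrow> 'a) \<Rightarrow> bool" where
  "holo_circle_action X A \<rho> \<longleftrightarrow>
     (\<forall>x\<in>X. \<rho> 1 x = x) \<and>
     (\<forall>g\<in>sphere 0 1. \<forall>h\<in>sphere 0 1. \<forall>x\<in>X. \<rho> (g * h) x = \<rho> g (\<rho> h x)) \<and>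
     (\<forall>g\<in>sphere 0 1. holo_map X A X A (\<rho> g)) \<and>
     continuous_on (sphere 0 1 \<times> X) (\<lambda>(g, x). \<rho> g x) \<and>
     (\<forall>c\<in>A. \<forall>d\<in>A. smooth_on (UNIV \<times> ctan c)
        {(\<theta>::real, z). z \<in> cimg c \<and> \<rho> (cis \<theta>) (cinv c z) \<in> cdom d}
        (\<lambda>(\<theta>, z). coord d (\<rho> (cis \<theta>) (cinv c z))))"

definition fixed_points :: "'a set \<Rightarrow> (complex \<Rightarrow> 'a \<Rightarrow> 'a) \<Rightarrow> 'a set" where
  "fixed_points X \<rho> = {x \<in> X. \<forall>g\<in>sphere 0 1. \<rho> g x = x}"

text \<open>
  The identification of \<open>Lie(T)\<close> with \<open>\<real>\<close> by a generator is recorded by a real \<open>\<xi> \<noteq> 0\<close>: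
  \<open>exp x = cis (\<xi> * x)\<close>.  (The opposite sign convention for generated vector fields amounts to
  \<open>-\<xi>\<close>.)  \<open>gen_field \<rho> \<xi> x\<close> is the real vector field generated by \<open>x\<close>.
\<close>

definition gen_field :: "(complex \<Rightarrow> 'a \<Rightarrow> 'a) \<Rightarrow> real \<Rightarrow> real \<Rightarrow> ('a, 'n::finite) chart \<Rightarrow> complex ^ 'n \<Rightarrow> complex ^ 'n" where
  "gen_field \<rho> \<xi> x c z = vector_derivative (\<lambda>t. coord c (\<rho> (cis (\<xi> * (t * x))) (cinv c z))) (at 0)"

text \<open>
  Contraction with the \<open>(1,0)\<close>-component \<open>W\<^sub>x = (V - \<i> \<otimes> JV)/2\<close> of \<open>V = gen_field \<rho> \<xi> x\<close>.
  On the fixed point set \<open>V = 0\<close>, so the contraction is zero there.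
\<close>

definition contr :: "('a, 'n::finite) chart set \<Rightarrow> (complex \<Rightarrow> 'a \<Rightarrow> 'a) \<Rightarrow> real \<Rightarrow> real \<Rightarrow> ('a, 'n) form \<Rightarrow> ('a, 'n) form" where
  "contr A \<rho> \<xi> x \<omega> = (\<lambda>c z vs. if meaningful A c z vs then
      (let V = gen_field \<rho> \<xi> x c z in (\<omega> c z (V # vs) - \<i> * \<omega> c z ((\<i> *s V) # vs)) / 2) else 0)"


section \<open>Cohomology\<close>

text \<open>Cohomology as the set of cosets \<open>z +o B\<close> of cocycles \<open>z\<close> modulo coboundaries \<open>B\<close>.\<close>

definition quotient_by :: "'v::ab_group_add set \<Rightarrow> 'v set \<Rightarrow> 'v set set" where
  "quotient_by C B = (\<lambda>z. z +o B) ` C"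

text \<open>The map on cosets induced by a map \<open>f\<close> on representatives, with target coboundaries \<open>B\<close>.\<close>

definition induced :: "('v \<Rightarrow> 'w::ab_group_add) \<Rightarrow> 'w set \<Rightarrow> 'v set \<Rightarrow> 'w set" where
  "induced f B C = (\<Union>z\<in>C. f z +o B)"

subsection \<open>The Koszul complex\<close>

definition koszul :: "('a, 'n::finite) chart set \<Rightarrow> int \<Rightarrow> ('a, 'n) form set" where
  "koszul A s = {\<omega>. \<exists>N a. (\<forall>r\<le>N. a r \<in> forms_pq A (int r) (int r + s)) \<and> \<omega> = (\<Sum>r\<le>(N::nat). a r)}"

definition koszul_D :: "('a, 'n::finite) chart set \<Rightarrow> (complex \<Rightarrow> 'a \<Rightarrow> 'a) \<Rightarrow> real \<Rightarrow> ('a, 'n) form \<Rightarrow> ('a, 'n) form" where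
  "koszul_D A \<rho> \<xi> \<omega> = dbar A \<omega> - contr A \<rho> \<xi> 1 \<omega>"

definition koszul_cocycles :: "('a, 'n::finite) chart set \<Rightarrow> (complex \<Rightarrow> 'a \<Rightarrow> 'a) \<Rightarrow> real \<Rightarrow> int \<Rightarrow> ('a, 'n) form set" where
  "koszul_cocycles A \<rho> \<xi> s = {\<omega> \<in> koszul A s. koszul_D A \<rho> \<xi> \<omega> = 0}"

definition koszul_coboundaries :: "('a, 'n::finite) chart set \<Rightarrow> (complex \<Rightarrow> 'a \<Rightarrow> 'a) \<Rightarrow> real \<Rightarrow> int \<Rightarrow> ('a, 'n) form set" where
  "koszul_coboundaries A \<rho> \<xi> s = koszul_D A \<rho> \<xi> ` koszul A (s - 1)"

definition koszul_coh :: "('a, 'n::finite) chart set \<Rightarrow> (complex \<Rightarrow> 'a \<Rightarrow> 'a) \<Rightarrow> real \<Rightarrow> int \<Rightarrow> ('a, 'n) form set set" where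
  "koszul_coh A \<rho> \<xi> s = quotient_by (koszul_cocycles A \<rho> \<xi> s) (koszul_coboundaries A \<rho> \<xi> s)"

definition filt :: "('a, 'n::finite) chart set \<Rightarrow> nat \<Rightarrow> ('a, 'n) form set" where
  "filt A p = {\<omega>. \<exists>N a. (\<forall>r\<le>p. \<forall>q\<le>N. a r q \<in> forms_pq A (int r) (int q)) \<and>
     \<omega> = (\<Sum>r\<le>p. \<Sum>q\<le>(N::nat). a r q)}"

definition filt_coh :: "('a, 'n::finite) chart set \<Rightarrow> (complex \<Rightarrow> 'a \<Rightarrow> 'a) \<Rightarrow> real \<Rightarrow> nat \<Rightarrow> int \<Rightarrow> ('a, 'n) form set set" where
  "filt_coh A \<rho> \<xi> p s =
     {C \<in> koszul_coh A \<rho> \<xi> s. \<exists>\<omega> \<in> koszul_cocycles A \<rho> \<xi> s \<inter> filt A p.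
        C = \<omega> +o koszul_coboundaries A \<rho> \<xi> s}"

definition restr_koszul_coh :: "('a, 'n::finite) chart set \<Rightarrow> (complex \<Rightarrow> 'a \<Rightarrow> 'a) \<Rightarrow> real \<Rightarrow> 'a set \<Rightarrow> int \<Rightarrow>
    ('a, 'n) form set \<Rightarrow> ('a, 'n) form set" where
  "restr_koszul_coh A \<rho> \<xi> Z s =
     induced (pullback (sub_atlas A Z) A (\<lambda>x. x)) (koszul_coboundaries (sub_atlas A Z) \<rho> \<xi> s)"

definition filt_coh_fixed :: "('a, 'n::finite) chart set \<Rightarrow> (complex \<Rightarrow> 'a \<Rightarrow> 'a) \<Rightarrow> real \<Rightarrow> 'a set \<Rightarrow> nat \<Rightarrow> int \<Rightarrow>
    ('a, 'n) form set set" where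
  "filt_coh_fixed A \<rho> \<xi> Z p s = restr_koszul_coh A \<rho> \<xi> Z s ` filt_coh A \<rho> \<xi> p s"

subsection \<open>Equivariant Dolbeault cohomology\<close>

definition invariant_pq :: "('a, 'n::finite) chart set \<Rightarrow> (complex \<Rightarrow> 'a \<Rightarrow> 'a) \<Rightarrow> int \<Rightarrow> int \<Rightarrow> ('a, 'n) form set" where
  "invariant_pq A \<rho> p q = {\<omega> \<in> forms_pq A p q. \<forall>g\<in>sphere 0 1. pullback A A (\<rho> g) \<omega> = \<omega>}"

text \<open>Equivariant forms are polynomial maps from \<open>Lie(T) = \<real>\<close> to invariant forms.\<close>

definition equiv_forms :: "('a, 'n::finite) chart set \<Rightarrow> (complex \<Rightarrow> 'a \<Rightarrow> 'a) \<Rightarrow> int \<Rightarrow> int \<Rightarrow>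
    (real \<Rightarrow> ('a, 'n) form) set" where
  "equiv_forms A \<rho> p q = {f. \<exists>N w. (\<forall>i\<le>N. w i \<in> invariant_pq A \<rho> (p - int i) (q - int i)) \<and>
     f = (\<lambda>x. \<Sum>i\<le>(N::nat). form_scale (complex_of_real (x ^ i)) (w i))}"

definition equiv_dbar :: "('a, 'n::finite) chart set \<Rightarrow> (complex \<Rightarrow> 'a \<Rightarrow> 'a) \<Rightarrow> real \<Rightarrow>
    (real \<Rightarrow> ('a, 'n) form) \<Rightarrow> real \<Rightarrow> ('a, 'n) form" where
  "equiv_dbar A \<rho> \<xi> f = (\<lambda>x. dbar A (f x) - contr A \<rho> \<xi> x (f x))"

definition equiv_cocycles :: "('a, 'n::finite) chart set \<Rightarrow> (complex \<Rightarrow> 'a \<Rightarrow> 'a) \<Rightarrow> real \<Rightarrow> int \<Rightarrow> int \<Rightarrow>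
    (real \<Rightarrow> ('a, 'n) form) set" where
  "equiv_cocycles A \<rho> \<xi> p q = {f \<in> equiv_forms A \<rho> p q. equiv_dbar A \<rho> \<xi> f = 0}"

definition equiv_coboundaries :: "('a, 'n::finite) chart set \<Rightarrow> (complex \<Rightarrow> 'a \<Rightarrow> 'a) \<Rightarrow> real \<Rightarrow> int \<Rightarrow> int \<Rightarrow>
    (real \<Rightarrow> ('a, 'n) form) set" where
  "equiv_coboundaries A \<rho> \<xi> p q = equiv_dbar A \<rho> \<xi> ` equiv_forms A \<rho> p (q - 1)"

definition equiv_coh :: "('a, 'n::finite) chart set \<Rightarrow> (complex \<Rightarrow> 'a \<Rightarrow> 'a) \<Rightarrow> real \<Rightarrow> int \<Rightarrow> int \<Rightarrow>
    (real \<Rightarrow> ('a, 'n) form) set set" where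
  "equiv_coh A \<rho> \<xi> p q = quotient_by (equiv_cocycles A \<rho> \<xi> p q) (equiv_coboundaries A \<rho> \<xi> p q)"

definition restr_equiv_coh :: "('a, 'n::finite) chart set \<Rightarrow> (complex \<Rightarrow> 'a \<Rightarrow> 'a) \<Rightarrow> real \<Rightarrow> 'a set \<Rightarrow> int \<Rightarrow> int \<Rightarrow>
    (real \<Rightarrow> ('a, 'n) form) set \<Rightarrow> (real \<Rightarrow> ('a, 'n) form) set" where
  "restr_equiv_coh A \<rho> \<xi> Z p q =
     induced (\<lambda>f x. pullback (sub_atlas A Z) A (\<lambda>x. x) (f x)) (equiv_coboundaries (sub_atlas A Z) \<rho> \<xi> p q)"

text \<open>
  The map \<open>\<Phi>\<close> induced by \<open>f \<mapsto> f(1)\<close>, on \<open>\<Oplus>\<^bsub>i \<le> p\<^esub> H\<^sub>T\<^sup>i\<^sup>,\<^sup>i\<^sup>+\<^sup>s\<close>, whose elements are families \<open>h\<close>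
  of classes.  The sum is the addition of cosets.
\<close>

definition eval_coh :: "('a, 'n::finite) chart set \<Rightarrow> (complex \<Rightarrow> 'a \<Rightarrow> 'a) \<Rightarrow> real \<Rightarrow> nat \<Rightarrow> int \<Rightarrow>
    (nat \<Rightarrow> (real \<Rightarrow> ('a, 'n) form) set) \<Rightarrow> ('a, 'n) form set" where
  "eval_coh A \<rho> \<xi> p s h = (\<Sum>i\<le>p. induced (\<lambda>f. f 1) (koszul_coboundaries A \<rho> \<xi> s) (h i))"

end

theory Submission
  imports Defs
begin

text \<open>
  The inclusion of the left side in the right side is evaluation at \<open>1\<close>, which turns the equivariant
  differential into \<open>D\<close>.  Conversely, let \<open>\<omega> = \<Sum>\<^sub>r a\<^sub>r\<close> be a \<open>D\<close>-closed element of \<open>F\<^sub>p\<close>, with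
  \<open>a\<^sub>r\<close> of type \<open>(r, r + s)\<close>.  Since \<open>T\<close> acts trivially on \<open>Z\<close>, averaging \<open>\<omega>\<close> over \<open>T\<close> does not change
  its restriction to \<open>Z\<close>, so that no homotopy between \<open>\<omega>\<close> and its average is needed.  The equation
  \<open>D \<omega> = 0\<close> splits by degree into \<open>dbar a\<^sub>r = i\<^sub>W a\<^sub>r\<^sub>+\<^sub>1\<close>, and hence \<open>\<Sum>\<^sub>r a\<^sub>r t\<^bsup>p-r\<^esup>\<close>, formed with the
  averaged components, is an equivariant cocycle whose value at \<open>1\<close> restricts to \<open>\<omega>\<close> on \<open>Z\<close>.

  Averages and pullbacks along group elements are computed in the charts transported by the action:
  in these the pullback of a form has the same local expression as the form, so it commutes with
  every operator defined chart by chart.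
\<close>

section \<open>Calculus of iterated directional derivatives\<close>

text \<open>Two features of the definitions shape the work. \<open>pullback\<close> evaluates a form
  in an arbitrary chart around the image point, so restricting \<open>dbar A \<omega>\<close> to
  \<open>Z\<close> presupposes that the coordinate formula for \<open>dbar\<close> is independent of
  the chart; this rests on symmetry of second derivatives and on holomorphy of the transition maps.
  Smoothness, in turn, only speaks of iterated directional derivatives along one coordinate space,
  so linearity in the direction, the chain rule and differentiation under the integral have to be
  derived from it. For the average, smoothness in each chart is too weak: the transported chart
  moves with the angle, and joint smoothness in angle and point is extracted from that of the
  action. On \<open>Z\<close> the contraction vanishes together with the generating field; on all of
  \<open>X\<close> it commutes with averaging because the circle is commutative. The power of
  \<open>t\<close> attached to a component is dictated by the bidegree, as \<open>t\<close> has type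
  (1,1). The end conditions \<open>i_W a_0 = 0\<close> and \<open>a_(p+1) = 0\<close> close the
  resulting sum.\<close>

lemma Ck_on_continuous: "Ck_on k L S f \<Longrightarrow> continuous_on S f"
  by (cases k) auto

lemma Ck_on_Suc_imp: "Ck_on (Suc k) L S f \<Longrightarrow> Ck_on k L S f"
proof (induction k arbitrary: f)
  case (Suc k)
  show ?case
    unfolding Ck_on.simps(2)[of k]
    using Suc.prems Suc.IH unfolding Ck_on.simps(2)[of "Suc k"] by blast
qed simp

lemma Ck_on_subset:
  assumes "Ck_on k L S f" "L' \<subseteq> L" "S' \<subseteq> S"
  shows "Ck_on k L' S' f"
  using assms
proof (induction k arbitrary: f)
  case 0
  then show ?case by (auto intro: continuous_on_subset)
next
  case (Suc k)
  then show ?case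
    by (simp add: subset_iff) (meson continuous_on_subset subsetI)
qed

lemma smooth_on_subset:
  "smooth_on L S f \<Longrightarrow> L' \<subseteq> L \<Longrightarrow> S' \<subseteq> S \<Longrightarrow> smooth_on L' S' f"
  unfolding smooth_on_def using Ck_on_subset by blast

lemma smooth_on_differentiable:
  assumes "smooth_on L S f" "z \<in> S" "v \<in> L"
  shows "(\<lambda>t. f (z + t *\<^sub>R v)) differentiable (at 0)"
  using assms unfolding smooth_on_def by (auto dest!: spec[of _ "Suc 0"])

lemma smooth_on_dir_deriv:
  assumes "smooth_on L S f" "v \<in> L"
  shows "smooth_on L S (\<lambda>z. dir_deriv f z v)"
  using assms unfolding smooth_on_def by (metis Ck_on.simps(2))

lemma has_dir_deriv:
  assumes "(\<lambda>t. f (z + t *\<^sub>R v)) differentiable (at 0)"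
  shows "((\<lambda>t. f (z + t *\<^sub>R v)) has_vector_derivative dir_deriv f z v) (at 0)"
  using assms unfolding dir_deriv_def by (simp add: vector_derivative_works)

lemma dir_deriv_eqI:
  "((\<lambda>t. f (z + t *\<^sub>R v)) has_vector_derivative D) (at 0) \<Longrightarrow> dir_deriv f z v = D"
  unfolding dir_deriv_def by (rule vector_derivative_at)

lemma smooth_on_has_dir_deriv:
  assumes "smooth_on L S f" "z \<in> S" "v \<in> L"
  shows "((\<lambda>t. f (z + t *\<^sub>R v)) has_vector_derivative dir_deriv f z v) (at 0)"
  by (rule has_dir_deriv[OF smooth_on_differentiable[OF assms]])

section \<open>Locality of derivatives along a subspace\<close>

text \<open>The calculus takes place on sets open in \<open>L\<close>, not in the ambient space.
  Lines in directions of \<open>L\<close> stay in such a set for small times; this is how equalities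
  on \<open>S\<close> pass to derivatives.\<close>

lemma line_in_open:
  fixes z :: "'e::real_normed_vector"
  assumes "subspace L" "openin (top_of_set L) S" "z \<in> S" "v \<in> L"
  shows "\<forall>\<^sub>F t in nhds (0::real). z + t *\<^sub>R v \<in> S"
proof -
  obtain T where T: "open T" "S = L \<inter> T"
    using assms(2) openin_open by metis
  have "((\<lambda>t::real. z + t *\<^sub>R v) \<longlongrightarrow> z + 0 *\<^sub>R v) (nhds 0)"
    by (intro tendsto_intros filterlim_ident)
  then have "\<forall>\<^sub>F t in nhds (0::real). z + t *\<^sub>R v \<in> T"
    using T assms(3) by (simp add: topological_tendstoD)
  then show ?thesis
    using T assms by (auto elim!: eventually_mono simp: subspace_add subspace_scale)
qed

lemma has_vector_derivative_cong_nhds: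
  assumes "\<forall>\<^sub>F t in nhds x. f t = g t"
  shows "(f has_vector_derivative D) (at x) \<longleftrightarrow> (g has_vector_derivative D) (at x)"
  using assms eventually_nhds_x_imp_x[OF assms]
  by (intro has_vector_derivative_cong_ev) (auto elim: eventually_mono)

lemma dir_deriv_cong_line:
  assumes "\<forall>\<^sub>F t in nhds 0. f (z + t *\<^sub>R v) = g (z + t *\<^sub>R v)"
  shows "dir_deriv f z v = dir_deriv g z v"
  unfolding dir_deriv_def
  using assms by (intro vector_derivative_cong_eq) (auto elim: eventually_mono)

lemma dir_deriv_cong:
  fixes z :: "'e::real_normed_vector"
  assumes "subspace L" "openin (top_of_set L) S" "z \<in> S" "v \<in> L" "\<And>y. y \<in> S \<Longrightarrow> f y = g y"
  shows "dir_deriv f z v = dir_deriv g z v"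
  using line_in_open[OF assms(1-4)] assms(5)
  by (intro dir_deriv_cong_line) (auto elim: eventually_mono)

lemma differentiable_cong_line:
  fixes f g :: "'e::real_normed_vector \<Rightarrow> 'f::real_normed_vector"
  assumes "\<forall>\<^sub>F t in nhds 0. f (z + t *\<^sub>R v) = g (z + t *\<^sub>R v)"
    and "(\<lambda>t. f (z + t *\<^sub>R v)) differentiable (at (0::real))"
  shows "(\<lambda>t. g (z + t *\<^sub>R v)) differentiable (at (0::real))"
proof -
  have "((\<lambda>t. f (z + t *\<^sub>R v)) has_vector_derivative dir_deriv f z v) (at 0)"
    using assms(2) by (rule has_dir_deriv)
  then have "((\<lambda>t. g (z + t *\<^sub>R v)) has_vector_derivative dir_deriv f z v) (at 0)"
    using has_vector_derivative_cong_nhds[OF assms(1)] by blast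
  then show ?thesis by (rule differentiableI_vector)
qed

text \<open>Derivatives along \<open>L\<close> at points of \<open>S\<close> see only values on
  \<open>S\<close>, so equality on \<open>S\<close> is inherited by all directional derivatives and
  the induction runs over both functions at once.\<close>

lemma Ck_on_cong:
  fixes f g :: "'e::real_normed_vector \<Rightarrow> 'f::real_normed_vector"
  assumes L: "subspace L" "openin (top_of_set L) S"
    and "\<And>y. y \<in> S \<Longrightarrow> f y = g y" "Ck_on k L S f"
  shows "Ck_on k L S g"
  using assms(3,4)
proof (induction k arbitrary: f g)
  case 0
  then show ?case by (metis Ck_on.simps(1) continuous_on_cong)
next
  case (Suc k)
  have "(\<lambda>t. g (z + t *\<^sub>R v)) differentiable (at (0::real))" if "z \<in> S" "v \<in> L" for z v
    using Suc.prems that line_in_open[OF L that]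
    by (intro differentiable_cong_line[of f z v g]) (auto elim: eventually_mono)
  moreover have "Ck_on k L S (\<lambda>z. dir_deriv g z v)" if "v \<in> L" for v
  proof (rule Suc.IH)
    show "dir_deriv f y v = dir_deriv g y v" if "y \<in> S" for y
      by (rule dir_deriv_cong[OF L that \<open>v \<in> L\<close> Suc.prems(1)])
    show "Ck_on k L S (\<lambda>z. dir_deriv f z v)" using Suc.prems(2) that by simp
  qed
  moreover have "continuous_on S g"
    using Suc.prems by (metis Ck_on.simps(2) continuous_on_cong)
  ultimately show ?case by simp
qed

text \<open>Replaces the existence statements in \<open>Ck_on\<close> by an explicit formula
  \<open>D\<close> for the derivative; the sum, product, chain and integral rules below all follow
  this pattern.\<close>

lemma Ck_on_SucI:
  fixes f :: "'e::real_normed_vector \<Rightarrow> 'f::real_normed_vector"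
  assumes L: "subspace L" "openin (top_of_set L) S" and cont: "continuous_on S f"
    and der: "\<And>z v. z \<in> S \<Longrightarrow> v \<in> L \<Longrightarrow> ((\<lambda>t. f (z + t *\<^sub>R v)) has_vector_derivative D z v) (at 0)"
    and D: "\<And>v. v \<in> L \<Longrightarrow> Ck_on k L S (\<lambda>z. D z v)"
  shows "Ck_on (Suc k) L S f"
proof -
  have "Ck_on k L S (\<lambda>z. dir_deriv f z v)" if "v \<in> L" for v
  proof (rule Ck_on_cong[OF L])
    show "D y v = dir_deriv f y v" if "y \<in> S" for y
      using dir_deriv_eqI[OF der[OF that \<open>v \<in> L\<close>]] by simp
  qed (rule D[OF that])
  moreover have "(\<lambda>t. f (z + t *\<^sub>R v)) differentiable (at 0)" if "z \<in> S" "v \<in> L" for z v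
    using der[OF that] by (rule differentiableI_vector)
  ultimately show ?thesis using cont by simp
qed

lemma smooth_on_cong:
  assumes "subspace L" "openin (top_of_set L) S" "\<And>y. y \<in> S \<Longrightarrow> f y = g y" "smooth_on L S f"
  shows "smooth_on L S g"
  using assms unfolding smooth_on_def by (metis Ck_on_cong)

text \<open>The derivative clauses of \<open>Ck_on\<close> are pointwise, so only continuity has to
  be glued. It serves where a function is described by different charts near different
  points.\<close>

lemma Ck_on_local:
  assumes "\<And>z. z \<in> S \<Longrightarrow> \<exists>U. z \<in> U \<and> openin (top_of_set S) U \<and> Ck_on k L U f"
  shows "Ck_on k L S f"
proof -
  have cont: "continuous_on S h"
    if loc: "\<And>z. z \<in> S \<Longrightarrow> \<exists>U. z \<in> U \<and> openin (top_of_set S) U \<and> continuous_on U h"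
    for h :: "'a \<Rightarrow> 'b"
    unfolding continuous_on_eq_continuous_within
  proof
    fix z assume "z \<in> S"
    then obtain U T where U: "z \<in> U" "continuous_on U h" "open T" "U = S \<inter> T"
      using loc openin_open by metis
    then have "continuous (at z within S \<inter> T) h"
      by (metis continuous_on_eq_continuous_within)
    moreover have "at z within S \<inter> T = at z within S"
      using U by (intro at_within_nhd[of z T]) auto
    ultimately show "continuous (at z within S) h" by simp
  qed
  show ?thesis
    using assms
  proof (induction k arbitrary: f)
    case 0
    then show ?case using cont by auto
  next
    case (Suc k)
    have "(\<lambda>t. f (z + t *\<^sub>R v)) differentiable (at (0::real))" if "z \<in> S" "v \<in> L" for z v
      using Suc.prems that by (metis Ck_on.simps(2))
    moreover have "Ck_on k L S (\<lambda>z. dir_deriv f z v)" if "v \<in> L" for v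
      by (rule Suc.IH) (use Suc.prems that in \<open>metis Ck_on.simps(2)\<close>)
    moreover have "continuous_on S f"
      using Suc.prems by (intro cont) (metis Ck_on.simps(2))
    ultimately show ?case by simp
  qed
qed

lemma smooth_on_local:
  assumes "\<And>z. z \<in> S \<Longrightarrow> \<exists>U. z \<in> U \<and> openin (top_of_set S) U \<and> smooth_on L U f"
  shows "smooth_on L S f"
  using assms unfolding smooth_on_def by (metis Ck_on_local)

section \<open>Sums, products and linear images\<close>

lemma Ck_on_const: "Ck_on k L S (\<lambda>z. c)"
proof (induction k arbitrary: c)
  case (Suc k)
  have "dir_deriv (\<lambda>z. c) z v = 0" for z v :: 'a
    by (rule dir_deriv_eqI) simp
  then show ?case by (simp add: Suc.IH)
qed simp

lemma smooth_on_const: "smooth_on L S (\<lambda>z. c)"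
  by (simp add: smooth_on_def Ck_on_const)

lemma Ck_on_add:
  assumes L: "subspace L" "openin (top_of_set L) S"
    and "Ck_on k L S f" "Ck_on k L S g"
  shows "Ck_on k L S (\<lambda>z. f z + g z)"
  using assms(3,4)
proof (induction k arbitrary: f g)
  case 0
  then show ?case by (simp add: continuous_on_add)
next
  case (Suc k)
  have 1: "((\<lambda>t. f (z + t *\<^sub>R v) + g (z + t *\<^sub>R v)) has_vector_derivative
      dir_deriv f z v + dir_deriv g z v) (at 0)" if "z \<in> S" "v \<in> L" for z v
    using Suc.prems that by (intro has_vector_derivative_add has_dir_deriv) auto
  show ?case
  proof (rule Ck_on_SucI[OF L _ 1])
    show "continuous_on S (\<lambda>z. f z + g z)" using Suc.prems by (simp add: continuous_on_add)
    show "Ck_on k L S (\<lambda>z. dir_deriv f z v + dir_deriv g z v)" if "v \<in> L" for v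
      by (rule Suc.IH) (use Suc.prems that in simp_all)
  qed
qed

lemma smooth_on_add:
  "subspace L \<Longrightarrow> openin (top_of_set L) S \<Longrightarrow> smooth_on L S f \<Longrightarrow> smooth_on L S g \<Longrightarrow>
    smooth_on L S (\<lambda>z. f z + g z)"
  unfolding smooth_on_def using Ck_on_add by blast

lemma Ck_on_sum:
  assumes L: "subspace L" "openin (top_of_set L) S"
    and "\<And>i. i \<in> I \<Longrightarrow> Ck_on k L S (f i)"
  shows "Ck_on k L S (\<lambda>z. \<Sum>i\<in>I. f i z)"
  using assms(3)
  by (induction I rule: infinite_finite_induct) (auto intro!: Ck_on_const Ck_on_add[OF L])

lemma Ck_on_scaleR:
  assumes L: "subspace L" "openin (top_of_set L) S"
    and "Ck_on k L S f" "Ck_on k L S g"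
  shows "Ck_on k L S (\<lambda>z. f z *\<^sub>R g z)"
  using assms(3,4)
proof (induction k arbitrary: f g)
  case 0
  then show ?case by (simp add: continuous_on_scaleR)
next
  case (Suc k)
  have 1: "((\<lambda>t. f (z + t *\<^sub>R v) *\<^sub>R g (z + t *\<^sub>R v)) has_vector_derivative
      f z *\<^sub>R dir_deriv g z v + dir_deriv f z v *\<^sub>R g z) (at 0)" if "z \<in> S" "v \<in> L" for z v
  proof -
    have "((\<lambda>t. f (z + t *\<^sub>R v)) has_vector_derivative dir_deriv f z v) (at 0)"
      "((\<lambda>t. g (z + t *\<^sub>R v)) has_vector_derivative dir_deriv g z v) (at 0)"
      using Suc.prems that by (auto intro: has_dir_deriv)
    from bounded_bilinear.has_vector_derivative[OF bounded_bilinear_scaleR this]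
    show ?thesis by simp
  qed
  show ?case
  proof (rule Ck_on_SucI[OF L _ 1])
    show "continuous_on S (\<lambda>z. f z *\<^sub>R g z)" using Suc.prems by (simp add: continuous_on_scaleR)
    show "Ck_on k L S (\<lambda>z. f z *\<^sub>R dir_deriv g z v + dir_deriv f z v *\<^sub>R g z)" if "v \<in> L" for v
      using Suc.prems[THEN Ck_on_Suc_imp] Suc.prems that
      by (intro Ck_on_add[OF L] Suc.IH) simp_all
  qed
qed

lemma smooth_on_scaleR:
  "subspace L \<Longrightarrow> openin (top_of_set L) S \<Longrightarrow> smooth_on L S f \<Longrightarrow> smooth_on L S g \<Longrightarrow>
    smooth_on L S (\<lambda>z. f z *\<^sub>R g z)"
  unfolding smooth_on_def using Ck_on_scaleR by blast

lemma Ck_on_bounded_linear: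
  assumes L: "subspace L" "openin (top_of_set L) S"
    and "bounded_linear T" "Ck_on k L S f"
  shows "Ck_on k L S (\<lambda>z. T (f z))"
  using assms(4)
proof (induction k arbitrary: f)
  case 0
  then show ?case by (simp add: bounded_linear.continuous_on[OF assms(3)])
next
  case (Suc k)
  have 1: "((\<lambda>t. T (f (z + t *\<^sub>R v))) has_vector_derivative T (dir_deriv f z v)) (at 0)"
    if "z \<in> S" "v \<in> L" for z v
    using Suc.prems that
    by (intro bounded_linear.has_vector_derivative[OF assms(3)] has_dir_deriv) auto
  show ?case
  proof (rule Ck_on_SucI[OF L _ 1])
    show "continuous_on S (\<lambda>z. T (f z))"
      using Suc.prems by (simp add: bounded_linear.continuous_on[OF assms(3)])
    show "Ck_on k L S (\<lambda>z. T (dir_deriv f z v))" if "v \<in> L" for v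
      by (rule Suc.IH) (use Suc.prems that in simp)
  qed
qed

lemma smooth_on_bounded_linear:
  "subspace L \<Longrightarrow> openin (top_of_set L) S \<Longrightarrow> bounded_linear T \<Longrightarrow> smooth_on L S f \<Longrightarrow>
    smooth_on L S (\<lambda>z. T (f z))"
  unfolding smooth_on_def using Ck_on_bounded_linear by blast

section \<open>Total derivatives and the chain rule\<close>

text \<open>A device used throughout: a varying vector of \<open>L\<close> is written as a sum of
  fixed directions with scalar coefficients, to which statements about fixed directions
  apply.\<close>

lemma orthonormal_basis:
  fixes L :: "'e::euclidean_space set"
  assumes "subspace L"
  obtains B where "finite B" "B \<subseteq> L" "\<And>b. b \<in> B \<Longrightarrow> norm b = 1"
    "\<And>v. v \<in> L \<Longrightarrow> (\<Sum>b\<in>B. (v \<bullet> b) *\<^sub>R b) = v"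
proof -
  obtain B where B: "B \<subseteq> L" "pairwise orthogonal B" "\<And>x. x \<in> B \<Longrightarrow> norm x = 1"
      "independent B" "span B = L"
    using orthonormal_basis_subspace[OF assms] by metis
  show ?thesis
  proof
    show fin: "finite B" using B(4) by (simp add: independent_imp_finite)
    fix v assume "v \<in> L"
    then obtain u where "v = (\<Sum>b\<in>B. u b *\<^sub>R b)"
      using B(5) fin by (auto simp: span_finite)
    moreover have "(\<Sum>b'\<in>B. u b' *\<^sub>R b') \<bullet> b = u b" if "b \<in> B" for b
    proof -
      have "(\<Sum>b'\<in>B. u b' *\<^sub>R b') \<bullet> b = (\<Sum>b'\<in>B. if b' = b then u b else 0)"
        unfolding inner_sum_left
        using B(2,3) that
        by (intro sum.cong) (auto simp: pairwise_def orthogonal_def dot_square_norm)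
      then show ?thesis using fin that by simp
    qed
    ultimately show "(\<Sum>b\<in>B. (v \<bullet> b) *\<^sub>R b) = v" by simp
  qed (use B in auto)
qed

text \<open>The orthogonal projection onto \<open>L\<close>, written in an orthonormal basis, fixes
  the curve near 0; differentiating shows that it fixes the derivative.\<close>

lemma has_vector_derivative_in_subspace:
  fixes \<gamma> :: "real \<Rightarrow> 'e::euclidean_space"
  assumes "subspace L" "(\<gamma> has_vector_derivative w) (at 0)" "\<forall>\<^sub>F t in nhds 0. \<gamma> t \<in> L"
  shows "w \<in> L"
proof -
  obtain B where B: "finite B" "B \<subseteq> L" "\<And>b. b \<in> B \<Longrightarrow> norm b = 1"
      "\<And>v. v \<in> L \<Longrightarrow> (\<Sum>b\<in>B. (v \<bullet> b) *\<^sub>R b) = v"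
    using orthonormal_basis[OF assms(1)] by metis
  have "((\<lambda>t. \<Sum>b\<in>B. (\<gamma> t \<bullet> b) *\<^sub>R b) has_vector_derivative (\<Sum>b\<in>B. (w \<bullet> b) *\<^sub>R b)) (at 0)"
    by (intro bounded_linear.has_vector_derivative[OF _ assms(2)] bounded_linear_sum
        bounded_linear_scaleR_const bounded_linear_inner_left)
  moreover have "\<forall>\<^sub>F t in nhds 0. (\<Sum>b\<in>B. (\<gamma> t \<bullet> b) *\<^sub>R b) = \<gamma> t"
    using assms(3) B(4) by (auto elim: eventually_mono)
  ultimately have "(\<gamma> has_vector_derivative (\<Sum>b\<in>B. (w \<bullet> b) *\<^sub>R b)) (at 0)"
    using has_vector_derivative_cong_nhds[of "\<lambda>t. \<Sum>b\<in>B. (\<gamma> t \<bullet> b) *\<^sub>R b" \<gamma> 0] by blast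
  then have "w = (\<Sum>b\<in>B. (w \<bullet> b) *\<^sub>R b)"
    using assms(2) vector_derivative_unique_at by blast
  then show ?thesis
    using assms(1) B(2) by (metis (no_types, lifting) subsetD subspace_scale subspace_sum)
qed

lemma line_has_vector_derivative:
  assumes "(\<lambda>t. f (z + t0 *\<^sub>R v + t *\<^sub>R v)) differentiable (at (0::real))"
  shows "((\<lambda>t. f (z + t *\<^sub>R v)) has_vector_derivative dir_deriv f (z + t0 *\<^sub>R v) v) (at t0)"
proof -
  have "((\<lambda>t. t - t0) has_vector_derivative 1) (at t0)"
    by (auto intro!: derivative_eq_intros)
  moreover have "((\<lambda>t. f (z + t0 *\<^sub>R v + t *\<^sub>R v)) has_vector_derivative
      dir_deriv f (z + t0 *\<^sub>R v) v) (at (t0 - t0))"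
    using has_dir_deriv[OF assms] by simp
  ultimately show ?thesis
    by (drule_tac vector_diff_chain_at) (auto simp: o_def algebra_simps)
qed

text \<open>Mean value inequality for \<open>\<phi> t - t *\<^sub>R m\<close>, whose derivative is
  bounded by \<open>e\<close>. The closed segment and the absolute value allow \<open>T\<close> to
  be negative.\<close>

lemma segment_bound:
  fixes \<phi> :: "real \<Rightarrow> 'f::real_normed_vector"
  assumes "\<And>t. t \<in> closed_segment 0 T \<Longrightarrow> (\<phi> has_vector_derivative \<phi>' t) (at t)"
    and "\<And>t. t \<in> closed_segment 0 T \<Longrightarrow> norm (\<phi>' t - m) \<le> e"
  shows "norm (\<phi> T - \<phi> 0 - T *\<^sub>R m) \<le> e * \<bar>T\<bar>"
proof -
  have "norm ((\<phi> T - T *\<^sub>R m) - (\<phi> 0 - 0 *\<^sub>R m)) \<le> e * norm (T - 0)"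
  proof (rule differentiable_bound[of "closed_segment 0 T" _ "\<lambda>t h. h *\<^sub>R (\<phi>' t - m)"])
    fix t assume t: "t \<in> closed_segment 0 T"
    have "((\<lambda>t. \<phi> t - t *\<^sub>R m) has_vector_derivative \<phi>' t - m) (at t)"
      using assms(1)[OF t] by (auto intro!: derivative_eq_intros)
    then show "((\<lambda>t. \<phi> t - t *\<^sub>R m) has_derivative (\<lambda>h. h *\<^sub>R (\<phi>' t - m))) (at t within closed_segment 0 T)"
      unfolding has_vector_derivative_def by (rule has_derivative_at_withinI)
    show "onorm (\<lambda>h. h *\<^sub>R (\<phi>' t - m)) \<le> e"
      using assms(2)[OF t] norm_ge_zero[of "\<phi>' t - m"]
      by (intro onorm_bound) (auto simp: mult.commute[of e] intro: mult_left_mono simp del: norm_ge_zero)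
  qed auto
  then show ?thesis by (simp add: algebra_simps)
qed

text \<open>The end point is reached from \<open>z\<close> by a polygon parallel to the basis
  vectors, one edge per induction step, and \<open>segment_bound\<close> applies on each edge. The
  bound on the sum of the \<open>\<bar>h b\<bar>\<close> keeps the polygon in the ball.\<close>

lemma C1_estimate:
  fixes f :: "'e::euclidean_space \<Rightarrow> 'f::real_normed_vector"
  assumes L: "subspace L" and C1: "Ck_on 1 L S f" and S: "L \<inter> ball z r \<subseteq> S" and z: "z \<in> L"
    and B: "B \<subseteq> L" "\<And>b. b \<in> B \<Longrightarrow> norm b = 1" and "finite C" "C \<subseteq> B"
    and e: "\<And>y b. y \<in> L \<Longrightarrow> y \<in> ball z r \<Longrightarrow> b \<in> B \<Longrightarrow>
      norm (dir_deriv f y b - dir_deriv f z b) \<le> e"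
    and "(\<Sum>b\<in>C. \<bar>h b\<bar>) < r"
  shows "norm (f (z + (\<Sum>b\<in>C. h b *\<^sub>R b)) - f z - (\<Sum>b\<in>C. h b *\<^sub>R dir_deriv f z b))
    \<le> e * (\<Sum>b\<in>C. \<bar>h b\<bar>)"
  using assms(7,8,10)
proof (induction C rule: finite_induct)
  case (insert b C)
  define u where "u = z + (\<Sum>b\<in>C. h b *\<^sub>R b)"
  have IH: "norm (f u - f z - (\<Sum>b\<in>C. h b *\<^sub>R dir_deriv f z b)) \<le> e * (\<Sum>b\<in>C. \<bar>h b\<bar>)"
    unfolding u_def using insert by (intro insert.IH) auto
  have uL: "u \<in> L"
    unfolding u_def using L z insert.prems B(1)
    by (intro subspace_add subspace_sum subspace_scale) auto
  have bL: "b \<in> L" "norm b = 1" "b \<in> B" using insert.prems B by auto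
  have norm_C: "norm (\<Sum>b\<in>C. h b *\<^sub>R b) \<le> (\<Sum>b\<in>C. \<bar>h b\<bar>)"
    using insert.prems B(2) by (intro order_trans[OF norm_sum] sum_mono) auto
  have seg: "u + t *\<^sub>R b \<in> L" "u + t *\<^sub>R b \<in> ball z r" if "t \<in> closed_segment 0 (h b)" for t
  proof -
    show "u + t *\<^sub>R b \<in> L" using L uL bL by (simp add: subspace_add subspace_scale)
    have "\<bar>t\<bar> \<le> \<bar>h b\<bar>" using that by (auto simp: closed_segment_eq_real_ivl split: if_splits)
    then have "norm ((\<Sum>b\<in>C. h b *\<^sub>R b) + t *\<^sub>R b) \<le> (\<Sum>b\<in>C. \<bar>h b\<bar>) + \<bar>h b\<bar>"
      using norm_C bL by (intro norm_triangle_mono) auto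
    also have "\<dots> < r" using insert.prems insert.hyps by simp
    finally show "u + t *\<^sub>R b \<in> ball z r"
      unfolding u_def mem_ball dist_norm norm_minus_commute[of z] by (simp add: algebra_simps)
  qed
  have "norm (f (u + h b *\<^sub>R b) - f (u + 0 *\<^sub>R b) - h b *\<^sub>R dir_deriv f z b) \<le> e * \<bar>h b\<bar>"
  proof (rule segment_bound[where \<phi>' = "\<lambda>t. dir_deriv f (u + t *\<^sub>R b) b"])
    fix t assume t: "t \<in> closed_segment 0 (h b)"
    show "((\<lambda>t. f (u + t *\<^sub>R b)) has_vector_derivative dir_deriv f (u + t *\<^sub>R b) b) (at t)"
      using C1 seg[OF t] S bL by (intro line_has_vector_derivative) auto
    show "norm (dir_deriv f (u + t *\<^sub>R b) b - dir_deriv f z b) \<le> e"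
      using seg[OF t] bL by (intro e) auto
  qed
  with IH have "norm ((f (u + h b *\<^sub>R b) - f u - h b *\<^sub>R dir_deriv f z b) +
      (f u - f z - (\<Sum>b\<in>C. h b *\<^sub>R dir_deriv f z b))) \<le> e * \<bar>h b\<bar> + e * (\<Sum>b\<in>C. \<bar>h b\<bar>)"
    by (intro norm_triangle_mono) auto
  then show ?case
    using insert.hyps by (simp add: u_def algebra_simps)
qed auto

text \<open>The classical passage from continuous partial derivatives to a total derivative,
  relative to \<open>L\<close>: the candidate is built from the derivatives along an orthonormal
  basis.\<close>

lemma Ck1_has_derivative:
  fixes f :: "'e::euclidean_space \<Rightarrow> 'f::real_normed_vector"
  assumes L: "subspace L" "openin (top_of_set L) S" and C1: "Ck_on 1 L S f" and z: "z \<in> S"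
    and B: "finite B" "B \<subseteq> L" "\<And>b. b \<in> B \<Longrightarrow> norm b = 1"
      "\<And>v. v \<in> L \<Longrightarrow> (\<Sum>b\<in>B. (v \<bullet> b) *\<^sub>R b) = v"
  shows "(f has_derivative (\<lambda>v. \<Sum>b\<in>B. (v \<bullet> b) *\<^sub>R dir_deriv f z b)) (at z within S)"
  unfolding has_derivative_within_alt
proof (intro conjI allI impI)
  show "bounded_linear (\<lambda>v. \<Sum>b\<in>B. (v \<bullet> b) *\<^sub>R dir_deriv f z b)"
    by (intro bounded_linear_sum bounded_linear_scaleR_const bounded_linear_inner_left)
  fix e :: real assume "e > 0"
  \<comment> \<open>The coordinates of \<open>y - z\<close> have total absolute value at most
    \<open>card B * norm (y - z)\<close>, so this share of \<open>e\<close> suffices; the 1 in the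
    denominator covers the empty basis. The radius \<open>\<delta>\<close> below is scaled in the
    same way.\<close>
  define e' where "e' = e / (1 + card B)"
  have e': "e' > 0" using \<open>e > 0\<close> by (simp add: e'_def add_pos_nonneg)
  obtain T where T: "open T" "S = L \<inter> T" using L(2) openin_open by metis
  have "\<forall>\<^sub>F y in at z within S. norm (dir_deriv f y b - dir_deriv f z b) < e'" if "b \<in> B" for b
  proof -
    have "continuous_on S (\<lambda>y. dir_deriv f y b)" using C1 B that by auto
    then have "((\<lambda>y. dir_deriv f y b) \<longlongrightarrow> dir_deriv f z b) (at z within S)"
      using z by (auto simp: continuous_on_def)
    then show ?thesis using e' by (auto dest!: tendstoD simp: dist_norm)
  qed
  then have "\<forall>\<^sub>F y in at z within S. \<forall>b\<in>B. norm (dir_deriv f y b - dir_deriv f z b) < e'"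
    using B(1) by (simp add: eventually_ball_finite)
  then obtain r1 where r1: "r1 > 0" "\<And>y b. y \<in> S \<Longrightarrow> y \<noteq> z \<Longrightarrow> dist y z < r1 \<Longrightarrow> b \<in> B \<Longrightarrow>
      norm (dir_deriv f y b - dir_deriv f z b) < e'"
    unfolding eventually_at by metis
  obtain r2 where r2: "r2 > 0" "ball z r2 \<subseteq> T" using T z by (metis IntE open_contains_ball)
  define r where "r = min r1 r2"
  define \<delta> where "\<delta> = r / (1 + card B)"
  have "\<delta> > 0" using r1 r2 by (simp add: r_def \<delta>_def add_pos_nonneg)
  show "\<exists>d>0. \<forall>y\<in>S. norm (y - z) < d \<longrightarrow>
      norm (f y - f z - (\<Sum>b\<in>B. ((y - z) \<bullet> b) *\<^sub>R dir_deriv f z b)) \<le> e * norm (y - z)"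
  proof (intro exI conjI ballI impI)
    fix y assume y: "y \<in> S" "norm (y - z) < \<delta>"
    have yz: "y - z \<in> L" using y z T L(1) by (auto intro: subspace_diff)
    have "\<bar>(y - z) \<bullet> b\<bar> \<le> norm (y - z)" if "b \<in> B" for b
      using Cauchy_Schwarz_ineq2[of "y - z" b] B(3)[OF that] by simp
    then have sum_le: "(\<Sum>b\<in>B. \<bar>(y - z) \<bullet> b\<bar>) \<le> card B * norm (y - z)"
      by (metis (no_types, lifting) sum_bounded_above)
    also have "\<dots> \<le> card B * \<delta>" using y by (intro mult_left_mono) auto
    also have "\<dots> < (1 + card B) * \<delta>" using \<open>\<delta> > 0\<close> by simp
    also have "\<dots> = r" by (simp add: \<delta>_def add_nonneg_eq_0_iff)
    finally have "(\<Sum>b\<in>B. \<bar>(y - z) \<bullet> b\<bar>) < r" .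
    then have "norm (f (z + (\<Sum>b\<in>B. ((y - z) \<bullet> b) *\<^sub>R b)) - f z -
        (\<Sum>b\<in>B. ((y - z) \<bullet> b) *\<^sub>R dir_deriv f z b)) \<le> e' * (\<Sum>b\<in>B. \<bar>(y - z) \<bullet> b\<bar>)"
    proof (intro C1_estimate[OF L(1) C1 _ _ B(2,3,1)])
      show "L \<inter> ball z r \<subseteq> S" using r2 T by (auto simp: r_def)
      show "norm (dir_deriv f y b - dir_deriv f z b) \<le> e'" if "y \<in> L" "y \<in> ball z r" "b \<in> B" for y b
        using that r1(2)[of y b] r2 T e' by (cases "y = z") (auto simp: r_def dist_commute subset_iff less_imp_le)
    qed (use z T in auto)
    also have "e' * (\<Sum>b\<in>B. \<bar>(y - z) \<bullet> b\<bar>) \<le> e' * (card B * norm (y - z))"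
      using sum_le e' by (intro mult_left_mono) auto
    also have "\<dots> = (e' * card B) * norm (y - z)" by simp
    also have "\<dots> \<le> e * norm (y - z)"
      using \<open>e > 0\<close> by (intro mult_right_mono) (auto simp: e'_def field_simps)
    finally show "norm (f y - f z - (\<Sum>b\<in>B. ((y - z) \<bullet> b) *\<^sub>R dir_deriv f z b)) \<le> e * norm (y - z)"
      using B(4)[OF yz] by simp
  qed fact
qed

text \<open>The total derivative is available only within \<open>S\<close>, so the curve is
  restricted to an open set of times that it maps into \<open>S\<close>.\<close>

lemma has_vector_derivative_chain_within:
  fixes f :: "'e::real_normed_vector \<Rightarrow> 'f::real_normed_vector" and \<gamma> :: "real \<Rightarrow> 'e"
  assumes "(f has_derivative f') (at (\<gamma> 0) within S)"
    and "(\<gamma> has_vector_derivative w) (at 0)" and ev: "\<forall>\<^sub>F t in nhds 0. \<gamma> t \<in> S"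
  shows "((\<lambda>t. f (\<gamma> t)) has_vector_derivative f' w) (at 0)"
proof -
  obtain U where U: "open U" "0 \<in> U" "\<And>t. t \<in> U \<Longrightarrow> \<gamma> t \<in> S"
    using ev unfolding eventually_nhds by blast
  have "(\<gamma> has_derivative (\<lambda>h. h *\<^sub>R w)) (at 0 within U)"
    using assms(2) unfolding has_vector_derivative_def by (rule has_derivative_at_withinI)
  moreover have "(f has_derivative f') (at (\<gamma> 0) within \<gamma> ` U)"
    using assms(1) U by (auto intro: has_derivative_subset)
  ultimately have "((f \<circ> \<gamma>) has_derivative (f' \<circ> (\<lambda>h. h *\<^sub>R w))) (at 0 within U)"
    by (rule diff_chain_within)
  moreover have "f' \<circ> (\<lambda>h. h *\<^sub>R w) = (\<lambda>h. h *\<^sub>R f' w)"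
    using has_derivative_bounded_linear[OF assms(1)]
    by (auto simp: bounded_linear.linear linear_scale)
  ultimately have "((f \<circ> \<gamma>) has_derivative (\<lambda>h. h *\<^sub>R f' w)) (at 0 within U)" by metis
  then show ?thesis
    unfolding has_vector_derivative_def at_within_open[OF U(2,1)] o_def .
qed

text \<open>Linearity in the direction is not part of \<open>Ck_on\<close>; it comes from the total
  derivative.\<close>

lemma dir_deriv_basis_expansion:
  fixes f :: "'e::euclidean_space \<Rightarrow> 'f::real_normed_vector"
  assumes L: "subspace L" "openin (top_of_set L) S" and C1: "Ck_on 1 L S f" and z: "z \<in> S"
    and B: "finite B" "B \<subseteq> L" "\<And>b. b \<in> B \<Longrightarrow> norm b = 1"
      "\<And>v. v \<in> L \<Longrightarrow> (\<Sum>b\<in>B. (v \<bullet> b) *\<^sub>R b) = v"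
    and v: "v \<in> L"
  shows "dir_deriv f z v = (\<Sum>b\<in>B. (v \<bullet> b) *\<^sub>R dir_deriv f z b)"
proof (rule dir_deriv_eqI)
  show "((\<lambda>t. f (z + t *\<^sub>R v)) has_vector_derivative (\<Sum>b\<in>B. (v \<bullet> b) *\<^sub>R dir_deriv f z b)) (at 0)"
    by (rule has_vector_derivative_chain_within[where S = S])
      (use Ck1_has_derivative[OF L C1 z B] line_in_open[OF L z v] in
        \<open>auto intro!: derivative_eq_intros\<close>)
qed

lemma dir_deriv_chain:
  fixes f :: "'e::euclidean_space \<Rightarrow> 'f::real_normed_vector" and \<gamma> :: "real \<Rightarrow> 'e"
  assumes L: "subspace L" "openin (top_of_set L) S" and C1: "Ck_on 1 L S f"
    and \<gamma>: "(\<gamma> has_vector_derivative w) (at 0)" "\<forall>\<^sub>F t in nhds 0. \<gamma> t \<in> S"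
  shows "((\<lambda>t. f (\<gamma> t)) has_vector_derivative dir_deriv f (\<gamma> 0) w) (at 0)"
proof -
  obtain B where B: "finite B" "B \<subseteq> L" "\<And>b. b \<in> B \<Longrightarrow> norm b = 1"
      "\<And>v. v \<in> L \<Longrightarrow> (\<Sum>b\<in>B. (v \<bullet> b) *\<^sub>R b) = v"
    using orthonormal_basis[OF L(1)] by metis
  have z: "\<gamma> 0 \<in> S" using \<gamma>(2) by (rule eventually_nhds_x_imp_x)
  have "S \<subseteq> L" using L(2) openin_imp_subset by blast
  then have "w \<in> L"
    using \<gamma> by (intro has_vector_derivative_in_subspace[OF L(1)]) (auto elim: eventually_mono)
  then show ?thesis
    using has_vector_derivative_chain_within[OF Ck1_has_derivative[OF L C1 z B] \<gamma>]
      dir_deriv_basis_expansion[OF L C1 z B] by simp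
qed

lemma dir_deriv_in_subspace:
  fixes f :: "'e::real_normed_vector \<Rightarrow> 'f::euclidean_space"
  assumes "subspace L" "openin (top_of_set L) S" "z \<in> S" "v \<in> L"
    and "subspace L'" "f ` S \<subseteq> L'" "(\<lambda>t. f (z + t *\<^sub>R v)) differentiable (at (0::real))"
  shows "dir_deriv f z v \<in> L'"
  using line_in_open[OF assms(1-4)] assms(6)
  by (intro has_vector_derivative_in_subspace[OF assms(5) has_dir_deriv[OF assms(7)]])
    (auto elim!: eventually_mono)

text \<open>In the chain rule the direction \<open>dir_deriv g z v\<close> depends on
  \<open>z\<close>. Expanding it in a basis of \<open>L\<close> turns the derivative into a finite
  sum of scalar coefficients times \<open>dir_deriv f (g z) b\<close> with \<open>b\<close> fixed,
  and the induction hypothesis applies to the latter.\<close>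

lemma Ck_on_compose:
  fixes f :: "'e::euclidean_space \<Rightarrow> 'f::real_normed_vector" and g :: "'d::real_normed_vector \<Rightarrow> 'e"
  assumes L: "subspace L" "openin (top_of_set L) S" and L': "subspace L'" "openin (top_of_set L') S'"
    and "g ` S' \<subseteq> S" "Ck_on k L S f" "Ck_on k L' S' g"
  shows "Ck_on k L' S' (\<lambda>z. f (g z))"
  using assms(6,7)
proof (induction k arbitrary: f)
  case 0
  then show ?case using assms(5) by (auto intro: continuous_on_compose2)
next
  case (Suc k)
  obtain B where B: "finite B" "B \<subseteq> L" "\<And>b. b \<in> B \<Longrightarrow> norm b = 1"
      "\<And>v. v \<in> L \<Longrightarrow> (\<Sum>b\<in>B. (v \<bullet> b) *\<^sub>R b) = v"
    using orthonormal_basis[OF L(1)] by metis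
  have C1: "Ck_on 1 L S f" using Suc.prems(1) Ck_on_continuous by fastforce
  have SL: "S \<subseteq> L" using L(2) openin_imp_subset by blast
  have 1: "((\<lambda>t. f (g (z + t *\<^sub>R v))) has_vector_derivative dir_deriv f (g z) (dir_deriv g z v)) (at 0)"
    if "z \<in> S'" "v \<in> L'" for z v
  proof -
    have "((\<lambda>t. g (z + t *\<^sub>R v)) has_vector_derivative dir_deriv g z v) (at 0)"
      using Suc.prems(2) that by (intro has_dir_deriv) simp
    moreover have "\<forall>\<^sub>F t in nhds 0. g (z + t *\<^sub>R v) \<in> S"
      using line_in_open[OF L' that] by (rule eventually_mono) (use assms(5) in blast)
    ultimately show ?thesis using dir_deriv_chain[OF L C1] by fastforce
  qed
  have 2: "((\<lambda>t. f (g (z + t *\<^sub>R v))) has_vector_derivative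
      (\<Sum>b\<in>B. (dir_deriv g z v \<bullet> b) *\<^sub>R dir_deriv f (g z) b)) (at 0)"
    if "z \<in> S'" "v \<in> L'" for z v
  proof -
    have gz: "g z \<in> S" using assms(5) that by blast
    have gv: "dir_deriv g z v \<in> L"
      using Suc.prems(2) that assms(5) SL by (intro dir_deriv_in_subspace[OF L' that L(1)]) auto
    show ?thesis
      using 1[OF that] by (simp add: dir_deriv_basis_expansion[OF L C1 gz B gv])
  qed
  show ?case
  proof (rule Ck_on_SucI[OF L' _ 2])
    show "continuous_on S' (\<lambda>z. f (g z))"
      using Suc.prems assms(5) by (auto intro: continuous_on_compose2)
    show "Ck_on k L' S' (\<lambda>z. \<Sum>b\<in>B. (dir_deriv g z v \<bullet> b) *\<^sub>R dir_deriv f (g z) b)" if "v \<in> L'" for v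
    proof (intro Ck_on_sum[OF L'] Ck_on_scaleR[OF L'] Ck_on_bounded_linear[OF L' bounded_linear_inner_left])
      fix b assume "b \<in> B"
      then have "Ck_on k L S (\<lambda>z. dir_deriv f z b)" using Suc.prems(1) B(2) by auto
      then show "Ck_on k L' S' (\<lambda>z. dir_deriv f (g z) b)"
        using Ck_on_Suc_imp[OF Suc.prems(2)] by (rule Suc.IH)
    qed (use Suc.prems that in simp)
  qed
qed

lemma smooth_on_compose:
  fixes f :: "'e::euclidean_space \<Rightarrow> 'f::real_normed_vector" and g :: "'d::real_normed_vector \<Rightarrow> 'e"
  assumes "subspace L" "openin (top_of_set L) S" "subspace L'" "openin (top_of_set L') S'"
    and "g ` S' \<subseteq> S" "smooth_on L S f" "smooth_on L' S' g"
  shows "smooth_on L' S' (\<lambda>z. f (g z))"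
  using assms unfolding smooth_on_def by (metis Ck_on_compose)

section \<open>Symmetry of second derivatives\<close>

text \<open>The second difference over the parallelogram spanned by \<open>T *\<^sub>R v\<close> and
  \<open>T *\<^sub>R w\<close> is compared with \<open>T * T\<close> times \<open>m\<close>: the
  mean value inequality along \<open>w\<close> bounds the increment of the derivative along
  \<open>v\<close>, and a second one along \<open>v\<close> integrates this bound.\<close>

lemma second_difference_estimate:
  fixes f :: "'e::real_normed_vector \<Rightarrow> 'f::real_normed_vector"
  assumes C2: "Ck_on 2 L S f" and v: "v \<in> L" and w: "w \<in> L" and T: "0 \<le> T"
    and S: "\<And>s t. \<lbrakk>0 \<le> s; s \<le> T; 0 \<le> t; t \<le> T\<rbrakk> \<Longrightarrow> z + s *\<^sub>R v + t *\<^sub>R w \<in> S"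
    and e: "\<And>s t. \<lbrakk>0 \<le> s; s \<le> T; 0 \<le> t; t \<le> T\<rbrakk> \<Longrightarrow>
      norm (dir_deriv (\<lambda>y. dir_deriv f y v) (z + s *\<^sub>R v + t *\<^sub>R w) w - m) \<le> e"
  shows "norm (f (z + T *\<^sub>R v + T *\<^sub>R w) - f (z + T *\<^sub>R v) - f (z + T *\<^sub>R w) + f z - (T * T) *\<^sub>R m)
    \<le> e * T * T"
proof -
  have [simp]: "closed_segment 0 T = {0..T}" using T by (simp add: closed_segment_eq_real_ivl)
  have d1: "((\<lambda>t. f (y + t *\<^sub>R v)) has_vector_derivative dir_deriv f (y + s *\<^sub>R v) v) (at s)"
    if "y + s *\<^sub>R v \<in> S" for y s
    using that C2 v by (intro line_has_vector_derivative) (auto simp: numeral_2_eq_2)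
  have inner: "norm (dir_deriv f (z + s *\<^sub>R v + T *\<^sub>R w) v - dir_deriv f (z + s *\<^sub>R v + 0 *\<^sub>R w) v
      - T *\<^sub>R m) \<le> e * \<bar>T\<bar>" if s: "s \<in> {0..T}" for s
  proof (rule segment_bound[where \<phi>' = "\<lambda>t. dir_deriv (\<lambda>y. dir_deriv f y v) (z + s *\<^sub>R v + t *\<^sub>R w) w"])
    fix t assume t: "t \<in> closed_segment 0 T"
    show "((\<lambda>t. dir_deriv f (z + s *\<^sub>R v + t *\<^sub>R w) v) has_vector_derivative
        dir_deriv (\<lambda>y. dir_deriv f y v) (z + s *\<^sub>R v + t *\<^sub>R w) w) (at t)"
      using S[of s t] s t C2 v w by (intro line_has_vector_derivative) (auto simp: numeral_2_eq_2)
  qed (use s e in auto)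
  have "norm ((f (z + T *\<^sub>R w + T *\<^sub>R v) - f (z + T *\<^sub>R v)) -
      (f (z + T *\<^sub>R w + 0 *\<^sub>R v) - f (z + 0 *\<^sub>R v)) - T *\<^sub>R (T *\<^sub>R m)) \<le> (e * T) * \<bar>T\<bar>"
  proof (rule segment_bound[where \<phi> = "\<lambda>s. f (z + T *\<^sub>R w + s *\<^sub>R v) - f (z + s *\<^sub>R v)" and \<phi>' = "\<lambda>s.
      dir_deriv f (z + T *\<^sub>R w + s *\<^sub>R v) v - dir_deriv f (z + s *\<^sub>R v) v"])
    fix s assume s: "s \<in> closed_segment 0 T"
    show "((\<lambda>s. f (z + T *\<^sub>R w + s *\<^sub>R v) - f (z + s *\<^sub>R v)) has_vector_derivative
        dir_deriv f (z + T *\<^sub>R w + s *\<^sub>R v) v - dir_deriv f (z + s *\<^sub>R v) v) (at s)"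
      using S[of s T] S[of s 0] s T
      by (intro has_vector_derivative_diff d1) (auto simp: add.assoc add.commute add.left_commute)
    show "norm (dir_deriv f (z + T *\<^sub>R w + s *\<^sub>R v) v - dir_deriv f (z + s *\<^sub>R v) v - T *\<^sub>R m) \<le> e * T"
      using inner[of s] s T by (simp add: add.assoc add.commute[of "T *\<^sub>R w"])
  qed
  then show ?thesis using T by (simp add: algebra_simps)
qed

text \<open>The second difference is symmetric in \<open>v\<close> and \<open>w\<close>, so both
  mixed derivatives, multiplied by \<open>T * T\<close>, are within \<open>e * T * T\<close> of it.
  Continuity of the mixed derivatives makes every \<open>e > 0\<close> admissible.\<close>

lemma dir_deriv_symmetric:
  fixes f :: "'e::real_normed_vector \<Rightarrow> 'f::real_normed_vector"
  assumes L: "subspace L" "openin (top_of_set L) S" and C2: "Ck_on 2 L S f"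
    and z: "z \<in> S" and v: "v \<in> L" and w: "w \<in> L"
  shows "dir_deriv (\<lambda>y. dir_deriv f y v) z w = dir_deriv (\<lambda>y. dir_deriv f y w) z v"
    (is "?a = ?b")
proof -
  have "norm (?a - ?b) \<le> 2 * e" if "e > 0" for e
  proof -
    obtain U where U: "open U" "S = L \<inter> U" using L(2) openin_open by metis
    have "\<exists>r>0. \<forall>y\<in>S. dist y z < r \<longrightarrow>
        norm (dir_deriv (\<lambda>y. dir_deriv f y v) y w - dir_deriv (\<lambda>y. dir_deriv f y v) z w) \<le> e"
      if "v \<in> L" "w \<in> L" for v w
    proof -
      have "continuous_on S (\<lambda>y. dir_deriv (\<lambda>y. dir_deriv f y v) y w)"
        using C2 that by (simp add: numeral_2_eq_2)
      then obtain r where "r > 0" "\<forall>y\<in>S. dist y z < r \<longrightarrow>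
          dist (dir_deriv (\<lambda>y. dir_deriv f y v) y w) (dir_deriv (\<lambda>y. dir_deriv f y v) z w) < e"
        using z \<open>e > 0\<close> unfolding continuous_on_iff by blast
      then show ?thesis unfolding dist_norm by (auto intro: less_imp_le)
    qed
    from this[OF v w] this[OF w v] obtain r1 r2 where r: "r1 > 0" "r2 > 0"
      "\<And>y. y \<in> S \<Longrightarrow> dist y z < r1 \<Longrightarrow> norm (dir_deriv (\<lambda>y. dir_deriv f y v) y w - ?a) \<le> e"
      "\<And>y. y \<in> S \<Longrightarrow> dist y z < r2 \<Longrightarrow> norm (dir_deriv (\<lambda>y. dir_deriv f y w) y v - ?b) \<le> e"
      by metis
    obtain r3 where r3: "r3 > 0" "ball z r3 \<subseteq> U" using U z by (metis IntE open_contains_ball)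
    define r where "r = min r1 (min r2 r3)"
    have rpos: "r > 0" using r r3 by (simp add: r_def)
    \<comment> \<open>Small enough for the parallelogram to stay within distance \<open>r\<close> of
      \<open>z\<close>; the 1 keeps the denominator positive when both vectors are zero.\<close>
    define T where "T = r / (1 + norm v + norm w)"
    have D: "1 + norm v + norm w > 0" by (smt (verit) norm_ge_zero)
    have T: "T > 0" using rpos D by (simp add: T_def)
    have TD: "T * norm v + T * norm w < r"
    proof -
      have "T * norm v + T * norm w < T * (1 + norm v + norm w)" using T by (simp add: algebra_simps)
      also have "\<dots> = r" using D by (simp add: T_def)
      finally show ?thesis .
    qed
    have near: "z + s *\<^sub>R v + t *\<^sub>R w \<in> S \<and> dist (z + s *\<^sub>R v + t *\<^sub>R w) z < r"
      if "0 \<le> s" "s \<le> T" "0 \<le> t" "t \<le> T" for s t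
    proof -
      have "norm (s *\<^sub>R v + t *\<^sub>R w) \<le> T * norm v + T * norm w"
        using that by (intro norm_triangle_mono) (auto intro: mult_right_mono)
      then have d: "dist (z + s *\<^sub>R v + t *\<^sub>R w) z < r"
        using TD by (simp add: dist_norm algebra_simps)
      moreover have "z + s *\<^sub>R v + t *\<^sub>R w \<in> L"
        using L v w z U by (auto intro!: subspace_add subspace_scale)
      ultimately show ?thesis
        using r3 U by (auto simp: r_def dist_commute subset_iff)
    qed
    have 1: "norm (f (z + T *\<^sub>R v + T *\<^sub>R w) - f (z + T *\<^sub>R v) - f (z + T *\<^sub>R w) + f z - (T * T) *\<^sub>R ?a) \<le> e * T * T"
      using near T r by (intro second_difference_estimate[OF C2 v w]) (auto simp: r_def)
    have 2: "norm (f (z + T *\<^sub>R w + T *\<^sub>R v) - f (z + T *\<^sub>R w) - f (z + T *\<^sub>R v) + f z - (T * T) *\<^sub>R ?b) \<le> e * T * T"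
    proof (intro second_difference_estimate[OF C2 w v])
      fix s t assume "0 \<le> s" "s \<le> T" "0 \<le> t" "t \<le> T"
      then have *: "z + s *\<^sub>R w + t *\<^sub>R v \<in> S \<and> dist (z + s *\<^sub>R w + t *\<^sub>R v) z < r"
        using near[of t s] by (simp add: algebra_simps)
      then show "z + s *\<^sub>R w + t *\<^sub>R v \<in> S" by simp
      show "norm (dir_deriv (\<lambda>y. dir_deriv f y w) (z + s *\<^sub>R w + t *\<^sub>R v) v - ?b) \<le> e"
        using * r(4) by (simp add: r_def)
    qed (use T in auto)
    define Q where "Q = f (z + T *\<^sub>R v + T *\<^sub>R w) - f (z + T *\<^sub>R v) - f (z + T *\<^sub>R w) + f z"
    have "norm (Q - (T * T) *\<^sub>R ?a) \<le> e * T * T" "norm (Q - (T * T) *\<^sub>R ?b) \<le> e * T * T"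
      using 1 2 by (simp_all add: Q_def algebra_simps)
    then have "norm ((Q - (T * T) *\<^sub>R ?b) - (Q - (T * T) *\<^sub>R ?a)) \<le> e * T * T + e * T * T"
      by (intro norm_triangle_le_diff) linarith
    moreover have "(Q - (T * T) *\<^sub>R ?b) - (Q - (T * T) *\<^sub>R ?a) = (T * T) *\<^sub>R (?a - ?b)"
      by (simp add: scaleR_diff_right)
    ultimately have "norm ((T * T) *\<^sub>R (?a - ?b)) \<le> (T * T) * (2 * e)"
      by (metis mult.commute mult.left_commute mult_2)
    then have "(T * T) * norm (?a - ?b) \<le> (T * T) * (2 * e)"
      by (simp only: norm_scaleR abs_mult abs_mult_self_eq)
    then show ?thesis using T by (simp add: mult_le_cancel_left)
  qed
  then have "norm (?a - ?b) \<le> e" if "e > 0" for e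
    using that by (metis field_sum_of_halves half_gt_zero mult_2)
  then have "norm (?a - ?b) \<le> 0" by (rule field_le_epsilon) simp
  then show ?thesis by simp
qed

section \<open>Differentiation under the integral sign\<close>

text \<open>Joint regularity in parameter and point supplies the continuity in both variables that
  the Leibniz rule asks for. A derivative in the point alone is a derivative of \<open>G\<close>
  along \<open>(0, v)\<close>.\<close>

lemma integral_dir_deriv:
  fixes G :: "real \<times> 'e::euclidean_space \<Rightarrow> 'f::euclidean_space"
  assumes L: "subspace L" "openin (top_of_set L) S" and C1: "Ck_on 1 (UNIV \<times> L) (UNIV \<times> S) G"
    and z: "z \<in> S" and v: "v \<in> L"
  shows "((\<lambda>t. integral {0..T} (\<lambda>\<theta>. G (\<theta>, z + t *\<^sub>R v))) has_vector_derivative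
    integral {0..T} (\<lambda>\<theta>. dir_deriv (\<lambda>y. G (\<theta>, y)) z v)) (at 0)"
proof -
  obtain U where U: "open U" "(0::real) \<in> U" "\<And>t. t \<in> U \<Longrightarrow> z + t *\<^sub>R v \<in> S"
    using line_in_open[OF L z v] unfolding eventually_nhds by blast
  then obtain d where d: "d > 0" "ball 0 d \<subseteq> U" using open_contains_ball by blast
  have dd: "dir_deriv (\<lambda>y. G (\<theta>, y)) y v = dir_deriv G (\<theta>, y) (0, v)" for \<theta> y
    by (simp add: dir_deriv_def)
  have "((\<lambda>t. integral (cbox 0 T) (\<lambda>\<theta>. G (\<theta>, z + t *\<^sub>R v))) has_vector_derivative
    integral (cbox 0 T) (\<lambda>\<theta>. dir_deriv G (\<theta>, z + 0 *\<^sub>R v) (0, v))) (at 0 within ball 0 d)"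
  proof (rule leibniz_rule_vector_derivative[where fx = "\<lambda>t \<theta>. dir_deriv G (\<theta>, z + t *\<^sub>R v) (0, v)"])
    fix t :: real and \<theta> assume t: "t \<in> ball 0 d"
    then have tS: "z + t *\<^sub>R v \<in> S" using U d by blast
    have "(\<lambda>s. G ((\<theta>, z + t *\<^sub>R v) + s *\<^sub>R (0, v))) differentiable (at 0)"
      using C1 tS v unfolding One_nat_def Ck_on.simps by blast
    then have "((\<lambda>t. G ((\<theta>, z) + t *\<^sub>R (0, v))) has_vector_derivative
        dir_deriv G ((\<theta>, z) + t *\<^sub>R (0, v)) (0, v)) (at t)"
      by (intro line_has_vector_derivative) simp
    then show "((\<lambda>t. G (\<theta>, z + t *\<^sub>R v)) has_vector_derivative
        dir_deriv G (\<theta>, z + t *\<^sub>R v) (0, v)) (at t within ball 0 d)"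
      by (simp add: has_vector_derivative_at_within)
  next
    fix t :: real assume "t \<in> ball 0 d"
    then have tS: "z + t *\<^sub>R v \<in> S" using U d by blast
    have "continuous_on (UNIV \<times> S) G" using C1 by simp
    then have "continuous_on (cbox 0 T) (\<lambda>\<theta>. G (\<theta>, z + t *\<^sub>R v))"
      by (rule continuous_on_compose2) (use tS in \<open>auto intro!: continuous_intros\<close>)
    then show "(\<lambda>\<theta>. G (\<theta>, z + t *\<^sub>R v)) integrable_on cbox 0 T"
      by (rule integrable_continuous)
  next
    have "continuous_on (UNIV \<times> S) (\<lambda>p. dir_deriv G p (0, v))" using C1 v by simp
    then have "continuous_on (ball 0 d \<times> cbox 0 T) (\<lambda>p. dir_deriv G (snd p, z + fst p *\<^sub>R v) (0, v))"
      by (rule continuous_on_compose2) (use U d in \<open>auto intro!: continuous_intros\<close>)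
    then show "continuous_on (ball 0 d \<times> cbox 0 T) (\<lambda>(t, \<theta>). dir_deriv G (\<theta>, z + t *\<^sub>R v) (0, v))"
      by (simp add: split_def)
  qed (use d in auto)
  then show ?thesis using d by (simp add: at_within_open[of 0 "ball 0 d"] dd)
qed

text \<open>The derivative is again an integral of the same kind, with the derivative of
  \<open>G\<close> along \<open>(0, v)\<close> as integrand, so the induction is over all
  \<open>G\<close>.\<close>

lemma Ck_on_integral:
  fixes G :: "real \<times> 'e::euclidean_space \<Rightarrow> 'f::euclidean_space"
  assumes L: "subspace L" "openin (top_of_set L) S" and "Ck_on k (UNIV \<times> L) (UNIV \<times> S) G"
  shows "Ck_on k L S (\<lambda>z. integral {0..T} (\<lambda>\<theta>. G (\<theta>, z)))"
  using assms(3)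
proof (induction k arbitrary: G)
  case 0
  have "continuous_on (S \<times> cbox 0 T) (\<lambda>(z, \<theta>). G (\<theta>, z))"
    unfolding split_def using Ck_on_continuous[OF 0]
    by (auto intro!: continuous_intros intro: continuous_on_compose2[of "UNIV \<times> S" G])
  from integral_continuous_on_param[OF this] show ?case by simp
next
  case (Suc k)
  have C1: "Ck_on 1 (UNIV \<times> L) (UNIV \<times> S) G" using Suc.prems Ck_on_continuous by fastforce
  note der = integral_dir_deriv[OF L C1, of _ _ T]
  have dd: "dir_deriv (\<lambda>y. G (\<theta>, y)) y v = dir_deriv G (\<theta>, y) (0, v)" for \<theta> y v
    by (simp add: dir_deriv_def)
  show ?case
  proof (rule Ck_on_SucI[OF L _ der])
    have "continuous_on (S \<times> cbox 0 T) (\<lambda>(z, \<theta>). G (\<theta>, z))"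
      unfolding split_def using Ck_on_continuous[OF C1]
      by (auto intro!: continuous_intros intro: continuous_on_compose2[of "UNIV \<times> S" G])
    from integral_continuous_on_param[OF this]
    show "continuous_on S (\<lambda>z. integral {0..T} (\<lambda>\<theta>. G (\<theta>, z)))" by simp
    show "Ck_on k L S (\<lambda>z. integral {0..T} (\<lambda>\<theta>. dir_deriv (\<lambda>y. G (\<theta>, y)) z v))" if "v \<in> L" for v
      unfolding dd by (rule Suc.IH) (use Suc.prems that in simp)
  qed
qed

lemma smooth_on_integral:
  fixes G :: "real \<times> 'e::euclidean_space \<Rightarrow> 'f::euclidean_space"
  assumes "subspace L" "openin (top_of_set L) S" "smooth_on (UNIV \<times> L) (UNIV \<times> S) G"
  shows "smooth_on L S (\<lambda>z. integral {0..T} (\<lambda>\<theta>. G (\<theta>, z)))"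
  using assms unfolding smooth_on_def by (metis Ck_on_integral)

section \<open>Alternating forms\<close>

lemma multilinear_alternatingD:
  assumes "multilinear_alternating L \<alpha>"
  shows "set us \<subseteq> L \<Longrightarrow> v \<in> L \<Longrightarrow> w \<in> L \<Longrightarrow> set ws \<subseteq> L \<Longrightarrow>
      \<alpha> (us @ (a *\<^sub>R v + b *\<^sub>R w) # ws) =
      complex_of_real a * \<alpha> (us @ v # ws) + complex_of_real b * \<alpha> (us @ w # ws)"
    and "set vs \<subseteq> L \<Longrightarrow> \<not> distinct vs \<Longrightarrow> \<alpha> vs = 0"
  using assms unfolding multilinear_alternating_def by blast+

lemma alternating_add:
  assumes "multilinear_alternating L \<alpha>" "set us \<subseteq> L" "v \<in> L" "w \<in> L" "set ws \<subseteq> L"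
  shows "\<alpha> (us @ (v + w) # ws) = \<alpha> (us @ v # ws) + \<alpha> (us @ w # ws)"
  using multilinear_alternatingD(1)[OF assms, of 1 1] by simp

lemma alternating_scaleR:
  assumes "multilinear_alternating L \<alpha>" "set us \<subseteq> L" "v \<in> L" "set ws \<subseteq> L"
  shows "\<alpha> (us @ (a *\<^sub>R v) # ws) = complex_of_real a * \<alpha> (us @ v # ws)"
  using multilinear_alternatingD(1)[OF assms(1,2,3,3,4), of a 0] by simp

lemma alternating_zero:
  assumes "multilinear_alternating L \<alpha>" "set us \<subseteq> L" "0 \<in> L" "set ws \<subseteq> L"
  shows "\<alpha> (us @ 0 # ws) = 0"
  using alternating_scaleR[OF assms, of 0] by simp

lemma alternating_sum:
  assumes L: "subspace L" and \<alpha>: "multilinear_alternating L \<alpha>"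
    and us: "set us \<subseteq> L" "set ws \<subseteq> L" and "finite B" "B \<subseteq> L"
  shows "\<alpha> (us @ (\<Sum>b\<in>B. c b *\<^sub>R b) # ws) = (\<Sum>b\<in>B. c b *\<^sub>R \<alpha> (us @ b # ws))"
  using assms(5,6)
proof (induction B rule: finite_induct)
  case empty
  then show ?case using alternating_zero[OF \<alpha> us(1) _ us(2)] subspace_0[OF L] by simp
next
  case (insert b B)
  have "(\<Sum>b\<in>B. c b *\<^sub>R b) \<in> L" using insert.prems L by (intro subspace_sum subspace_scale) auto
  then have "\<alpha> (us @ (c b *\<^sub>R b + 1 *\<^sub>R (\<Sum>b\<in>B. c b *\<^sub>R b)) # ws) =
      complex_of_real (c b) * \<alpha> (us @ b # ws) + complex_of_real 1 * \<alpha> (us @ (\<Sum>b\<in>B. c b *\<^sub>R b) # ws)"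
    using insert.prems us by (intro multilinear_alternatingD(1)[OF \<alpha>]) auto
  then show ?case using insert by (simp add: scaleR_conv_of_real)
qed

text \<open>Polarisation: expand the zero value on the repeated vector \<open>v + w\<close>.\<close>

lemma alternating_swap:
  assumes L: "subspace L" and \<alpha>: "multilinear_alternating L \<alpha>"
    and "set us \<subseteq> L" "v \<in> L" "w \<in> L" "set ws \<subseteq> L"
  shows "\<alpha> (us @ v # w # ws) = - \<alpha> (us @ w # v # ws)"
proof -
  have vw: "v + w \<in> L" using L assms by (simp add: subspace_add)
  have "0 = \<alpha> (us @ (v + w) # (v + w) # ws)"
    using assms vw by (subst multilinear_alternatingD(2)[OF \<alpha>]) auto
  also have "\<dots> = \<alpha> (us @ v # (v + w) # ws) + \<alpha> (us @ w # (v + w) # ws)"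
    using assms vw by (intro alternating_add[OF \<alpha>]) auto
  also have "\<alpha> (us @ v # (v + w) # ws) = \<alpha> (us @ v # v # ws) + \<alpha> (us @ v # w # ws)"
    using alternating_add[OF \<alpha>, of "us @ [v]" v w ws] assms by simp
  also have "\<alpha> (us @ w # (v + w) # ws) = \<alpha> (us @ w # v # ws) + \<alpha> (us @ w # w # ws)"
    using alternating_add[OF \<alpha>, of "us @ [w]" v w ws] assms by simp
  also have "\<alpha> (us @ v # v # ws) = 0"
    using assms by (intro multilinear_alternatingD(2)[OF \<alpha>]) auto
  also have "\<alpha> (us @ w # w # ws) = 0"
    using assms by (intro multilinear_alternatingD(2)[OF \<alpha>]) auto
  finally show ?thesis by (simp add: eq_neg_iff_add_eq_0)
qed

lemma alternating_move_front:
  assumes L: "subspace L" and \<alpha>: "multilinear_alternating L \<alpha>"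
    and "set us \<subseteq> L" "w \<in> L" "set ws \<subseteq> L"
  shows "\<alpha> (us @ w # ws) = (-1) ^ length us * \<alpha> (w # us @ ws)"
  using assms(3,5)
proof (induction us arbitrary: ws rule: rev_induct)
  case (snoc u us)
  have "\<alpha> ((us @ [u]) @ w # ws) = - \<alpha> (us @ w # (u # ws))"
    using alternating_swap[OF L \<alpha>, of us u w ws] snoc.prems assms(4) by simp
  also have "\<dots> = - ((-1) ^ length us * \<alpha> (w # us @ (u # ws)))"
    using snoc.prems by (subst snoc.IH) auto
  finally show ?case by simp
qed simp

text \<open>Differentiating a slot produces a list update; in this shape the term fits the
  alternating sums over \<open>drop_nth\<close> that define \<open>dbar\<close>.\<close>

lemma alternating_list_update:
  assumes L: "subspace L" and \<alpha>: "multilinear_alternating L \<alpha>"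
    and "set us \<subseteq> L" "w \<in> L" "i < length us"
  shows "\<alpha> (us[i := w]) = (-1) ^ i * \<alpha> (w # drop_nth i us)"
proof -
  have "set (take i us) \<subseteq> L" "set (drop (Suc i) us) \<subseteq> L"
    using assms(3) by (meson order_trans set_take_subset set_drop_subset)+
  from alternating_move_front[OF L \<alpha> this(1) assms(4) this(2)] assms(5)
  show ?thesis by (simp add: upd_conv_take_nth_drop drop_nth_def min_def)
qed

section \<open>Deleting list entries and the alternating double sum\<close>

lemma set_drop_nth: "set (drop_nth j vs) \<subseteq> set vs"
  unfolding drop_nth_def using set_take_subset[of j vs] set_drop_subset[of "Suc j" vs] by auto

lemma length_drop_nth: "j < length vs \<Longrightarrow> length (drop_nth j vs) = length vs - 1"
  unfolding drop_nth_def by auto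

lemma map_drop_nth: "map f (drop_nth j vs) = drop_nth j (map f vs)"
  unfolding drop_nth_def by (simp add: take_map drop_map)

lemma nth_drop_nth:
  "j < length vs \<Longrightarrow> i < length vs - 1 \<Longrightarrow> drop_nth j vs ! i = (if i < j then vs ! i else vs ! Suc i)"
  unfolding drop_nth_def by (auto simp: nth_append min_def)

text \<open>The simplicial identity for two deletions: both sides remove the original positions
  \<open>j\<close> and \<open>Suc i\<close>.\<close>

lemma drop_nth_drop_nth:
  assumes "j \<le> i" "i < length vs - 1"
  shows "drop_nth i (drop_nth j vs) = drop_nth j (drop_nth (Suc i) vs)"
  using assms
  by (intro nth_equalityI) (auto simp: length_drop_nth nth_drop_nth)

text \<open>The sign pattern behind \<open>d \<circ> d = 0\<close>.\<close>

lemma alternating_double_sum: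
  fixes g :: "nat \<Rightarrow> nat \<Rightarrow> complex"
  shows "(\<Sum>j<Suc m. \<Sum>i<m. (-1) ^ (j + i) * (if i < j then g i j else g j (Suc i))) = 0"
proof (induction m)
  case (Suc m)
  \<comment> \<open>Passing from \<open>m\<close> to \<open>Suc m\<close> adds the column
    \<open>i = m\<close> and the row \<open>j = Suc m\<close>. Both run through the values
    \<open>g k (Suc m)\<close> with \<open>k \<le> m\<close>, with opposite signs.\<close>
  define t where "t j i = (-1) ^ (j + i) * (if i < j then g i j else g j (Suc i))" for j i
  have "(\<Sum>j<Suc (Suc m). \<Sum>i<Suc m. t j i) =
      (\<Sum>j<Suc m. \<Sum>i<Suc m. t j i) + (\<Sum>i<Suc m. t (Suc m) i)"
    by (rule sum.lessThan_Suc)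
  also have "(\<Sum>j<Suc m. \<Sum>i<Suc m. t j i) = (\<Sum>j<Suc m. \<Sum>i<m. t j i) + (\<Sum>j<Suc m. t j m)"
    unfolding sum.distrib[symmetric] by (intro sum.cong refl sum.lessThan_Suc)
  also have "(\<Sum>j<Suc m. \<Sum>i<m. t j i) = 0" using Suc by (simp only: t_def)
  also have "(\<Sum>j<Suc m. t j m) = (\<Sum>j<Suc m. (-1) ^ (j + m) * g j (Suc m))"
    by (rule sum.cong) (auto simp: t_def)
  also have "(\<Sum>i<Suc m. t (Suc m) i) = (\<Sum>i<Suc m. - ((-1) ^ (i + m) * g i (Suc m)))"
    by (rule sum.cong) (auto simp: t_def add.commute)
  finally show ?case by (simp only: t_def sum_negf) simp
qed simp

text \<open>The constant vectors \<open>us\<close> are there for the induction over the moving ones.\<close>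

lemma alternating_has_vector_derivative:
  fixes \<alpha> :: "complex ^ 'n::finite \<Rightarrow> (complex ^ 'n) list \<Rightarrow> complex"
    and \<gamma> :: "real \<Rightarrow> complex ^ 'n"
  assumes L: "subspace L" "openin (top_of_set L) S"
    and \<alpha>: "\<And>y. y \<in> S \<Longrightarrow> multilinear_alternating L (\<alpha> y)"
    and smooth: "\<And>us. set us \<subseteq> L \<Longrightarrow> smooth_on L S (\<lambda>y. \<alpha> y us)"
    and \<gamma>: "(\<gamma> has_vector_derivative \<gamma>') (at 0)" "\<forall>\<^sub>F t in nhds 0. \<gamma> t \<in> S"
    and "set us \<subseteq> L"
    and "\<And>w. w \<in> set ws \<Longrightarrow> w differentiable (at (0::real))"
    and "\<And>w. w \<in> set ws \<Longrightarrow> \<forall>\<^sub>F t in nhds 0. w t \<in> L"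
  shows "((\<lambda>t. \<alpha> (\<gamma> t) (us @ map (\<lambda>w. w t) ws)) has_vector_derivative
      dir_deriv (\<lambda>y. \<alpha> y (us @ map (\<lambda>w. w 0) ws)) (\<gamma> 0) \<gamma>' +
      (\<Sum>i<length ws. \<alpha> (\<gamma> 0) (us @ (map (\<lambda>w. w 0) ws)[i := vector_derivative (ws ! i) (at 0)]))) (at 0)"
  using assms(7-9)
proof (induction ws arbitrary: us)
  case Nil
  have "Ck_on 1 L S (\<lambda>y. \<alpha> y us)" using smooth[OF Nil(1)] by (simp add: smooth_on_def)
  then show ?case using dir_deriv_chain[OF L _ \<gamma>] by simp
next
  case (Cons w ws)
  obtain B where B: "finite B" "B \<subseteq> L" "\<And>b. b \<in> B \<Longrightarrow> norm b = 1"
      "\<And>v. v \<in> L \<Longrightarrow> (\<Sum>b\<in>B. (v \<bullet> b) *\<^sub>R b) = v"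
    using orthonormal_basis[OF L(1)] by metis
  define w' where "w' = vector_derivative w (at 0)"
  define R where "R = (\<lambda>t. map (\<lambda>w. w t) ws)"
  have w': "(w has_vector_derivative w') (at 0)"
    using Cons.prems(2)[of w] by (simp add: w'_def vector_derivative_works)
  have wL: "\<forall>\<^sub>F t in nhds 0. w t \<in> L" using Cons.prems(3) by simp
  have w'L: "w' \<in> L" using has_vector_derivative_in_subspace[OF L(1) w' wL] .
  have w0L: "w 0 \<in> L" using wL by (rule eventually_nhds_x_imp_x)
  have "\<forall>\<^sub>F t in nhds 0. \<forall>w\<in>set ws. w t \<in> L"
    using Cons.prems(3) by (simp add: eventually_ball_finite)
  then have RL: "\<forall>\<^sub>F t in nhds 0. set (R t) \<subseteq> L" by (simp add: R_def image_subset_iff)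
  have R0L: "set (R 0) \<subseteq> L" using RL by (rule eventually_nhds_x_imp_x)
  have \<gamma>0: "\<gamma> 0 \<in> S" using \<gamma>(2) by (rule eventually_nhds_x_imp_x)
  have SL: "S \<subseteq> L" using L(2) openin_imp_subset by blast
  have \<gamma>'L: "\<gamma>' \<in> L"
    using \<gamma>(2) SL by (intro has_vector_derivative_in_subspace[OF L(1) \<gamma>(1)]) (auto elim!: eventually_mono)
  have dL: "vector_derivative (ws ! i) (at 0) \<in> L" if "i < length ws" for i
    using Cons.prems(2,3)[of "ws ! i"] that
    by (intro has_vector_derivative_in_subspace[OF L(1)]) (auto simp: vector_derivative_works[symmetric])
  \<comment> \<open>The derivative at 0 when the first moving vector is frozen at a basis vector
    \<open>b\<close>. Near 0, \<open>w t\<close> is a combination of such \<open>b\<close> with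
    differentiable coefficients, and the product rule adds only the term in which \<open>w\<close>
    is replaced by its derivative.\<close>
  define E where "E = (\<lambda>b. dir_deriv (\<lambda>y. \<alpha> y (us @ b # R 0)) (\<gamma> 0) \<gamma>' +
      (\<Sum>i<length ws. \<alpha> (\<gamma> 0) (us @ b # (R 0)[i := vector_derivative (ws ! i) (at 0)])))"
  have IH: "((\<lambda>t. \<alpha> (\<gamma> t) (us @ b # R t)) has_vector_derivative E b) (at 0)" if "b \<in> B" for b
    using Cons.IH[of "us @ [b]"] Cons.prems that B(2) by (auto simp: E_def R_def)
  have "((\<lambda>t. \<Sum>b\<in>B. (w t \<bullet> b) *\<^sub>R \<alpha> (\<gamma> t) (us @ b # R t)) has_vector_derivative
      (\<Sum>b\<in>B. (w 0 \<bullet> b) *\<^sub>R E b + (w' \<bullet> b) *\<^sub>R \<alpha> (\<gamma> 0) (us @ b # R 0))) (at 0)"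
  proof (intro has_vector_derivative_sum)
    fix b assume "b \<in> B"
    have "((\<lambda>t. w t \<bullet> b) has_vector_derivative w' \<bullet> b) (at 0)"
      by (rule bounded_linear.has_vector_derivative[OF bounded_linear_inner_left w'])
    from bounded_bilinear.has_vector_derivative[OF bounded_bilinear_scaleR this IH[OF \<open>b \<in> B\<close>]]
    show "((\<lambda>t. (w t \<bullet> b) *\<^sub>R \<alpha> (\<gamma> t) (us @ b # R t)) has_vector_derivative
      (w 0 \<bullet> b) *\<^sub>R E b + (w' \<bullet> b) *\<^sub>R \<alpha> (\<gamma> 0) (us @ b # R 0)) (at 0)" .
  qed
  moreover have "\<forall>\<^sub>F t in nhds 0. (\<Sum>b\<in>B. (w t \<bullet> b) *\<^sub>R \<alpha> (\<gamma> t) (us @ b # R t)) = \<alpha> (\<gamma> t) (us @ w t # R t)"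
    using wL RL \<gamma>(2)
  proof eventually_elim
    case (elim t)
    then show ?case
      using alternating_sum[OF L(1) \<alpha> Cons.prems(1) _ B(1,2), of "\<gamma> t" "R t" "\<lambda>b. w t \<bullet> b"] B(4) by simp
  qed
  ultimately have *: "((\<lambda>t. \<alpha> (\<gamma> t) (us @ w t # R t)) has_vector_derivative
      (\<Sum>b\<in>B. (w 0 \<bullet> b) *\<^sub>R E b + (w' \<bullet> b) *\<^sub>R \<alpha> (\<gamma> 0) (us @ b # R 0))) (at 0)"
    by (subst (asm) has_vector_derivative_cong_nhds) auto
  \<comment> \<open>Multilinearity read backwards: it reassembles the basis expansion in each kind
    of term.\<close>
  have expand: "(\<Sum>b\<in>B. (v \<bullet> b) *\<^sub>R \<alpha> y (us @ b # rs)) = \<alpha> y (us @ v # rs)"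
    if "y \<in> S" "v \<in> L" "set rs \<subseteq> L" for y v rs
    using alternating_sum[OF L(1) \<alpha>[OF that(1)] Cons.prems(1) that(3) B(1,2), of "\<lambda>b. v \<bullet> b"]
      B(4)[OF that(2)] by simp
  have "(\<Sum>b\<in>B. (w 0 \<bullet> b) *\<^sub>R dir_deriv (\<lambda>y. \<alpha> y (us @ b # R 0)) (\<gamma> 0) \<gamma>') =
      dir_deriv (\<lambda>y. \<Sum>b\<in>B. (w 0 \<bullet> b) *\<^sub>R \<alpha> y (us @ b # R 0)) (\<gamma> 0) \<gamma>'"
    using Cons.prems(1) R0L B(2)
    by (intro dir_deriv_eqI[symmetric] has_vector_derivative_sum
        bounded_linear.has_vector_derivative[OF bounded_linear_scaleR_right]
        smooth_on_has_dir_deriv[OF smooth \<gamma>0 \<gamma>'L]) auto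
  also have "\<dots> = dir_deriv (\<lambda>y. \<alpha> y (us @ w 0 # R 0)) (\<gamma> 0) \<gamma>'"
    by (rule dir_deriv_cong[OF L \<gamma>0 \<gamma>'L]) (simp add: expand w0L R0L)
  finally have 1: "(\<Sum>b\<in>B. (w 0 \<bullet> b) *\<^sub>R dir_deriv (\<lambda>y. \<alpha> y (us @ b # R 0)) (\<gamma> 0) \<gamma>') = \<dots>" .
  have 2: "(\<Sum>b\<in>B. (w 0 \<bullet> b) *\<^sub>R (\<Sum>i<length ws. \<alpha> (\<gamma> 0) (us @ b # (R 0)[i := vector_derivative (ws ! i) (at 0)])))
      = (\<Sum>i<length ws. \<alpha> (\<gamma> 0) (us @ w 0 # (R 0)[i := vector_derivative (ws ! i) (at 0)]))"
    unfolding scaleR_sum_right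
    by (subst sum.swap) (intro sum.cong refl expand \<gamma>0 w0L; use R0L dL in \<open>auto dest!: set_update_subset_insert[THEN subsetD]\<close>)
  have "(\<Sum>b\<in>B. (w 0 \<bullet> b) *\<^sub>R E b + (w' \<bullet> b) *\<^sub>R \<alpha> (\<gamma> 0) (us @ b # R 0)) =
      dir_deriv (\<lambda>y. \<alpha> y (us @ w 0 # R 0)) (\<gamma> 0) \<gamma>' +
      (\<alpha> (\<gamma> 0) (us @ w' # R 0) +
       (\<Sum>i<length ws. \<alpha> (\<gamma> 0) (us @ w 0 # (R 0)[i := vector_derivative (ws ! i) (at 0)])))"
    unfolding sum.distrib E_def scaleR_add_right 1 2 expand[OF \<gamma>0 w'L R0L] by simp
  with * show ?case
    by (simp add: R_def sum.lessThan_Suc_shift w'_def del: sum.lessThan_Suc)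
qed

text \<open>Base point and vectors both depend on the parameter. The moving vectors are expanded one
  after the other in a fixed basis, and \<open>us\<close> collects the basis vectors; when none is
  left, the claim is smoothness of a composition.\<close>

lemma smooth_on_alternating:
  fixes \<alpha> :: "complex ^ 'n::finite \<Rightarrow> (complex ^ 'n) list \<Rightarrow> complex"
    and \<Phi> :: "'e::real_normed_vector \<Rightarrow> complex ^ 'n"
  assumes L: "subspace L" "openin (top_of_set L) S" and L': "subspace L'" "openin (top_of_set L') S'"
    and \<alpha>: "\<And>y. y \<in> S \<Longrightarrow> multilinear_alternating L (\<alpha> y)"
    and smooth: "\<And>us. set us \<subseteq> L \<Longrightarrow> smooth_on L S (\<lambda>y. \<alpha> y us)"
    and \<Phi>: "\<Phi> ` S' \<subseteq> S" "smooth_on L' S' \<Phi>"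
    and "set us \<subseteq> L"
    and "\<And>\<psi>. \<psi> \<in> set \<Psi> \<Longrightarrow> smooth_on L' S' \<psi>" "\<And>\<psi>. \<psi> \<in> set \<Psi> \<Longrightarrow> \<psi> ` S' \<subseteq> L"
  shows "smooth_on L' S' (\<lambda>u. \<alpha> (\<Phi> u) (us @ map (\<lambda>\<psi>. \<psi> u) \<Psi>))"
  using assms(9-11)
proof (induction \<Psi> arbitrary: us)
  case Nil
  then show ?case using smooth_on_compose[OF L L' \<Phi>(1) smooth \<Phi>(2)] by simp
next
  case (Cons \<psi> \<Psi>)
  obtain B where B: "finite B" "B \<subseteq> L" "\<And>b. b \<in> B \<Longrightarrow> norm b = 1"
      "\<And>v. v \<in> L \<Longrightarrow> (\<Sum>b\<in>B. (v \<bullet> b) *\<^sub>R b) = v"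
    using orthonormal_basis[OF L(1)] by metis
  show ?case
  proof (rule smooth_on_cong[OF L'])
    have "smooth_on L' S' (\<lambda>u. (\<psi> u \<bullet> b) *\<^sub>R \<alpha> (\<Phi> u) (us @ b # map (\<lambda>\<psi>. \<psi> u) \<Psi>))" if "b \<in> B" for b
      using Cons.IH[of "us @ [b]"] Cons.prems that B(2)
      by (intro smooth_on_scaleR[OF L'] smooth_on_bounded_linear[OF L' bounded_linear_inner_left]) auto
    then show "smooth_on L' S' (\<lambda>u. \<Sum>b\<in>B. (\<psi> u \<bullet> b) *\<^sub>R \<alpha> (\<Phi> u) (us @ b # map (\<lambda>\<psi>. \<psi> u) \<Psi>))"
      unfolding smooth_on_def by (intro allI Ck_on_sum[OF L']) auto
    show "(\<Sum>b\<in>B. (\<psi> u \<bullet> b) *\<^sub>R \<alpha> (\<Phi> u) (us @ b # map (\<lambda>\<psi>. \<psi> u) \<Psi>)) =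
        \<alpha> (\<Phi> u) (us @ map (\<lambda>\<psi>. \<psi> u) (\<psi> # \<Psi>))" if "u \<in> S'" for u
    proof -
      have "\<psi> u \<in> L" "set (map (\<lambda>\<psi>. \<psi> u) \<Psi>) \<subseteq> L" "\<Phi> u \<in> S"
        using Cons.prems(3) that \<Phi>(1) by (auto simp: image_subset_iff)
      then show ?thesis
        using alternating_sum[OF L(1) \<alpha> Cons.prems(1) _ B(1,2), of "\<Phi> u" "map (\<lambda>\<psi>. \<psi> u) \<Psi>" "\<lambda>b. \<psi> u \<bullet> b"]
          B(4) by simp
    qed
  qed
qed

section \<open>Coordinate spaces, holomorphic maps and invariance of the \<open>dbar\<close>
  formula\<close>

lemma subspace_coord_space: "subspace (coord_space J)"
  unfolding coord_space_def subspace_def by simp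

lemma coord_space_scale: "v \<in> coord_space J \<Longrightarrow> a *s v \<in> coord_space J"
  unfolding coord_space_def by simp

lemma coord_space_mono: "J \<subseteq> J' \<Longrightarrow> coord_space J \<subseteq> coord_space J'"
  unfolding coord_space_def by auto

lemma holo_on_smooth: "holo_on L S f \<Longrightarrow> smooth_on L S f"
  unfolding holo_on_def by simp

lemma bounded_linear_vector_scale: "bounded_linear (\<lambda>v::complex ^ 'n::finite. a *s v)"
proof (rule linear_conv_bounded_linear[THEN iffD1], rule linearI)
  show "a *s (r *\<^sub>R v) = r *\<^sub>R (a *s v)" for r and v :: "complex ^ 'n"
    by (simp add: vec_eq_iff scaleR_conv_of_real)
qed (simp add: vector_add_ldistrib)

text \<open>The complex linear map in \<open>holo_on\<close> is a derivative within
  \<open>S\<close>, so it is tied to \<open>f\<close> only along the coordinate space. There it is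
  the directional derivative, and the coordinate space is closed under multiplication by
  \<open>a\<close>.\<close>

lemma holo_on_dir_deriv_scale:
  assumes "holo_on (coord_space J) S f" "openin (top_of_set (coord_space J)) S" "z \<in> S" "v \<in> coord_space J"
  shows "dir_deriv f z (a *s v) = a *s dir_deriv f z v"
proof -
  obtain f' where f': "(f has_derivative f') (at z within S)" "\<And>a v. f' (a *s v) = a *s f' v"
    using assms(1,3) unfolding holo_on_def by blast
  have "dir_deriv f z w = f' w" if "w \<in> coord_space J" for w
  proof (intro dir_deriv_eqI has_vector_derivative_chain_within[of f f' _ S])
    show "((\<lambda>t. z + t *\<^sub>R w) has_vector_derivative w) (at 0)"
      by (auto intro!: derivative_eq_intros)
  qed (use line_in_open[OF subspace_coord_space assms(2,3) that] f'(1) in auto)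
  then show ?thesis using assms(4) f'(2) coord_space_scale by metis
qed

text \<open>
  The second derivatives of the coordinate change cancel in the alternating sum, because they
  are symmetric and complex linear in both directions.
\<close>

lemma dbar_sum_transform:
  fixes \<beta> :: "complex ^ 'n::finite \<Rightarrow> (complex ^ 'n) list \<Rightarrow> complex"
    and F :: "complex ^ 'n \<Rightarrow> complex ^ 'n" and J J' :: "'n set"
  defines "L \<equiv> coord_space J" and "L' \<equiv> coord_space J'"
  assumes S: "openin (top_of_set L) S" and S': "openin (top_of_set L') S'"
    and F: "holo_on L S F" "F ` S \<subseteq> S'"
    and \<beta>: "\<And>y. y \<in> S' \<Longrightarrow> multilinear_alternating L' (\<beta> y)"
    and smooth: "\<And>us. set us \<subseteq> L' \<Longrightarrow> smooth_on L' S' (\<lambda>y. \<beta> y us)"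
    and \<alpha>: "\<And>y us. y \<in> S \<Longrightarrow> set us \<subseteq> L \<Longrightarrow> \<alpha> y us = \<beta> (F y) (map (dir_deriv F y) us)"
    and z: "z \<in> S" and vs: "set vs \<subseteq> L"
  shows "(\<Sum>j<length vs. (-1) ^ j * dbar_dir (\<lambda>y. \<alpha> y (drop_nth j vs)) z (vs ! j)) =
    (\<Sum>j<length vs. (-1) ^ j * dbar_dir (\<lambda>y. \<beta> y (drop_nth j (map (dir_deriv F z) vs))) (F z) (dir_deriv F z (vs ! j)))"
proof -
  have L: "subspace L" and L': "subspace L'" by (simp_all add: L_def L'_def subspace_coord_space)
  have iL: "\<i> *s v \<in> L" if "v \<in> L" for v using that by (simp add: L_def coord_space_scale)
  have iL': "\<i> *s v \<in> L'" if "v \<in> L'" for v using that by (simp add: L'_def coord_space_scale)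
  have SL': "S' \<subseteq> L'" using S' openin_imp_subset by blast
  have Fs: "smooth_on L S F" using F(1) by (rule holo_on_smooth)
  have Fz: "F z \<in> S'" using F z by blast
  define DF where "DF = dir_deriv F z"
  \<comment> \<open>Second derivative of the coordinate change: the derivative along
    \<open>v\<close> of the image of the constant vector \<open>u\<close>.\<close>
  define b where "b v u = dir_deriv (\<lambda>y. dir_deriv F y u) z v" for v u
  have DFL: "dir_deriv F y u \<in> L'" if "u \<in> L" "y \<in> S" for u y
    using F(2) SL' by (intro dir_deriv_in_subspace[OF L S that(2,1) L'] smooth_on_differentiable[OF Fs that(2,1)]) auto
  have bL: "b v u \<in> L'" if "v \<in> L" "u \<in> L" for v u
    unfolding b_def
    by (intro dir_deriv_in_subspace[OF L S z that(1) L']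
        smooth_on_differentiable[OF smooth_on_dir_deriv[OF Fs that(2)] z that(1)])
      (use DFL that in auto)
  have b_sym: "b v u = b u v" if "v \<in> L" "u \<in> L" for v u
    unfolding b_def using Fs by (intro dir_deriv_symmetric[OF L S _ z that(2,1)]) (simp add: smooth_on_def)
  have Fi: "dir_deriv F y (\<i> *s v) = \<i> *s dir_deriv F y v" if "y \<in> S" "v \<in> L" for y v
    using holo_on_dir_deriv_scale[OF F(1)[unfolded L_def] S[unfolded L_def] that(1)] that(2)
    by (simp add: L_def)
  \<comment> \<open>Complex linearity in \<open>u\<close> holds already before differentiating along
    \<open>v\<close>, by \<open>Fi\<close> on all of \<open>S\<close>; symmetry carries it over to
    \<open>v\<close>.\<close>
  have b_i: "b (\<i> *s v) u = \<i> *s b v u" if v: "v \<in> L" "u \<in> L" for v u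
  proof -
    have "b (\<i> *s v) u = dir_deriv (\<lambda>y. dir_deriv F y (\<i> *s v)) z u"
      using b_sym[OF iL[OF v(1)] v(2)] by (simp add: b_def)
    also have "\<dots> = dir_deriv (\<lambda>y. \<i> *s dir_deriv F y v) z u"
      by (rule dir_deriv_cong[OF L S z v(2)]) (simp add: Fi v)
    also have "\<dots> = \<i> *s dir_deriv (\<lambda>y. dir_deriv F y v) z u"
      by (intro dir_deriv_eqI bounded_linear.has_vector_derivative[OF bounded_linear_vector_scale]
          smooth_on_has_dir_deriv[OF smooth_on_dir_deriv[OF Fs v(1)] z v(2)])
    also have "\<dots> = \<i> *s b v u" using b_sym[OF v] by (simp add: b_def)
    finally show ?thesis .
  qed
  \<comment> \<open>Product rule along the line through \<open>z\<close>: one term moves the base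
    point of \<open>\<beta>\<close>, the others move one vector each. The updated vector is brought
    to the front at the price of a sign.\<close>
  have der: "dir_deriv (\<lambda>y. \<alpha> y us) z v = dir_deriv (\<lambda>y. \<beta> y (map DF us)) (F z) (DF v) +
      (\<Sum>i<length us. (-1) ^ i * \<beta> (F z) (b v (us ! i) # drop_nth i (map DF us)))"
    if us: "set us \<subseteq> L" and v: "v \<in> L" for us v
  proof -
    define ws where "ws = map (\<lambda>u t. dir_deriv F (z + t *\<^sub>R v) u) us"
    have der0: "((\<lambda>t. \<beta> (F (z + t *\<^sub>R v)) ([] @ map (\<lambda>w. w t) ws)) has_vector_derivative
      dir_deriv (\<lambda>y. \<beta> y ([] @ map (\<lambda>w. w 0) ws)) (F (z + 0 *\<^sub>R v)) (DF v) +
      (\<Sum>i<length ws. \<beta> (F (z + 0 *\<^sub>R v)) ([] @ (map (\<lambda>w. w 0) ws)[i := vector_derivative (ws ! i) (at 0)]))) (at 0)"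
    proof (rule alternating_has_vector_derivative[OF L' S' \<beta> smooth])
      show "((\<lambda>t. F (z + t *\<^sub>R v)) has_vector_derivative DF v) (at 0)"
        unfolding DF_def by (rule smooth_on_has_dir_deriv[OF Fs z v])
      show "\<forall>\<^sub>F t in nhds 0. F (z + t *\<^sub>R v) \<in> S'"
        using line_in_open[OF L S z v] by (rule eventually_mono) (use F(2) in blast)
      show "w differentiable (at 0)" if "w \<in> set ws" for w
        using that us smooth_on_differentiable[OF smooth_on_dir_deriv[OF Fs] z v] by (auto simp: ws_def)
      show "\<forall>\<^sub>F t in nhds 0. w t \<in> L'" if "w \<in> set ws" for w
        using line_in_open[OF L S z v] by (rule eventually_mono) (use that us DFL in \<open>auto simp: ws_def\<close>)
    qed auto
    have map_ws: "map (\<lambda>w. w t) ws = map (dir_deriv F (z + t *\<^sub>R v)) us" for t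
      by (simp add: ws_def)
    have map_ws0: "map (\<lambda>w. w 0) ws = map DF us" by (simp add: ws_def DF_def)
    have "(\<Sum>i<length ws. \<beta> (F (z + 0 *\<^sub>R v)) ((map DF us)[i := vector_derivative (ws ! i) (at 0)])) =
        (\<Sum>i<length us. \<beta> (F z) ((map DF us)[i := b v (us ! i)]))"
      by (rule sum.cong) (auto simp: ws_def b_def dir_deriv_def[of _ z v])
    with der0 have "((\<lambda>t. \<beta> (F (z + t *\<^sub>R v)) (map (dir_deriv F (z + t *\<^sub>R v)) us)) has_vector_derivative
      dir_deriv (\<lambda>y. \<beta> y (map DF us)) (F z) (DF v) +
      (\<Sum>i<length us. \<beta> (F z) ((map DF us)[i := b v (us ! i)]))) (at 0)"
      unfolding map_ws0 append_Nil unfolding map_ws by simp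
    moreover have "\<forall>\<^sub>F t in nhds 0. \<beta> (F (z + t *\<^sub>R v)) (map (dir_deriv F (z + t *\<^sub>R v)) us) = \<alpha> (z + t *\<^sub>R v) us"
      using line_in_open[OF L S z v] by (rule eventually_mono) (simp add: \<alpha> us)
    ultimately have "((\<lambda>t. \<alpha> (z + t *\<^sub>R v) us) has_vector_derivative
      dir_deriv (\<lambda>y. \<beta> y (map DF us)) (F z) (DF v) +
      (\<Sum>i<length us. \<beta> (F z) ((map DF us)[i := b v (us ! i)]))) (at 0)"
      by (subst (asm) has_vector_derivative_cong_nhds) auto
    moreover have "\<beta> (F z) ((map DF us)[i := b v (us ! i)]) =
        (-1) ^ i * \<beta> (F z) (b v (us ! i) # drop_nth i (map DF us))" if "i < length us" for i
    proof (rule alternating_list_update[OF L' \<beta>[OF Fz]])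
      show "set (map DF us) \<subseteq> L'" using us z DFL by (auto simp: DF_def)
      show "b v (us ! i) \<in> L'" using us nth_mem[OF that] by (intro bL[OF v]) blast
    qed (use that in simp)
    ultimately show ?thesis using dir_deriv_eqI by fastforce
  qed
  \<comment> \<open>Evaluation of the first slot on the (0,1)-component of \<open>x\<close>. Complex
    linearity of \<open>b\<close> in \<open>v\<close> makes the two second-derivative terms of
    \<open>dbar_dir\<close> combine to it.\<close>
  define h where "h x R = (\<beta> (F z) (x # R) + \<i> * \<beta> (F z) ((\<i> *s x) # R)) / 2" for x R
  have dbar: "dbar_dir (\<lambda>y. \<alpha> y us) z v = dbar_dir (\<lambda>y. \<beta> y (map DF us)) (F z) (DF v) +
      (\<Sum>i<length us. (-1) ^ i * h (b v (us ! i)) (drop_nth i (map DF us)))"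
    if us: "set us \<subseteq> L" and v: "v \<in> L" for us v
  proof -
    have "DF (\<i> *s v) = \<i> *s DF v" unfolding DF_def using z v by (rule Fi)
    moreover have "b (\<i> *s v) (us ! i) = \<i> *s b v (us ! i)" if "i < length us" for i
      using b_i[OF v] us that nth_mem by blast
    ultimately show ?thesis
      unfolding dbar_dir_def der[OF us v] der[OF us iL[OF v]] h_def
      by (simp add: sum_distrib_left sum_divide_distrib algebra_simps sum.distrib add_divide_distrib)
  qed
  define n where "n = length vs"
  \<comment> \<open>Used for pairs \<open>i < j\<close> of positions of \<open>vs\<close>: the two
    vectors are fed into \<open>b\<close>, the others remain. Differentiating along either of them
    while the other one moves gives the same value by \<open>b_sym\<close>, with opposite
    signs.\<close>
  define g where "g i j = h (b (vs ! i) (vs ! j)) (drop_nth i (drop_nth j (map DF vs)))" for i j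
  have "(\<Sum>j<n. (-1) ^ j * dbar_dir (\<lambda>y. \<alpha> y (drop_nth j vs)) z (vs ! j)) =
      (\<Sum>j<n. (-1) ^ j * dbar_dir (\<lambda>y. \<beta> y (map DF (drop_nth j vs))) (F z) (DF (vs ! j))) +
      (\<Sum>j<n. \<Sum>i<n - 1. (-1) ^ (j + i) * (if i < j then g i j else g j (Suc i)))"
  proof -
    have "(-1) ^ j * dbar_dir (\<lambda>y. \<alpha> y (drop_nth j vs)) z (vs ! j) =
        (-1) ^ j * dbar_dir (\<lambda>y. \<beta> y (map DF (drop_nth j vs))) (F z) (DF (vs ! j)) +
        (\<Sum>i<n - 1. (-1) ^ (j + i) * (if i < j then g i j else g j (Suc i)))" if j: "j < n" for j
    proof -
      have vj: "vs ! j \<in> L" using vs j by (auto simp: n_def)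
      have "h (b (vs ! j) (drop_nth j vs ! i)) (drop_nth i (map DF (drop_nth j vs))) =
          (if i < j then g i j else g j (Suc i))" if i: "i < n - 1" for i
      proof (cases "i < j")
        case True
        then have "vs ! i \<in> L" using vs i by (auto simp: n_def)
        then show ?thesis
          using True i j b_sym[OF vj] by (simp add: g_def map_drop_nth nth_drop_nth n_def)
      next
        case False
        then have "drop_nth i (drop_nth j (map DF vs)) = drop_nth j (drop_nth (Suc i) (map DF vs))"
          using i by (intro drop_nth_drop_nth) (auto simp: n_def)
        then show ?thesis using False i j by (simp add: g_def map_drop_nth nth_drop_nth n_def)
      qed
      then show ?thesis
        using dbar[of "drop_nth j vs" "vs ! j"] set_drop_nth[of j vs] vs vj j
        by (auto simp: length_drop_nth n_def distrib_left sum_distrib_left power_add mult.assoc)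
    qed
    then show ?thesis by (simp add: sum.distrib)
  qed
  also have "(\<Sum>j<n. \<Sum>i<n - 1. (-1) ^ (j + i) * (if i < j then g i j else g j (Suc i))) = 0"
    using alternating_double_sum[of g "n - 1"] by (cases n) simp_all
  finally show ?thesis by (simp add: n_def DF_def map_drop_nth)
qed

section \<open>Spaces of forms\<close>

lemma fun_sum_apply: "(\<Sum>i\<in>I. f i) x = (\<Sum>i\<in>I. f i x)"
  by (induction I rule: infinite_finite_induct) auto

lemma formsD:
  assumes "\<omega> \<in> forms A"
  shows forms_zero: "\<not> meaningful A c z vs \<Longrightarrow> \<omega> c z vs = 0"
    and forms_alternating: "c \<in> A \<Longrightarrow> z \<in> cimg c \<Longrightarrow> multilinear_alternating (ctan c) (\<omega> c z)"
    and forms_smooth: "c \<in> A \<Longrightarrow> set vs \<subseteq> ctan c \<Longrightarrow> smooth_on (ctan c) (cimg c) (\<lambda>z. \<omega> c z vs)"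
    and forms_transition: "c \<in> A \<Longrightarrow> d \<in> A \<Longrightarrow> x \<in> cdom c \<Longrightarrow> x \<in> cdom d \<Longrightarrow> set vs \<subseteq> ctan c \<Longrightarrow>
        \<omega> c (coord c x) vs = \<omega> d (coord d x) (map (dir_deriv (coord d \<circ> cinv c) (coord c x)) vs)"
  using assms unfolding forms_def by blast+

lemma multilinear_alternating_linear_comb:
  "multilinear_alternating L \<alpha> \<Longrightarrow> multilinear_alternating L \<beta> \<Longrightarrow>
    multilinear_alternating L (\<lambda>vs. a * \<alpha> vs + b * \<beta> vs)"
  unfolding multilinear_alternating_def by (simp add: algebra_simps)

lemma forms_pq_forms: "\<omega> \<in> forms_pq A p q \<Longrightarrow> \<omega> \<in> forms A"
  unfolding forms_pq_def by simp

lemma zero_forms: "0 \<in> forms A"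
  unfolding forms_def multilinear_alternating_def by (simp add: smooth_on_const)

section \<open>Evaluation on vectors of pure type\<close>

lemma ext_eval_zero: "ext_eval (\<lambda>vs. 0) xs = 0"
  by (induction xs) auto

lemma ext_eval_linear_comb:
  "ext_eval (\<lambda>vs. a * \<alpha> vs + b * \<beta> vs) xs = a * ext_eval \<alpha> xs + b * ext_eval \<beta> xs"
proof (induction xs arbitrary: \<alpha> \<beta>)
  case (Cons x xs)
  then show ?case by (cases x) (simp add: algebra_simps add_divide_distrib)
qed simp

lemma ext_eval_sum:
  "ext_eval (\<lambda>vs. \<Sum>i\<in>I. \<alpha> i vs) xs = (\<Sum>i\<in>I. ext_eval (\<alpha> i) xs)"
proof (induction I rule: infinite_finite_induct)
  case (insert i I)
  then show ?case using ext_eval_linear_comb[of 1 "\<alpha> i" 1 "\<lambda>vs. \<Sum>i\<in>I. \<alpha> i vs" xs] by simp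
qed (simp_all add: ext_eval_zero)

text \<open>A real vector is the sum of its (1,0)- and (0,1)-components, so a value of
  \<open>\<alpha>\<close> is the sum of its extended values over all labellings of the arguments,
  and one of these is nonzero.\<close>

lemma ext_eval_nonzero:
  assumes "\<alpha> vs \<noteq> 0"
  shows "\<exists>xs. map snd xs = vs \<and> ext_eval \<alpha> xs \<noteq> 0"
  using assms
proof (induction vs arbitrary: \<alpha>)
  case (Cons v vs)
  then obtain xs where xs: "map snd xs = vs" "ext_eval (\<lambda>vs. \<alpha> (v # vs)) xs \<noteq> 0"
    using Cons.IH[of "\<lambda>vs. \<alpha> (v # vs)"] by blast
  have "ext_eval \<alpha> ((True, v) # xs) + ext_eval \<alpha> ((False, v) # xs) = ext_eval (\<lambda>vs. \<alpha> (v # vs)) xs"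
    by (simp add: field_simps)
  then have "ext_eval \<alpha> ((True, v) # xs) \<noteq> 0 \<or> ext_eval \<alpha> ((False, v) # xs) \<noteq> 0"
    using xs(2) by auto
  then show ?case using xs(1) by (metis list.simps(9) snd_conv)
qed simp

lemma zero_forms_pq: "0 \<in> forms_pq A p q"
  using zero_forms[of A] unfolding forms_pq_def by (simp add: zero_fun_def ext_eval_zero)

lemma forms_linear_comb:
  fixes \<omega> \<eta> :: "('a, 'n::finite) form"
  assumes A: "\<And>c. c \<in> A \<Longrightarrow> openin (top_of_set (ctan c)) (cimg c)"
    and \<omega>: "\<omega> \<in> forms A" and \<eta>: "\<eta> \<in> forms A"
  shows "form_scale a \<omega> + form_scale b \<eta> \<in> forms A"
proof -
  have "smooth_on (ctan c) (cimg c) (\<lambda>z. a * \<omega> c z vs + b * \<eta> c z vs)"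
    if "c \<in> A" "set vs \<subseteq> ctan c" for c vs
    using forms_smooth[OF \<omega> that] forms_smooth[OF \<eta> that]
    by (intro smooth_on_add smooth_on_bounded_linear[OF _ _ bounded_linear_mult_right]
        subspace_coord_space A that)
  moreover have "multilinear_alternating (ctan c) (\<lambda>vs. a * \<omega> c z vs + b * \<eta> c z vs)"
    if "c \<in> A" "z \<in> cimg c" for c z
    using forms_alternating[OF \<omega> that] forms_alternating[OF \<eta> that] by (rule multilinear_alternating_linear_comb)
  moreover have "a * \<omega> c (coord c x) vs + b * \<eta> c (coord c x) vs =
      a * \<omega> d (coord d x) (map (dir_deriv (coord d \<circ> cinv c) (coord c x)) vs) +
      b * \<eta> d (coord d x) (map (dir_deriv (coord d \<circ> cinv c) (coord c x)) vs)"
    if "c \<in> A" "d \<in> A" "x \<in> cdom c" "x \<in> cdom d" "set vs \<subseteq> ctan c" for c d x vs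
    by (simp only: forms_transition[OF \<omega> that] forms_transition[OF \<eta> that])
  ultimately show ?thesis
    unfolding forms_def form_scale_def by (auto simp: forms_zero[OF \<omega>] forms_zero[OF \<eta>] plus_fun_def)
qed

section \<open>Linear structure of the spaces of forms\<close>

text \<open>The algebra of forms is developed from openness of the chart images, a property shared
  by the atlas of \<open>X\<close> and by \<open>sub_atlas A Z\<close>, so that the results apply to
  both.\<close>

locale open_charts =
  fixes A :: "('a, 'n::finite) chart set"
  assumes open_cimg: "c \<in> A \<Longrightarrow> openin (top_of_set (ctan c)) (cimg c)"
begin

lemma forms_pq_linear_comb:
  assumes \<omega>: "\<omega> \<in> forms_pq A p q" and \<eta>: "\<eta> \<in> forms_pq A p q"
  shows "form_scale a \<omega> + form_scale b \<eta> \<in> forms_pq A p q"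
proof -
  have *: "ext_eval ((form_scale a \<omega> + form_scale b \<eta>) c z) xs =
      a * ext_eval (\<omega> c z) xs + b * ext_eval (\<eta> c z) xs" for c z xs
    using ext_eval_linear_comb[of a "\<omega> c z" b "\<eta> c z" xs] by (simp add: form_scale_def plus_fun_def)
  have "int (length (filter fst xs)) = p \<and> int (length (filter (\<lambda>x. \<not> fst x) xs)) = q"
    if "c \<in> A" "z \<in> cimg c" "snd ` set xs \<subseteq> ctan c"
      "ext_eval ((form_scale a \<omega> + form_scale b \<eta>) c z) xs \<noteq> 0" for c z xs
  proof -
    have "ext_eval (\<omega> c z) xs \<noteq> 0 \<or> ext_eval (\<eta> c z) xs \<noteq> 0" using that(4) unfolding * by auto
    then show ?thesis using assms that(1-3) unfolding forms_pq_def by blast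
  qed
  then show ?thesis
    using forms_linear_comb[OF open_cimg forms_pq_forms[OF \<omega>] forms_pq_forms[OF \<eta>], of a b]
    unfolding forms_pq_def by blast
qed

lemma forms_pq_add: "\<omega> \<in> forms_pq A p q \<Longrightarrow> \<eta> \<in> forms_pq A p q \<Longrightarrow> \<omega> + \<eta> \<in> forms_pq A p q"
  using forms_pq_linear_comb[of \<omega> p q \<eta> 1 1] by (simp add: form_scale_def)

lemma forms_pq_scale: "\<omega> \<in> forms_pq A p q \<Longrightarrow> form_scale a \<omega> \<in> forms_pq A p q"
  using forms_pq_linear_comb[of \<omega> p q \<omega> a 0] by (simp add: form_scale_def plus_fun_def)

lemma forms_add: "\<omega> \<in> forms A \<Longrightarrow> \<eta> \<in> forms A \<Longrightarrow> \<omega> + \<eta> \<in> forms A"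
  using forms_linear_comb[OF open_cimg, where \<omega> = \<omega> and \<eta> = \<eta> and a = 1 and b = 1] by (simp add: form_scale_def)

lemma forms_sum: "(\<And>i. i \<in> I \<Longrightarrow> f i \<in> forms A) \<Longrightarrow> (\<Sum>i\<in>I. f i) \<in> forms A"
  by (induction I rule: infinite_finite_induct) (auto intro: zero_forms forms_add)

lemma koszul_forms: "\<omega> \<in> koszul A s \<Longrightarrow> \<omega> \<in> forms A"
  unfolding koszul_def by (auto intro!: forms_sum dest: forms_pq_forms)

lemma koszul_zero: "0 \<in> koszul A s"
  unfolding koszul_def by (auto intro!: exI[of _ 0] exI[of _ "\<lambda>_. 0"] simp: zero_forms_pq)

text \<open>\<open>koszul\<close> asks for an initial segment of indices; other finite index sets
  are padded with zero forms. The inserted 0 keeps the maximum defined for the empty set.\<close>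

lemma koszul_finite_sum:
  assumes "finite I" "\<And>r. r \<in> I \<Longrightarrow> a r \<in> forms_pq A (int r) (int r + s)"
  shows "(\<Sum>r\<in>I. a r) \<in> koszul A s"
proof -
  define b where "b r = (if r \<in> I then a r else 0)" for r
  have "(\<Sum>r\<in>I. a r) = (\<Sum>r\<le>Max (insert 0 I). b r)"
    unfolding b_def using assms(1)
    by (subst sum.inter_restrict[symmetric]) (auto intro!: sum.cong)
  moreover have "b r \<in> forms_pq A (int r) (int r + s)" for r
    using assms(2) by (simp add: b_def zero_forms_pq)
  ultimately show ?thesis unfolding koszul_def by blast
qed

lemma koszul_add:
  assumes "\<omega> \<in> koszul A s" "\<eta> \<in> koszul A s"
  shows "\<omega> + \<eta> \<in> koszul A s"
proof -
  obtain N a where a: "\<And>r. r \<le> N \<Longrightarrow> a r \<in> forms_pq A (int r) (int r + s)" "\<omega> = (\<Sum>r\<le>N. a r)"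
    using assms(1) unfolding koszul_def by blast
  obtain M b where b: "\<And>r. r \<le> M \<Longrightarrow> b r \<in> forms_pq A (int r) (int r + s)" "\<eta> = (\<Sum>r\<le>M. b r)"
    using assms(2) unfolding koszul_def by blast
  define a' where "a' r = (if r \<le> N then a r else 0)" for r
  define b' where "b' r = (if r \<le> M then b r else 0)" for r
  have 1: "\<omega> = (\<Sum>r\<le>max M N. a' r)"
    unfolding a(2) a'_def by (rule sum.mono_neutral_cong_left) auto
  have 2: "\<eta> = (\<Sum>r\<le>max M N. b' r)"
    unfolding b(2) b'_def by (rule sum.mono_neutral_cong_left) auto
  show ?thesis unfolding 1 2 sum.distrib[symmetric]
    using a(1) b(1) by (intro koszul_finite_sum forms_pq_add) (auto simp: a'_def b'_def zero_forms_pq)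
qed

lemma forms_differentiable:
  assumes "\<omega> \<in> forms A" "c \<in> A" "z \<in> cimg c" "v \<in> ctan c" "set vs \<subseteq> ctan c"
  shows "((\<lambda>t. \<omega> c (z + t *\<^sub>R v) vs) has_vector_derivative dir_deriv (\<lambda>y. \<omega> c y vs) z v) (at 0)"
  by (rule smooth_on_has_dir_deriv[OF forms_smooth[OF assms(1,2,5)] assms(3,4)])

text \<open>Additivity of directional derivatives requires differentiable arguments, hence
  membership in \<open>forms A\<close>; the contraction below is linear on arbitrary
  functions.\<close>

lemma dbar_linear_comb:
  fixes a b :: complex
  assumes \<omega>: "\<omega> \<in> forms A" and \<eta>: "\<eta> \<in> forms A"
  shows "dbar A (form_scale a \<omega> + form_scale b \<eta>) = form_scale a (dbar A \<omega>) + form_scale b (dbar A \<eta>)"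
proof -
  have *: "dbar_dir (\<lambda>y. a * \<omega> c y vs + b * \<eta> c y vs) z v =
      a * dbar_dir (\<lambda>y. \<omega> c y vs) z v + b * dbar_dir (\<lambda>y. \<eta> c y vs) z v"
    if "c \<in> A" "z \<in> cimg c" "v \<in> ctan c" "set vs \<subseteq> ctan c" for c z v vs
  proof -
    have "dir_deriv (\<lambda>y. a * \<omega> c y vs + b * \<eta> c y vs) z v =
      a * dir_deriv (\<lambda>y. \<omega> c y vs) z v + b * dir_deriv (\<lambda>y. \<eta> c y vs) z v" if "v \<in> ctan c" for v
      using that \<open>c \<in> A\<close> \<open>z \<in> cimg c\<close> \<open>set vs \<subseteq> ctan c\<close>
      by (intro dir_deriv_eqI has_vector_derivative_add has_vector_derivative_mult_right
          forms_differentiable \<omega> \<eta>)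
    then show ?thesis
      unfolding dbar_dir_def using that coord_space_scale[OF that(3)] by (simp add: algebra_simps add_divide_distrib)
  qed
  have "dbar_dir (\<lambda>y. a * \<omega> c y (drop_nth j vs) + b * \<eta> c y (drop_nth j vs)) z (vs ! j) =
      a * dbar_dir (\<lambda>y. \<omega> c y (drop_nth j vs)) z (vs ! j) + b * dbar_dir (\<lambda>y. \<eta> c y (drop_nth j vs)) z (vs ! j)"
    if "meaningful A c z vs" "j < length vs" for c z vs j
    using that set_drop_nth[of j vs] by (intro *) (auto simp: meaningful_def)
  then show ?thesis
    unfolding dbar_def form_scale_def
    by (auto simp: fun_eq_iff sum_distrib_left sum.distrib algebra_simps)
qed

lemma dbar_zero: "dbar A 0 = 0"
  by (simp add: dbar_def dbar_dir_def dir_deriv_def fun_eq_iff)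

lemma dbar_add: "\<omega> \<in> forms A \<Longrightarrow> \<eta> \<in> forms A \<Longrightarrow> dbar A (\<omega> + \<eta>) = dbar A \<omega> + dbar A \<eta>"
  using dbar_linear_comb[of \<omega> \<eta> 1 1] by (simp add: form_scale_def)

lemma dbar_scale: "\<omega> \<in> forms A \<Longrightarrow> dbar A (form_scale a \<omega>) = form_scale a (dbar A \<omega>)"
  using dbar_linear_comb[of \<omega> \<omega> a 0] by (simp add: form_scale_def plus_fun_def)

lemma dbar_sum: "(\<And>i. i \<in> I \<Longrightarrow> f i \<in> forms A) \<Longrightarrow> dbar A (\<Sum>i\<in>I. f i) = (\<Sum>i\<in>I. dbar A (f i))"
proof (induction I rule: infinite_finite_induct)
  case (insert i I)
  have "dbar A (\<Sum>j\<in>insert i I. f j) = dbar A (f i + (\<Sum>j\<in>I. f j))"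
    by (simp only: sum.insert[OF insert.hyps])
  also have "\<dots> = dbar A (f i) + dbar A (\<Sum>j\<in>I. f j)"
    using insert.prems by (intro dbar_add forms_sum) auto
  also have "dbar A (\<Sum>j\<in>I. f j) = (\<Sum>j\<in>I. dbar A (f j))"
    using insert.prems by (intro insert.IH) blast
  also have "dbar A (f i) + (\<Sum>j\<in>I. dbar A (f j)) = (\<Sum>j\<in>insert i I. dbar A (f j))"
    by (simp only: sum.insert[OF insert.hyps])
  finally show ?case .
qed (simp_all only: dbar_zero sum.infinite sum.empty not_False_eq_True)

lemma contr_add: "contr A \<rho> \<xi> x (\<omega> + \<eta>) = contr A \<rho> \<xi> x \<omega> + contr A \<rho> \<xi> x \<eta>"
  unfolding contr_def Let_def by (auto simp: fun_eq_iff algebra_simps add_divide_distrib diff_divide_distrib)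

lemma contr_zero: "contr A \<rho> \<xi> x 0 = 0"
  unfolding contr_def Let_def by (auto simp: fun_eq_iff)

lemma contr_scale: "contr A \<rho> \<xi> x (form_scale a \<omega>) = form_scale a (contr A \<rho> \<xi> x \<omega>)"
  unfolding contr_def Let_def form_scale_def by (auto simp: fun_eq_iff algebra_simps)

lemma contr_sum: "contr A \<rho> \<xi> x (\<Sum>i\<in>I. f i) = (\<Sum>i\<in>I. contr A \<rho> \<xi> x (f i))"
proof (induction I rule: infinite_finite_induct)
  case (insert i I)
  then show ?case
    using contr_add[of \<rho> \<xi> x "f i" "\<Sum>i\<in>I. f i"] by (simp only: sum.insert[OF insert.hyps])
qed (simp_all only: contr_zero sum.infinite sum.empty not_False_eq_True)

lemma koszul_D_add:
  "\<omega> \<in> forms A \<Longrightarrow> \<eta> \<in> forms A \<Longrightarrow> koszul_D A \<rho> \<xi> (\<omega> + \<eta>) = koszul_D A \<rho> \<xi> \<omega> + koszul_D A \<rho> \<xi> \<eta>"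
  unfolding koszul_D_def by (simp add: dbar_add contr_add)

lemma koszul_D_zero: "koszul_D A \<rho> \<xi> 0 = 0"
  unfolding koszul_D_def by (simp add: dbar_zero contr_zero)

lemma koszul_coboundaries_zero: "0 \<in> koszul_coboundaries A \<rho> \<xi> s"
  unfolding koszul_coboundaries_def by (metis image_eqI koszul_zero koszul_D_zero)

lemma koszul_coboundaries_add:
  "\<omega> \<in> koszul_coboundaries A \<rho> \<xi> s \<Longrightarrow> \<eta> \<in> koszul_coboundaries A \<rho> \<xi> s \<Longrightarrow>
    \<omega> + \<eta> \<in> koszul_coboundaries A \<rho> \<xi> s"
  unfolding koszul_coboundaries_def image_iff
  using koszul_D_add[OF koszul_forms koszul_forms] koszul_add by metis

section \<open>Types, degrees and the components of a cocycle\<close>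

text \<open>A nonzero value yields a labelling of the same vectors with nonzero extended value, and
  its two labels occur \<open>p\<close> and \<open>q\<close> times.\<close>

lemma forms_pq_nonzero:
  assumes "\<omega> \<in> forms_pq A p q" "\<omega> c z vs \<noteq> 0"
  shows "int (length vs) = p + q" "0 \<le> p" "0 \<le> q"
proof -
  have "meaningful A c z vs" using assms forms_zero[OF forms_pq_forms] by metis
  then have m: "c \<in> A" "z \<in> cimg c" "set vs \<subseteq> ctan c" by (auto simp: meaningful_def)
  obtain xs where xs: "map snd xs = vs" "ext_eval (\<omega> c z) xs \<noteq> 0"
    using ext_eval_nonzero[of "\<omega> c z", OF assms(2)] by blast
  then have "snd ` set xs \<subseteq> ctan c" using m(3) by (metis list.set_map)
  then have pq: "int (length (filter fst xs)) = p" "int (length (filter (\<lambda>x. \<not> fst x) xs)) = q"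
    using assms(1) m xs(2) unfolding forms_pq_def by auto
  have "length (filter fst xs) + length (filter (\<lambda>x. \<not> fst x) xs) = length vs"
    using xs(1) by (metis length_map sum_length_filter_compl)
  then show "int (length vs) = p + q" "0 \<le> p" "0 \<le> q" using pq by linarith+
qed

lemma forms_pq_negative:
  assumes "\<omega> \<in> forms_pq A p q" "p < 0 \<or> q < 0"
  shows "\<omega> = 0"
proof -
  have "\<omega> c z vs = 0" for c z vs
    using forms_pq_nonzero(2,3)[OF assms(1), of c z vs] assms(2) by linarith
  then show ?thesis by (simp add: fun_eq_iff)
qed

text \<open>The sum of the type components is direct. A labelled list that detects
  \<open>a r\<close> has exactly \<open>r\<close> labels (1,0), so every other component vanishes on
  it and it detects \<open>\<omega>\<close>; but an element of \<open>filt A p\<close> is detected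
  only by lists with at most \<open>p\<close> such labels.\<close>

lemma koszul_term_zero:
  assumes \<omega>: "\<omega> \<in> koszul A s" "\<omega> = (\<Sum>r\<le>N. a r)" "\<omega> \<in> filt A p"
    and a: "\<And>r. r \<le> N \<Longrightarrow> a r \<in> forms_pq A (int r) (int r + s)"
    and r: "p < r" "r \<le> N"
  shows "a r = 0"
proof (rule ccontr)
  assume "a r \<noteq> 0"
  then obtain c z vs where "a r c z vs \<noteq> 0" by (auto simp: fun_eq_iff)
  note nz = this
  have "meaningful A c z vs" using nz forms_zero[OF forms_pq_forms[OF a[OF r(2)]]] by metis
  then have m: "c \<in> A" "z \<in> cimg c" "set vs \<subseteq> ctan c" by (auto simp: meaningful_def)
  obtain xs where xs: "map snd xs = vs" "ext_eval (a r c z) xs \<noteq> 0"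
    using ext_eval_nonzero[of "a r c z", OF nz] by blast
  then have xsc: "snd ` set xs \<subseteq> ctan c" using m(3) by (metis list.set_map)
  have type_a: "int (length (filter fst xs)) = int r'" if "ext_eval (a r' c z) xs \<noteq> 0" "r' \<le> N" for r'
    using a[OF that(2)] m that(1) xsc unfolding forms_pq_def by auto
  have "ext_eval (a r' c z) xs = 0" if "r' \<le> N" "r' \<noteq> r" for r'
    using type_a[OF _ that(1)] type_a[OF xs(2) r(2)] that(2) by auto
  then have "(\<Sum>r'\<le>N. ext_eval (a r' c z) xs) = (\<Sum>r'\<in>{r}. ext_eval (a r' c z) xs)"
    using r(2) by (intro sum.mono_neutral_right) auto
  moreover have "ext_eval (\<omega> c z) xs = (\<Sum>r'\<le>N. ext_eval (a r' c z) xs)"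
    unfolding \<omega>(2) ext_eval_sum[symmetric] by (simp add: fun_sum_apply[abs_def] fun_eq_iff)
  ultimately have nz': "ext_eval (\<omega> c z) xs \<noteq> 0" using xs(2) by simp
  obtain M b where b: "\<And>r q. r \<le> p \<Longrightarrow> q \<le> M \<Longrightarrow> b r q \<in> forms_pq A (int r) (int q)"
      "\<omega> = (\<Sum>r\<le>p. \<Sum>q\<le>M. b r q)"
    using \<omega>(3) unfolding filt_def by blast
  have "ext_eval (\<omega> c z) xs = (\<Sum>r\<le>p. \<Sum>q\<le>M. ext_eval (b r q c z) xs)"
    unfolding b(2) ext_eval_sum[symmetric] by (simp add: fun_sum_apply[abs_def] fun_eq_iff)
  with nz' obtain r' q where rq: "r' \<le> p" "q \<le> M" "ext_eval (b r' q c z) xs \<noteq> 0"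
    by (auto elim!: sum.not_neutral_contains_not_neutral)
  then have "int (length (filter fst xs)) = int r'"
    using b(1)[OF rq(1,2)] m xsc unfolding forms_pq_def by auto
  then show False using type_a[OF xs(2) r(2)] rq(1) r(1) by simp
qed

text \<open>Membership in \<open>filt A p\<close> comes with its own bigraded decomposition,
  unrelated to \<open>s\<close>; by directness the one from \<open>koszul A s\<close> may be cut off
  at \<open>p\<close> instead. Indexing by all naturals lets the relation between \<open>a r\<close>
  and \<open>a (Suc r)\<close> hold without a special case at \<open>r = p\<close>.\<close>

lemma koszul_filt_decomposition:
  assumes "\<omega> \<in> koszul A s" "\<omega> \<in> filt A p"
  obtains a where "\<And>r. a r \<in> forms_pq A (int r) (int r + s)" "\<And>r. p < r \<Longrightarrow> a r = 0"
    "\<omega> = (\<Sum>r\<le>p. a r)"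
proof -
  obtain N a where a: "\<And>r. r \<le> N \<Longrightarrow> a r \<in> forms_pq A (int r) (int r + s)" "\<omega> = (\<Sum>r\<le>N. a r)"
    using assms(1) unfolding koszul_def by blast
  define b where "b r = (if r \<le> N \<and> r \<le> p then a r else 0)" for r
  show ?thesis
  proof
    show "b r \<in> forms_pq A (int r) (int r + s)" for r
      using a(1) by (simp add: b_def zero_forms_pq)
    have "(\<Sum>r\<le>N. a r) = (\<Sum>r\<in>{..N} \<inter> {..p}. b r)"
      using koszul_term_zero[OF assms(1) a(2) assms(2) a(1)]
      by (intro sum.mono_neutral_cong_right) (auto simp: b_def)
    also have "\<dots> = (\<Sum>r\<le>p. b r)"
      by (intro sum.mono_neutral_left) (auto simp: b_def)
    finally show "\<omega> = (\<Sum>r\<le>p. b r)" using a(2) by simp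
  qed (simp add: b_def)
qed

text \<open>
  In \<open>koszul A s\<close> the component of type \<open>(r, r + s)\<close> is the component of degree \<open>2r + s\<close>, so
  the equation \<open>D \<omega> = 0\<close> splits by degree.
\<close>

lemma koszul_D_components:
  assumes a: "\<And>r. a r \<in> forms_pq A (int r) (int r + s)" "\<And>r. p < r \<Longrightarrow> a r = 0"
    and D: "koszul_D A \<rho> \<xi> (\<Sum>r\<le>p. a r) = 0"
  shows "dbar A (a r) = contr A \<rho> \<xi> 1 (a (Suc r))" and "contr A \<rho> \<xi> 1 (a 0) = 0"
proof -
  \<comment> \<open>Only the number of arguments on which a term can be nonzero is tracked. It is
    \<open>2r + s + 1\<close> here and \<open>2r + s - 1\<close> for the contraction, and either
    number determines \<open>r\<close>.\<close>
  have len_dbar: "int (length vs) = 2 * int r + s + 1" if "dbar A (a r) c z vs \<noteq> 0" for r c z vs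
  proof -
    have m: "meaningful A c z vs" using that by (auto simp: dbar_def split: if_splits)
    with that have "(\<Sum>j<length vs. (-1) ^ j * dbar_dir (\<lambda>y. a r c y (drop_nth j vs)) z (vs ! j)) \<noteq> 0"
      by (simp add: dbar_def)
    then obtain j where j: "j < length vs" "dbar_dir (\<lambda>y. a r c y (drop_nth j vs)) z (vs ! j) \<noteq> 0"
      by (auto elim!: sum.not_neutral_contains_not_neutral)
    \<comment> \<open>The derivative looks at neighbouring points, so a nonzero coefficient is found
      at some \<open>y\<close>, possibly different from \<open>z\<close>.\<close>
    have "\<exists>y. a r c y (drop_nth j vs) \<noteq> 0"
    proof (rule ccontr)
      assume "\<nexists>y. a r c y (drop_nth j vs) \<noteq> 0"
      then have "(\<lambda>y. a r c y (drop_nth j vs)) = (\<lambda>y. 0)" by auto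
      then show False using j(2) by (simp add: dbar_dir_def dir_deriv_def)
    qed
    then have "int (length (drop_nth j vs)) = int r + (int r + s)"
      using forms_pq_nonzero(1)[OF a(1)] by blast
    then show ?thesis using j(1) by (simp add: length_drop_nth)
  qed
  have len_contr: "int (length vs) = 2 * int r + s - 1" if "contr A \<rho> \<xi> 1 (a r) c z vs \<noteq> 0" for r c z vs
  proof -
    obtain v where "a r c z (v # vs) \<noteq> 0"
    proof (rule ccontr)
      assume "\<not> thesis"
      then have "a r c z (v # vs) = 0" for v using that by blast
      then have "contr A \<rho> \<xi> 1 (a r) c z vs = 0" by (simp only: contr_def Let_def) simp
      then show False using \<open>contr A \<rho> \<xi> 1 (a r) c z vs \<noteq> 0\<close> by contradiction
    qed
    then have "int (length (v # vs)) = int r + (int r + s)" by (rule forms_pq_nonzero(1)[OF a(1)])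
    then show ?thesis by simp
  qed
  have eq: "(\<Sum>r\<le>p. dbar A (a r) c z vs) = (\<Sum>r\<le>p. contr A \<rho> \<xi> 1 (a r) c z vs)" for c z vs
  proof -
    have "(\<Sum>r\<le>p. dbar A (a r)) = (\<Sum>r\<le>p. contr A \<rho> \<xi> 1 (a r))"
      using D unfolding koszul_D_def contr_sum
        dbar_sum[where I = "{..p}" and f = a, OF forms_pq_forms[OF a(1)]] by (rule eq_iff_diff_eq_0[THEN iffD2])
    from fun_cong[OF fun_cong[OF fun_cong[OF this, of c], of z], of vs]
    show ?thesis by (simp only: fun_sum_apply)
  qed
  have single: "(\<Sum>r'\<le>p. f r') = f r" if "\<And>r'. r' \<noteq> r \<Longrightarrow> f r' = 0" "p < r \<Longrightarrow> f r = 0"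
    for f :: "nat \<Rightarrow> complex" and r
  proof (cases "r \<le> p")
    case True
    then have "(\<Sum>r'\<le>p. f r') = (\<Sum>r'\<in>{r}. f r')" using that by (intro sum.mono_neutral_right) auto
    then show ?thesis by simp
  next
    case False
    then show ?thesis using that by (metis linorder_not_le sum.neutral)
  qed
  have d0: "dbar A (a r) = 0" "contr A \<rho> \<xi> 1 (a r) = 0" if "p < r" for r
    using a(2)[OF that] by (simp_all add: dbar_zero contr_zero)
  show "dbar A (a r) = contr A \<rho> \<xi> 1 (a (Suc r))"
  proof (intro ext)
    fix c z vs
    show "dbar A (a r) c z vs = contr A \<rho> \<xi> 1 (a (Suc r)) c z vs"
    \<comment> \<open>On this many arguments only \<open>dbar A (a r)\<close> and the contraction of
      \<open>a (Suc r)\<close> can contribute.\<close>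
    proof (cases "int (length vs) = 2 * int r + s + 1")
      case True
      then have "(\<Sum>r'\<le>p. dbar A (a r') c z vs) = dbar A (a r) c z vs"
        using len_dbar d0 by (intro single) fastforce+
      moreover have "(\<Sum>r'\<le>p. contr A \<rho> \<xi> 1 (a r') c z vs) = contr A \<rho> \<xi> 1 (a (Suc r)) c z vs"
        using len_contr True d0 by (intro single) fastforce+
      ultimately show ?thesis using eq by metis
    next
      case False
      then show ?thesis using len_dbar[of r c z vs] len_contr[of "Suc r" c z vs] by fastforce
    qed
  qed
  show "contr A \<rho> \<xi> 1 (a 0) = 0"
  proof (intro ext)
    fix c z vs
    show "contr A \<rho> \<xi> 1 (a 0) c z vs = 0 c z vs"
    \<comment> \<open>The lowest degree that occurs: \<open>dbar\<close> of any component has degree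
      at least \<open>s + 1\<close>, so the contraction of \<open>a 0\<close> stands alone.\<close>
    proof (cases "int (length vs) = s - 1")
      case True
      then have "(\<Sum>r'\<le>p. contr A \<rho> \<xi> 1 (a r') c z vs) = contr A \<rho> \<xi> 1 (a 0) c z vs"
        using len_contr by (intro single) fastforce+
      moreover have "(\<Sum>r'\<le>p. dbar A (a r') c z vs) = 0"
        using len_dbar True by (intro sum.neutral ballI) fastforce
      ultimately show ?thesis using eq by simp
    next
      case False
      then show ?thesis using len_contr[of 0 c z vs] by fastforce
    qed
  qed
qed

end

section \<open>Charts and restriction to a submanifold\<close>

locale manifold_charts =
  fixes X :: "'a::t2_space set" and A :: "('a, 'n::finite) chart set"
  assumes manifold: "complex_manifold X A"
begin

lemma chart: "c \<in> A \<Longrightarrow> is_chart X c"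
  using manifold unfolding complex_manifold_def by blast

lemma charts_compatible: "c \<in> A \<Longrightarrow> d \<in> A \<Longrightarrow> compatible c d"
  using manifold unfolding complex_manifold_def by blast

lemma chart_at: "x \<in> X \<Longrightarrow> \<exists>c\<in>A. x \<in> cdom c"
  using manifold unfolding complex_manifold_def by blast

lemma chart_homeomorphism: "c \<in> A \<Longrightarrow> homeomorphism (cdom c) (cimg c) (coord c) (cinv c)"
  using chart by (auto simp: is_chart_def)

lemma openin_cdom: "c \<in> A \<Longrightarrow> openin (top_of_set X) (cdom c)"
  using chart by (auto simp: is_chart_def)

lemma cdom_subset: "c \<in> A \<Longrightarrow> cdom c \<subseteq> X"
  using openin_cdom openin_imp_subset by blast

sublocale open_charts A
  by unfold_locales (use chart in \<open>auto simp: is_chart_def\<close>)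

lemma cimg_subset: "c \<in> A \<Longrightarrow> cimg c \<subseteq> ctan c"
  using open_cimg openin_imp_subset by blast

lemma coord_cimg: "x \<in> cdom c \<Longrightarrow> coord c x \<in> cimg c"
  by (simp add: cimg_def)

lemma cinv_coord: "c \<in> A \<Longrightarrow> x \<in> cdom c \<Longrightarrow> cinv c (coord c x) = x"
  using chart_homeomorphism by (auto simp: homeomorphism_def)

lemma coord_cinv: "c \<in> A \<Longrightarrow> z \<in> cimg c \<Longrightarrow> coord c (cinv c z) = z"
  using chart_homeomorphism by (auto simp: homeomorphism_def)

lemma cinv_cdom: "c \<in> A \<Longrightarrow> z \<in> cimg c \<Longrightarrow> cinv c z \<in> cdom c"
  using chart_homeomorphism by (fastforce simp: homeomorphism_def)

lemma openin_coord_image: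
  assumes "c \<in> A" "openin (top_of_set X) U"
  shows "openin (top_of_set (ctan c)) (coord c ` (cdom c \<inter> U))"
proof -
  obtain T where "open T" "U = X \<inter> T" using assms(2) openin_open by metis
  then have "cdom c \<inter> U = cdom c \<inter> T" using cdom_subset[OF assms(1)] by auto
  then have "openin (top_of_set (cdom c)) (cdom c \<inter> U)" using \<open>open T\<close> by (simp add: openin_open_Int)
  then have "openin (top_of_set (cimg c)) (coord c ` (cdom c \<inter> U))"
    using homeomorphism_imp_open_map[OF chart_homeomorphism[OF assms(1)]] by blast
  then show ?thesis using open_cimg[OF assms(1)] openin_trans by blast
qed

lemma openin_overlap:
  "c \<in> A \<Longrightarrow> d \<in> A \<Longrightarrow> openin (top_of_set (ctan c)) (coord c ` (cdom c \<inter> cdom d))"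
  by (intro openin_coord_image openin_cdom)

lemma transition_holo:
  "c \<in> A \<Longrightarrow> d \<in> A \<Longrightarrow> holo_on (ctan c) (coord c ` (cdom c \<inter> cdom d)) (coord d \<circ> cinv c)"
  using charts_compatible by (auto simp: compatible_def)

lemma transition_image:
  "c \<in> A \<Longrightarrow> d \<in> A \<Longrightarrow> (coord d \<circ> cinv c) ` coord c ` (cdom c \<inter> cdom d) \<subseteq> cimg d"
  by (auto simp: cinv_coord coord_cimg)

lemma transition_deriv_ctan:
  assumes "c \<in> A" "d \<in> A" "x \<in> cdom c" "x \<in> cdom d" "v \<in> ctan c"
  shows "dir_deriv (coord d \<circ> cinv c) (coord c x) v \<in> ctan d"
  using transition_image[OF assms(1,2)] cimg_subset[OF assms(2)] assms
  by (intro dir_deriv_in_subspace[OF subspace_coord_space openin_overlap[OF assms(1,2)] _ _ subspace_coord_space]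
      smooth_on_differentiable[OF holo_on_smooth[OF transition_holo[OF assms(1,2)]]]) auto

text \<open>\<open>dbar_sum_transform\<close> for the transition map. It gives
  \<open>dbar A \<omega>\<close> the transition law of a form, which makes its restriction
  independent of the chart picked by \<open>pullback\<close>.\<close>

lemma dbar_transition:
  assumes \<omega>: "\<omega> \<in> forms A" and c: "c \<in> A" and d: "d \<in> A" and x: "x \<in> cdom c" "x \<in> cdom d"
    and vs: "set vs \<subseteq> ctan c"
  shows "dbar A \<omega> c (coord c x) vs =
    dbar A \<omega> d (coord d x) (map (dir_deriv (coord d \<circ> cinv c) (coord c x)) vs)"
proof -
  let ?F = "coord d \<circ> cinv c"
  have Fz: "?F (coord c x) = coord d x" using c x by (simp add: cinv_coord)
  have "(\<Sum>j<length vs. (-1) ^ j * dbar_dir (\<lambda>y. \<omega> c y (drop_nth j vs)) (coord c x) (vs ! j)) =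
    (\<Sum>j<length vs. (-1) ^ j * dbar_dir (\<lambda>y. \<omega> d y (drop_nth j (map (dir_deriv ?F (coord c x)) vs)))
      (?F (coord c x)) (dir_deriv ?F (coord c x) (vs ! j)))"
  proof (rule dbar_sum_transform[OF openin_overlap[OF c d] open_cimg[OF d] transition_holo[OF c d]
        transition_image[OF c d] forms_alternating[OF \<omega> d] forms_smooth[OF \<omega> d]])
    fix y us assume y: "y \<in> coord c ` (cdom c \<inter> cdom d)" and us: "set us \<subseteq> ctan c"
    then obtain x' where x': "x' \<in> cdom c" "x' \<in> cdom d" "y = coord c x'" by blast
    then show "\<omega> c y us = \<omega> d (?F y) (map (dir_deriv ?F y) us)"
      using forms_transition[OF \<omega> c d x'(1,2) us] cinv_coord[OF c x'(1)] by simp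
  qed (use x vs in auto)
  moreover have "meaningful A c (coord c x) vs" using c x vs coord_cimg by (auto simp: meaningful_def)
  moreover have "meaningful A d (coord d x) (map (dir_deriv ?F (coord c x)) vs)"
    using d x vs coord_cimg transition_deriv_ctan[OF c d x] by (auto simp: meaningful_def)
  ultimately show ?thesis unfolding dbar_def Fz by simp
qed

section \<open>Slice charts and restriction of forms\<close>

text \<open>Every chart of \<open>Z\<close> shares its coordinate map with an ambient chart in which
  \<open>Z\<close> is a coordinate slice; in this pair the inclusion is the identity.\<close>

lemma sub_atlas_cases:
  assumes "c' \<in> sub_atlas A Z"
  obtains c where "c \<in> A" "cdirs c' \<subseteq> cdirs c" "cdom c' = cdom c \<inter> Z" "coord c' = coord c"
    "cimg c' = cimg c \<inter> ctan c'" "\<forall>z\<in>cimg c'. cinv c' z = cinv c z"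
    "openin (top_of_set (ctan c')) (cimg c')" "\<forall>z\<in>cimg c'. cinv c z \<in> Z"
proof -
  obtain c J where c: "c \<in> A" "J \<subseteq> cdirs c" "coord c ` (cdom c \<inter> Z) = cimg c \<inter> coord_space J"
      "c' = c\<lparr>cdom := cdom c \<inter> Z, cdirs := J\<rparr>"
    using assms unfolding sub_atlas_def by blast
  have img: "cimg c' = coord c ` (cdom c \<inter> Z)" by (simp add: c(4) cimg_def)
  have inj: "inj_on (coord c) (cdom c)" using cinv_coord[OF c(1)] by (metis inj_onI)
  have inv: "cinv c' (coord c x) = x" "cinv c (coord c x) = x" if "x \<in> cdom c \<inter> Z" for x
    using that cinv_coord[OF c(1)] inj by (auto simp: c(4) cinv_def inv_into_f_f inj_on_subset)
  show ?thesis
  proof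
    show "c \<in> A" by fact
    show "cdirs c' \<subseteq> cdirs c" "cdom c' = cdom c \<inter> Z" "coord c' = coord c" using c(2,4) by simp_all
    show "cimg c' = cimg c \<inter> ctan c'" using c(3) img by (simp add: c(4))
    show "\<forall>z\<in>cimg c'. cinv c' z = cinv c z" "\<forall>z\<in>cimg c'. cinv c z \<in> Z"
      using inv by (auto simp: img)
    obtain T where "open T" "cimg c = ctan c \<inter> T" using open_cimg[OF c(1)] openin_open by metis
    then have "cimg c' = ctan c' \<inter> T"
      using c(3) img coord_space_mono[OF c(2)] by (auto simp: c(4))
    then show "openin (top_of_set (ctan c')) (cimg c')" using \<open>open T\<close> by (simp add: openin_open_Int)
  qed
qed

lemma sub_atlas_open_charts: "open_charts (sub_atlas A Z)"
  by unfold_locales (auto elim: sub_atlas_cases)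

abbreviation restr :: "'a set \<Rightarrow> ('a, 'n) form \<Rightarrow> ('a, 'n) form" where
  "restr Z \<equiv> pullback (sub_atlas A Z) A (\<lambda>x. x)"

lemma restr_not_meaningful: "\<not> meaningful (sub_atlas A Z) c' z vs \<Longrightarrow> restr Z \<eta> c' z vs = 0"
  by (simp add: pullback_def)

text \<open>The chart \<open>d\<close> chosen by \<open>pullback\<close> is traded for the ambient
  chart \<open>c\<close> of the slice. The transition law for \<open>vs\<close> is the hypothesis,
  instead of membership in \<open>forms A\<close>, so that \<open>dbar A \<omega>\<close> is covered
  as well.\<close>

lemma restr_eq:
  assumes trans: "\<And>d x. d \<in> A \<Longrightarrow> x \<in> cdom c \<Longrightarrow> x \<in> cdom d \<Longrightarrow>
      \<eta> c (coord c x) vs = \<eta> d (coord d x) (map (dir_deriv (coord d \<circ> cinv c) (coord c x)) vs)"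
    and c': "c' \<in> sub_atlas A Z" "z \<in> cimg c'" "set vs \<subseteq> ctan c'"
    and c: "c \<in> A" "cdom c' = cdom c \<inter> Z" "coord c' = coord c"
      "cimg c' = cimg c \<inter> ctan c'" "\<forall>z\<in>cimg c'. cinv c' z = cinv c z"
      "openin (top_of_set (ctan c')) (cimg c')"
  shows "restr Z \<eta> c' z vs = \<eta> c z vs"
proof -
  define x where "x = cinv c z"
  have zc: "z \<in> cimg c" using c' c by blast
  have x: "x \<in> cdom c" "coord c x = z" "cinv c' z = x"
    using cinv_cdom[OF c(1) zc] coord_cinv[OF c(1) zc] bspec[OF c(5) c'(2)] by (simp_all add: x_def)
  define d where "d = (SOME d. d \<in> A \<and> cinv c' z \<in> cdom d)"
  have d: "d \<in> A" "x \<in> cdom d"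
    using someI_ex[of "\<lambda>d. d \<in> A \<and> cinv c' z \<in> cdom d"] c(1) x unfolding d_def by metis+
  have "dir_deriv (coord d \<circ> (\<lambda>x. x) \<circ> cinv c') z v = dir_deriv (coord d \<circ> cinv c) z v"
    if "v \<in> ctan c'" for v
    using c(5) by (intro dir_deriv_cong[OF subspace_coord_space c(6) c'(2) that]) simp
  then have map_eq: "map (dir_deriv (coord d \<circ> (\<lambda>x. x) \<circ> cinv c') z) vs = map (dir_deriv (coord d \<circ> cinv c) z) vs"
    using c'(3) by auto
  have "restr Z \<eta> c' z vs =
      \<eta> d ((coord d \<circ> (\<lambda>x. x) \<circ> cinv c') z) (map (dir_deriv (coord d \<circ> (\<lambda>x. x) \<circ> cinv c') z) vs)"
    using c' unfolding pullback_def Let_def d_def by (simp add: meaningful_def)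
  then have "restr Z \<eta> c' z vs = \<eta> d (coord d x) (map (dir_deriv (coord d \<circ> cinv c) z) vs)"
    unfolding map_eq by (simp add: x(3))
  then show ?thesis using trans[OF d(1) x(1) d(2)] x(2) by simp
qed

lemma restr_form:
  assumes "\<eta> \<in> forms A" and c': "c' \<in> sub_atlas A Z" "z \<in> cimg c'" "set vs \<subseteq> ctan c'"
    and c: "c \<in> A" "cdirs c' \<subseteq> cdirs c" "cdom c' = cdom c \<inter> Z" "coord c' = coord c"
      "cimg c' = cimg c \<inter> ctan c'" "\<forall>z\<in>cimg c'. cinv c' z = cinv c z"
      "openin (top_of_set (ctan c')) (cimg c')"
  shows "restr Z \<eta> c' z vs = \<eta> c z vs"
  using c'(3) coord_space_mono[OF c(2)]
  by (intro restr_eq[OF _ c' c(1,3,4,5,6,7)] forms_transition[OF assms(1) c(1)]) auto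

text \<open>In a slice chart the restriction has the same local expression on fewer points and
  vectors, which settles alternation, smoothness and type. For the transition law, ambient
  transition maps must also send vectors tangent to \<open>Z\<close> to vectors tangent to
  \<open>Z\<close>.\<close>

lemma restr_forms_pq:
  assumes \<eta>: "\<eta> \<in> forms_pq A p q"
  shows "restr Z \<eta> \<in> forms_pq (sub_atlas A Z) p q"
proof -
  note \<eta>f = forms_pq_forms[OF \<eta>]
  \<comment> \<open>The extension evaluates only on the given vectors and their multiples by
    \<open>\<i>\<close>, which stay in \<open>ctan c'\<close>.\<close>
  have ext: "ext_eval (restr Z \<eta> c' z) xs = ext_eval (\<eta> c z) xs"
    if "\<And>vs. set vs \<subseteq> ctan c' \<Longrightarrow> restr Z \<eta> c' z vs = \<eta> c z vs" "snd ` set xs \<subseteq> ctan c'"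
    for c' c :: "('a, 'n) chart" and z xs
  proof -
    have "ext_eval \<alpha> xs = ext_eval \<beta> xs"
      if "\<And>vs. set vs \<subseteq> ctan c' \<Longrightarrow> \<alpha> vs = \<beta> vs" "snd ` set xs \<subseteq> ctan c'" for \<alpha> \<beta> xs
      using that
    proof (induction xs arbitrary: \<alpha> \<beta>)
      case (Cons x xs)
      obtain e v where x: "x = (e, v)" by (cases x)
      then have "v \<in> ctan c'" "\<i> *s v \<in> ctan c'" using Cons.prems(2) coord_space_scale by auto
      then have "ext_eval (\<lambda>vs. \<alpha> (v # vs)) xs = ext_eval (\<lambda>vs. \<beta> (v # vs)) xs"
        "ext_eval (\<lambda>vs. \<alpha> ((\<i> *s v) # vs)) xs = ext_eval (\<lambda>vs. \<beta> ((\<i> *s v) # vs)) xs"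
        using Cons.prems by (auto intro!: Cons.IH)
      then show ?case by (simp add: x)
    qed simp
    then show ?thesis using that by blast
  qed
  have "restr Z \<eta> \<in> forms (sub_atlas A Z)"
    unfolding forms_def mem_Collect_eq
  proof (intro conjI ballI allI impI)
    fix c' z vs assume "\<not> meaningful (sub_atlas A Z) c' z vs"
    then show "restr Z \<eta> c' z vs = 0" by (rule restr_not_meaningful)
  next
    fix c' z assume c': "c' \<in> sub_atlas A Z" "z \<in> cimg c'"
    obtain c where c: "c \<in> A" "cdirs c' \<subseteq> cdirs c" "cdom c' = cdom c \<inter> Z" "coord c' = coord c"
      "cimg c' = cimg c \<inter> ctan c'" "\<forall>z\<in>cimg c'. cinv c' z = cinv c z"
      "openin (top_of_set (ctan c')) (cimg c')"
      using sub_atlas_cases[OF c'(1)] by metis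
    have alt: "multilinear_alternating (ctan c) (\<eta> c z)"
      using c(1,5) c'(2) by (intro forms_alternating[OF \<eta>f]) blast+
    have sub: "ctan c' \<subseteq> ctan c" using coord_space_mono[OF c(2)] .
    have lin: "a *\<^sub>R v + b *\<^sub>R w \<in> ctan c'" if "v \<in> ctan c'" "w \<in> ctan c'" for a b v w
      by (rule subspace_add[OF subspace_coord_space subspace_scale[OF subspace_coord_space that(1)]
            subspace_scale[OF subspace_coord_space that(2)]])
    note eq = restr_form[OF \<eta>f c' _ c]
    show "multilinear_alternating (ctan c') (restr Z \<eta> c' z)"
      unfolding multilinear_alternating_def
    proof (intro conjI allI impI)
      fix us v w ws and a b :: real
      assume "set us \<subseteq> ctan c' \<and> v \<in> ctan c' \<and> w \<in> ctan c' \<and> set ws \<subseteq> ctan c'"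
      moreover from this sub have "\<eta> c z (us @ (a *\<^sub>R v + b *\<^sub>R w) # ws) =
          complex_of_real a * \<eta> c z (us @ v # ws) + complex_of_real b * \<eta> c z (us @ w # ws)"
        by (intro multilinear_alternatingD(1)[OF alt]) auto
      ultimately show "restr Z \<eta> c' z (us @ (a *\<^sub>R v + b *\<^sub>R w) # ws) =
          complex_of_real a * restr Z \<eta> c' z (us @ v # ws) + complex_of_real b * restr Z \<eta> c' z (us @ w # ws)"
        using lin[of v w a b] by (simp add: eq)
    next
      fix vs assume "set vs \<subseteq> ctan c' \<and> \<not> distinct vs"
      then show "restr Z \<eta> c' z vs = 0"
        using multilinear_alternatingD(2)[OF alt, of vs] sub by (auto simp: eq)
    qed
  next
    fix c' and vs :: "(complex ^ 'n) list"
    assume c': "c' \<in> sub_atlas A Z" and vs: "set vs \<subseteq> ctan c'"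
    obtain c where c: "c \<in> A" "cdirs c' \<subseteq> cdirs c" "cdom c' = cdom c \<inter> Z" "coord c' = coord c"
      "cimg c' = cimg c \<inter> ctan c'" "\<forall>z\<in>cimg c'. cinv c' z = cinv c z"
      "openin (top_of_set (ctan c')) (cimg c')"
      using sub_atlas_cases[OF c'] by metis
    have sub: "ctan c' \<subseteq> ctan c" using coord_space_mono[OF c(2)] .
    have "cimg c' \<subseteq> cimg c" using c(5) by blast
    then have smooth: "smooth_on (ctan c') (cimg c') (\<lambda>z. \<eta> c z vs)"
      by (rule smooth_on_subset[OF forms_smooth[OF \<eta>f c(1) order_trans[OF vs sub]] sub])
    show "smooth_on (ctan c') (cimg c') (\<lambda>z. restr Z \<eta> c' z vs)"
      by (rule smooth_on_cong[OF subspace_coord_space c(7) _ smooth])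
        (simp add: restr_form[OF \<eta>f c' _ vs c])
  next
    fix c' d' x and vs :: "(complex ^ 'n) list"
    assume c': "c' \<in> sub_atlas A Z" and d': "d' \<in> sub_atlas A Z" and x: "x \<in> cdom c' \<inter> cdom d'"
      and vs: "set vs \<subseteq> ctan c'"
    obtain c where c: "c \<in> A" "cdirs c' \<subseteq> cdirs c" "cdom c' = cdom c \<inter> Z" "coord c' = coord c"
      "cimg c' = cimg c \<inter> ctan c'" "\<forall>z\<in>cimg c'. cinv c' z = cinv c z"
      "openin (top_of_set (ctan c')) (cimg c')" "\<forall>z\<in>cimg c'. cinv c z \<in> Z"
      using sub_atlas_cases[OF c'] by metis
    obtain d where d: "d \<in> A" "cdirs d' \<subseteq> cdirs d" "cdom d' = cdom d \<inter> Z" "coord d' = coord d"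
      "cimg d' = cimg d \<inter> ctan d'" "\<forall>z\<in>cimg d'. cinv d' z = cinv d z"
      "openin (top_of_set (ctan d')) (cimg d')"
      using sub_atlas_cases[OF d'] by metis
    have sub: "ctan c' \<subseteq> ctan c" using coord_space_mono[OF c(2)] .
    have xc: "x \<in> cdom c" "x \<in> cdom d" "x \<in> Z" using x c(3) d(3) by auto
    have zc': "coord c x \<in> cimg c'" using x c(4) by (auto simp: cimg_def)
    have zd': "coord d x \<in> cimg d'" using x d(4) by (auto simp: cimg_def)
    let ?F = "coord d \<circ> cinv c"
    have F_eq: "dir_deriv (coord d' \<circ> cinv c') (coord c x) v = dir_deriv ?F (coord c x) v"
      if "v \<in> ctan c'" for v
      using c(6) by (intro dir_deriv_cong[OF subspace_coord_space c(7) zc' that]) (simp add: d(4))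
    \<comment> \<open>Along a line in the slice of \<open>c'\<close> the points stay in
      \<open>Z\<close>, so their images under the ambient transition map stay in the slice of
      \<open>d'\<close>, and with them the derivative.\<close>
    have F_tan: "dir_deriv ?F (coord c x) v \<in> ctan d'" if v: "v \<in> ctan c'" for v
    proof (rule has_vector_derivative_in_subspace[OF subspace_coord_space])
      have z_ov: "coord c x \<in> coord c ` (cdom c \<inter> cdom d)" using xc by blast
      have vc: "v \<in> ctan c" using v sub by blast
      show "((\<lambda>t. ?F (coord c x + t *\<^sub>R v)) has_vector_derivative dir_deriv ?F (coord c x) v) (at 0)"
        by (rule smooth_on_has_dir_deriv[OF holo_on_smooth[OF transition_holo[OF c(1) d(1)]] z_ov vc])
      show "\<forall>\<^sub>F t in nhds 0. ?F (coord c x + t *\<^sub>R v) \<in> ctan d'"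
        using line_in_open[OF subspace_coord_space openin_overlap[OF c(1) d(1)] z_ov vc]
          line_in_open[OF subspace_coord_space c(7) zc' v]
      proof eventually_elim
        case (elim t)
        let ?z = "coord c x + t *\<^sub>R v"
        obtain x' where x': "x' \<in> cdom c" "x' \<in> cdom d" "?z = coord c x'" using elim(1) by blast
        then have "cinv c ?z = x'" using cinv_coord[OF c(1)] by simp
        then have "x' \<in> Z" using bspec[OF c(8) elim(2)] by simp
        then have "coord d x' \<in> cimg d'" using x'(2) d(3,4) by (auto simp: cimg_def)
        then show ?case using \<open>cinv c ?z = x'\<close> d(5) by auto
      qed
    qed
    have "restr Z \<eta> c' (coord c x) vs = \<eta> c (coord c x) vs"
      using restr_form[OF \<eta>f c' zc' vs c(1-7)] .
    also have "\<dots> = \<eta> d (coord d x) (map (dir_deriv ?F (coord c x)) vs)"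
      using sub vs by (intro forms_transition[OF \<eta>f c(1) d(1) xc(1,2)]) auto
    also have "\<dots> = restr Z \<eta> d' (coord d x) (map (dir_deriv ?F (coord c x)) vs)"
      using F_tan vs by (intro restr_form[OF \<eta>f d' zd' _ d, symmetric]) auto
    also have "map (dir_deriv ?F (coord c x)) vs = map (dir_deriv (coord d' \<circ> cinv c') (coord c' x)) vs"
      using F_eq vs c(4) by auto
    finally show "restr Z \<eta> c' (coord c' x) vs =
        restr Z \<eta> d' (coord d' x) (map (dir_deriv (coord d' \<circ> cinv c') (coord c' x)) vs)"
      by (simp only: c(4) d(4))
  qed
  moreover have "int (length (filter fst xs)) = p \<and> int (length (filter (\<lambda>x. \<not> fst x) xs)) = q"
    if c': "c' \<in> sub_atlas A Z" and z: "z \<in> cimg c'" and xs: "snd ` set xs \<subseteq> ctan c'"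
      and nz: "ext_eval (restr Z \<eta> c' z) xs \<noteq> 0" for c' z xs
  proof -
    obtain c where c: "c \<in> A" "cdirs c' \<subseteq> cdirs c" "cdom c' = cdom c \<inter> Z" "coord c' = coord c"
      "cimg c' = cimg c \<inter> ctan c'" "\<forall>z\<in>cimg c'. cinv c' z = cinv c z"
      "openin (top_of_set (ctan c')) (cimg c')"
      using sub_atlas_cases[OF c'] by metis
    have "ext_eval (\<eta> c z) xs \<noteq> 0"
      using ext[OF restr_form[OF \<eta>f c' z _ c] xs] nz by simp
    moreover have "snd ` set xs \<subseteq> ctan c" "z \<in> cimg c"
      using xs coord_space_mono[OF c(2)] z c(5) by auto
    ultimately show ?thesis using \<eta> c(1) unfolding forms_pq_def by blast
  qed
  ultimately show ?thesis unfolding forms_pq_def by blast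
qed

lemma restr_add: "restr Z (\<omega> + \<eta>) = restr Z \<omega> + restr Z \<eta>"
  unfolding pullback_def Let_def by (simp add: fun_eq_iff)

lemma restr_zero: "restr Z 0 = 0"
  unfolding pullback_def Let_def by (simp add: fun_eq_iff)

lemma restr_sum: "restr Z (\<Sum>i\<in>I. f i) = (\<Sum>i\<in>I. restr Z (f i))"
proof (induction I rule: infinite_finite_induct)
  case (insert i I)
  then show ?case
    using restr_add[of Z "f i" "\<Sum>i\<in>I. f i"] by (simp only: sum.insert[OF insert.hyps])
qed (simp_all only: restr_zero sum.infinite sum.empty not_False_eq_True)

lemma restr_koszul:
  assumes "\<omega> \<in> koszul A s"
  shows "restr Z \<omega> \<in> koszul (sub_atlas A Z) s"
proof -
  obtain N a where a: "\<And>r. r \<le> N \<Longrightarrow> a r \<in> forms_pq A (int r) (int r + s)" "\<omega> = (\<Sum>r\<le>N. a r)"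
    using assms unfolding koszul_def by blast
  show ?thesis
    unfolding koszul_def mem_Collect_eq a(2) restr_sum
    using restr_forms_pq[OF a(1)] by (intro exI[of _ N] exI[of _ "\<lambda>r. restr Z (a r)"]) simp
qed

section \<open>Restriction as a map of Koszul complexes\<close>

lemma gen_field_fixed:
  assumes "c \<in> A \<or> c \<in> sub_atlas A Z" "\<forall>g\<in>sphere 0 1. \<rho> g (cinv c z) = cinv c z"
  shows "gen_field \<rho> \<xi> x c z = 0"
  unfolding gen_field_def using assms(2) by simp

lemma contr_fixed:
  assumes "multilinear_alternating (ctan c) (\<omega> c z)" "set vs \<subseteq> ctan c" "gen_field \<rho> \<xi> x c z = 0"
  shows "contr B \<rho> \<xi> x \<omega> c z vs = 0"
proof -
  have "0 \<in> ctan c" by (rule subspace_0[OF subspace_coord_space])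
  then have "\<omega> c z (0 # vs) = 0" using alternating_zero[OF assms(1), of "[]" vs] assms(2) by simp
  then show ?thesis by (simp add: contr_def assms(3))
qed

text \<open>Derivatives along the slice see only points of \<open>Z\<close>, so \<open>dbar\<close>
  commutes with restriction; the contraction vanishes on both sides because the generating field is
  zero at fixed points.\<close>

lemma restr_koszul_D:
  assumes \<omega>: "\<omega> \<in> koszul A s"
    and Z: "\<And>x g. x \<in> Z \<Longrightarrow> g \<in> sphere 0 1 \<Longrightarrow> \<rho> g x = x"
  shows "restr Z (koszul_D A \<rho> \<xi> \<omega>) = koszul_D (sub_atlas A Z) \<rho> \<xi> (restr Z \<omega>)"
proof (intro ext)
  fix c' z vs
  note \<omega>f = koszul_forms[OF \<omega>]
  interpret sub: open_charts "sub_atlas A Z" by (rule sub_atlas_open_charts)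
  have r\<omega>f: "restr Z \<omega> \<in> forms (sub_atlas A Z)" using sub.koszul_forms[OF restr_koszul[OF \<omega>]] .
  show "restr Z (koszul_D A \<rho> \<xi> \<omega>) c' z vs = koszul_D (sub_atlas A Z) \<rho> \<xi> (restr Z \<omega>) c' z vs"
  proof (cases "meaningful (sub_atlas A Z) c' z vs")
    case False
    then show ?thesis by (simp add: restr_not_meaningful koszul_D_def dbar_def contr_def)
  next
    case True
    then have c': "c' \<in> sub_atlas A Z" "z \<in> cimg c'" "set vs \<subseteq> ctan c'" by (auto simp: meaningful_def)
    obtain c where c: "c \<in> A" "cdirs c' \<subseteq> cdirs c" "cdom c' = cdom c \<inter> Z" "coord c' = coord c"
      "cimg c' = cimg c \<inter> ctan c'" "\<forall>z\<in>cimg c'. cinv c' z = cinv c z"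
      "openin (top_of_set (ctan c')) (cimg c')" "\<forall>z\<in>cimg c'. cinv c z \<in> Z"
      using sub_atlas_cases[OF c'(1)] by metis
    have zc: "z \<in> cimg c" and vsc: "set vs \<subseteq> ctan c"
      using c'(2,3) c(5) coord_space_mono[OF c(2)] by auto
    have fixed: "\<forall>g\<in>sphere 0 1. \<rho> g (cinv c z) = cinv c z" using Z bspec[OF c(8) c'(2)] by blast
    have "restr Z (dbar A \<omega>) c' z vs = dbar A \<omega> c z vs"
      using dbar_transition[OF \<omega>f c(1)] vsc by (intro restr_eq[OF _ c' c(1,3-7)]) auto
    also have "\<dots> = (\<Sum>j<length vs. (-1) ^ j * dbar_dir (\<lambda>y. \<omega> c y (drop_nth j vs)) z (vs ! j))"
      using c(1) zc vsc by (simp add: dbar_def meaningful_def)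
    also have "\<dots> = (\<Sum>j<length vs. (-1) ^ j * dbar_dir (\<lambda>y. restr Z \<omega> c' y (drop_nth j vs)) z (vs ! j))"
    proof (intro sum.cong refl)
      fix j assume "j \<in> {..<length vs}"
      then have "vs ! j \<in> ctan c'" using c'(3) nth_mem by blast
      then have vj: "vs ! j \<in> ctan c'" "\<i> *s (vs ! j) \<in> ctan c'" by (auto intro: coord_space_scale)
      have us: "set (drop_nth j vs) \<subseteq> ctan c'" by (rule order_trans[OF set_drop_nth c'(3)])
      have "dir_deriv (\<lambda>y. \<omega> c y (drop_nth j vs)) z v =
          dir_deriv (\<lambda>y. restr Z \<omega> c' y (drop_nth j vs)) z v" if "v \<in> ctan c'" for v
        using restr_form[OF \<omega>f c'(1) _ us c(1-7)]
        by (intro dir_deriv_cong[OF subspace_coord_space c(7) c'(2) that]) simp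
      then show "(-1) ^ j * dbar_dir (\<lambda>y. \<omega> c y (drop_nth j vs)) z (vs ! j) =
          (-1) ^ j * dbar_dir (\<lambda>y. restr Z \<omega> c' y (drop_nth j vs)) z (vs ! j)"
        using vj by (simp add: dbar_dir_def)
    qed
    also have "\<dots> = dbar (sub_atlas A Z) (restr Z \<omega>) c' z vs"
      using True by (simp add: dbar_def)
    finally have 1: "restr Z (dbar A \<omega>) c' z vs = dbar (sub_atlas A Z) (restr Z \<omega>) c' z vs" .
    \<comment> \<open>No transition law is at hand for the contraction, so it is computed in the
      very chart \<open>d\<close> that \<open>pullback\<close> picks; at a fixed point it vanishes
      in every chart.\<close>
    have 2: "restr Z (contr A \<rho> \<xi> 1 \<omega>) c' z vs = 0"
    proof -
      define x where "x = cinv c' z"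
      define d where "d = (SOME d. d \<in> A \<and> x \<in> cdom d)"
      let ?F = "coord d \<circ> (\<lambda>x. x) \<circ> cinv c'"
      have xZ: "x \<in> Z" "x \<in> cdom c" using bspec[OF c(6) c'(2)] bspec[OF c(8) c'(2)] cinv_cdom[OF c(1) zc] by (simp_all add: x_def)
      then have d: "d \<in> A" "x \<in> cdom d"
        using someI_ex[of "\<lambda>d. d \<in> A \<and> x \<in> cdom d"] c(1) unfolding d_def by blast+
      have "contr A \<rho> \<xi> 1 \<omega> d (?F z) (map (dir_deriv ?F z) vs) = 0"
      proof (cases "meaningful A d (?F z) (map (dir_deriv ?F z) vs)")
        case True
        have "gen_field \<rho> \<xi> 1 d (?F z) = 0"
          using d xZ(1) Z cinv_coord[OF d] by (intro gen_field_fixed) (auto simp: x_def)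
        then show ?thesis
          using True by (intro contr_fixed forms_alternating[OF \<omega>f]) (auto simp: meaningful_def)
      qed (simp add: contr_def)
      then show ?thesis using True by (simp add: pullback_def x_def[symmetric] d_def[symmetric] Let_def)
    qed
    have 3: "contr (sub_atlas A Z) \<rho> \<xi> 1 (restr Z \<omega>) c' z vs = 0"
      using fixed bspec[OF c(6) c'(2)] c'
      by (intro contr_fixed forms_alternating[OF r\<omega>f] gen_field_fixed) auto
    have "restr Z (koszul_D A \<rho> \<xi> \<omega>) c' z vs = restr Z (dbar A \<omega>) c' z vs - restr Z (contr A \<rho> \<xi> 1 \<omega>) c' z vs"
      unfolding koszul_D_def pullback_def Let_def by simp
    then show ?thesis using 1 2 3 by (simp add: koszul_D_def)
  qed
qed

end

section \<open>Averaging over the circle\<close>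

text \<open>The value \<open>0\<close> off the domain makes \<open>push_chart\<close> an action up to equality of records.\<close>

definition push_chart :: "(complex \<Rightarrow> 'a \<Rightarrow> 'a) \<Rightarrow> complex \<Rightarrow> ('a, 'n::finite) chart \<Rightarrow> ('a, 'n) chart" where
  "push_chart \<rho> g c = \<lparr>cdom = \<rho> g ` cdom c,
     coord = (\<lambda>x. if x \<in> \<rho> g ` cdom c then coord c (\<rho> (inverse g) x) else 0), cdirs = cdirs c\<rparr>"

text \<open>For a form \<open>\<omega>\<close>, the integrand is the local expression in
  \<open>c\<close> of its pullback along \<open>cis \<theta>\<close>, see
  \<open>pullback_push\<close>; the circle has total mass 1.\<close>

definition avg :: "('a, 'n::finite) chart set \<Rightarrow> (complex \<Rightarrow> 'a \<Rightarrow> 'a) \<Rightarrow> ('a, 'n) form \<Rightarrow> ('a, 'n) form" where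
  "avg A \<rho> \<omega> = (\<lambda>c z vs. if c \<in> A
     then integral {0..2 * pi} (\<lambda>\<theta>. \<omega> (push_chart \<rho> (cis \<theta>) c) z vs) / complex_of_real (2 * pi) else 0)"

lemma holo_on_cong:
  assumes J: "openin (top_of_set (coord_space J)) S" and eq: "\<And>y. y \<in> S \<Longrightarrow> f y = g y"
    and f: "holo_on (coord_space J) S f"
  shows "holo_on (coord_space J) S g"
proof -
  have "\<exists>f'. (g has_derivative f') (at z within S) \<and> (\<forall>a v. f' (a *s v) = a *s f' v)" if "z \<in> S" for z
  proof -
    obtain f' where f': "(f has_derivative f') (at z within S)" "\<forall>a v. f' (a *s v) = a *s f' v"
      using f \<open>z \<in> S\<close> unfolding holo_on_def by blast
    have "(g has_derivative f') (at z within S)"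
      by (rule has_derivative_transform[OF \<open>z \<in> S\<close> _ f'(1)]) (simp add: eq)
    then show ?thesis using f'(2) by blast
  qed
  moreover have "smooth_on (coord_space J) S g"
    by (rule smooth_on_cong[OF subspace_coord_space J eq holo_on_smooth[OF f]])
  ultimately show ?thesis unfolding holo_on_def by blast
qed

text \<open>The part of the shifted interval beyond the period is moved back by one period.\<close>

lemma integral_periodic:
  fixes H :: "real \<Rightarrow> 'e::euclidean_space"
  assumes cont: "continuous_on UNIV H" and per: "\<And>t. H (t + p) = H t" and a: "0 \<le> a" "a \<le> p"
  shows "integral {0..p} (\<lambda>t. H (t + a)) = integral {0..p} H"
proof -
  have int: "H integrable_on {u..v}" for u v
    by (rule integrable_continuous_interval[OF continuous_on_subset[OF cont]]) simp
  have shift: "integral {u..v} (\<lambda>t. H (t + b)) = integral {u + b..v + b} H" for u v b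
    using integral_shift_real_ivl[of "u + b" b "v + b" H] by simp
  have "integral {0..p} (\<lambda>t. H (t + a)) = integral {a..p} H + integral {p..p + a} H"
    using shift[of 0 p a] a by (simp add: Henstock_Kurzweil_Integration.integral_combine[OF _ _ int])
  also have "integral {p..p + a} H = integral {0..a} H"
    using shift[of 0 a p] per by (simp add: add.commute)
  also have "integral {a..p} H + integral {0..a} H = integral {0..p} H"
    using Henstock_Kurzweil_Integration.integral_combine[OF a int] by (simp add: add.commute)
  finally show ?thesis .
qed

text \<open>Continuity of the extended value belongs to the conclusion because the induction needs
  both parts of the split integrand to be integrable.\<close>

lemma ext_eval_integral:
  fixes \<alpha> :: "real \<Rightarrow> (complex ^ 'n::finite) list \<Rightarrow> complex"
  assumes "\<And>vs. continuous_on {a..b} (\<lambda>\<theta>. \<alpha> \<theta> vs)"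
  shows "ext_eval (\<lambda>vs. integral {a..b} (\<lambda>\<theta>. \<alpha> \<theta> vs)) xs = integral {a..b} (\<lambda>\<theta>. ext_eval (\<alpha> \<theta>) xs) \<and>
    continuous_on {a..b} (\<lambda>\<theta>. ext_eval (\<alpha> \<theta>) xs)"
  using assms
proof (induction xs arbitrary: \<alpha>)
  case (Cons x xs)
  obtain e v where x: "x = (e, v)" by (cases x)
  define k where "k = (if e then - \<i> else \<i>)"
  define E where "E = (\<lambda>w \<theta>. ext_eval (\<lambda>vs. \<alpha> \<theta> (w # vs)) xs)"
  have IH: "ext_eval (\<lambda>vs. integral {a..b} (\<lambda>\<theta>. \<alpha> \<theta> (w # vs))) xs = integral {a..b} (E w)"
    "continuous_on {a..b} (E w)" for w
    using Cons.IH[of "\<lambda>\<theta> vs. \<alpha> \<theta> (w # vs)"] Cons.prems by (auto simp: E_def)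
  have int: "E w integrable_on {a..b}" for w by (rule integrable_continuous_interval[OF IH(2)])
  have "integral {a..b} (\<lambda>\<theta>. (E v \<theta> + k * E (\<i> *s v) \<theta>) / 2) =
      (integral {a..b} (E v) + k * integral {a..b} (E (\<i> *s v))) / 2"
    using int by (simp add: integral_add integrable_on_mult_right)
  moreover have "continuous_on {a..b} (\<lambda>\<theta>. (E v \<theta> + k * E (\<i> *s v) \<theta>) / 2)"
    by (intro continuous_intros IH) simp
  ultimately show ?case using IH(1) by (simp add: x k_def[symmetric] E_def)
qed simp

locale circle_manifold = manifold_charts X A
  for X :: "'a::t2_space set" and A :: "('a, 'n::finite) chart set" +
  fixes \<rho> :: "complex \<Rightarrow> 'a \<Rightarrow> 'a"
  assumes action: "holo_circle_action X A \<rho>"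
begin

abbreviation push where "push \<equiv> push_chart \<rho>"

lemma action_one: "x \<in> X \<Longrightarrow> \<rho> 1 x = x"
  and action_mult: "g \<in> sphere 0 1 \<Longrightarrow> h \<in> sphere 0 1 \<Longrightarrow> x \<in> X \<Longrightarrow> \<rho> (g * h) x = \<rho> g (\<rho> h x)"
  and action_holo: "g \<in> sphere 0 1 \<Longrightarrow> holo_map X A X A (\<rho> g)"
  and action_continuous: "continuous_on (sphere 0 1 \<times> X) (\<lambda>(g, x). \<rho> g x)"
  and action_smooth: "c \<in> A \<Longrightarrow> d \<in> A \<Longrightarrow> smooth_on (UNIV \<times> ctan c)
        {(\<theta>::real, z). z \<in> cimg c \<and> \<rho> (cis \<theta>) (cinv c z) \<in> cdom d}
        (\<lambda>(\<theta>, z). coord d (\<rho> (cis \<theta>) (cinv c z)))"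
  using action unfolding holo_circle_action_def by blast+

lemma action_closed: "g \<in> sphere 0 1 \<Longrightarrow> x \<in> X \<Longrightarrow> \<rho> g x \<in> X"
  using action_holo unfolding holo_map_def by blast

lemma inverse_sphere: "g \<in> sphere 0 1 \<Longrightarrow> inverse g \<in> sphere (0::complex) 1"
  by (simp add: norm_inverse)

lemma cis_sphere: "cis \<theta> \<in> sphere 0 1"
  by simp

lemma action_inverse:
  assumes "g \<in> sphere 0 1" "x \<in> X"
  shows "\<rho> (inverse g) (\<rho> g x) = x" "\<rho> g (\<rho> (inverse g) x) = x"
proof -
  have "g \<noteq> 0" using assms(1) by auto
  then have "inverse g * g = 1" "g * inverse g = 1" by simp_all
  then show "\<rho> (inverse g) (\<rho> g x) = x" "\<rho> g (\<rho> (inverse g) x) = x"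
    using action_mult[OF inverse_sphere[OF assms(1)] assms] action_one[OF assms(2)]
      action_mult[OF assms(1) inverse_sphere[OF assms(1)] assms(2)] by metis+
qed

lemma action_homeomorphism:
  assumes "g \<in> sphere 0 1"
  shows "homeomorphism X X (\<rho> g) (\<rho> (inverse g))"
  using assms inverse_sphere[OF assms] action_holo action_inverse action_closed
  unfolding homeomorphism_def holo_map_def by (auto simp: image_iff) metis+

lemma openin_action_image: "g \<in> sphere 0 1 \<Longrightarrow> openin (top_of_set X) U \<Longrightarrow> openin (top_of_set X) (\<rho> g ` U)"
  using homeomorphism_imp_open_map[OF action_homeomorphism] by blast

section \<open>Charts transported by the group\<close>

lemma cdirs_push [simp]: "cdirs (push g c) = cdirs c"
  and cdom_push: "cdom (push g c) = \<rho> g ` cdom c"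
  by (simp_all add: push_chart_def)

lemma coord_push:
  assumes "c \<in> A" "g \<in> sphere 0 1" "x \<in> cdom c"
  shows "coord (push g c) (\<rho> g x) = coord c x"
  using assms cdom_subset[OF assms(1)] action_inverse(1)[OF assms(2)] by (auto simp: push_chart_def)

lemma cimg_push: "c \<in> A \<Longrightarrow> g \<in> sphere 0 1 \<Longrightarrow> cimg (push g c) = cimg c"
  unfolding cimg_def cdom_push image_image by (rule image_cong[OF refl]) (rule coord_push)

lemma cinv_push:
  assumes "c \<in> A" "g \<in> sphere 0 1" "z \<in> cimg c"
  shows "cinv (push g c) z = \<rho> g (cinv c z)"
proof -
  have "inj_on (coord (push g c)) (cdom (push g c))"
  proof (rule inj_onI)
    fix x y assume "x \<in> cdom (push g c)" "y \<in> cdom (push g c)" and eq: "coord (push g c) x = coord (push g c) y"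
    then obtain x' y' where xy: "x' \<in> cdom c" "y' \<in> cdom c" "x = \<rho> g x'" "y = \<rho> g y'" by (auto simp: cdom_push)
    then have "coord c x' = coord c y'" using eq coord_push[OF assms(1,2)] by simp
    then show "x = y" using xy cinv_coord[OF assms(1)] by metis
  qed
  moreover have "\<rho> g (cinv c z) \<in> cdom (push g c)" using cinv_cdom[OF assms(1,3)] by (simp add: cdom_push)
  moreover have "coord (push g c) (\<rho> g (cinv c z)) = z"
    using coord_push[OF assms(1,2) cinv_cdom[OF assms(1,3)]] coord_cinv[OF assms(1,3)] by simp
  ultimately show ?thesis unfolding cinv_def by (metis inv_into_f_f)
qed

lemma push_is_chart:
  assumes c: "c \<in> A" and g: "g \<in> sphere 0 1"
  shows "is_chart X (push g c)"
  unfolding is_chart_def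
proof (intro conjI)
  show "openin (top_of_set X) (cdom (push g c))"
    unfolding cdom_push by (intro openin_action_image g openin_cdom c)
  show "openin (top_of_set (ctan (push g c))) (cimg (push g c))"
    using open_cimg[OF c] cimg_push[OF c g] by simp
  have hg: "continuous_on X (\<rho> g)" "continuous_on X (\<rho> (inverse g))"
    using action_homeomorphism[OF g] by (auto simp: homeomorphism_def)
  have hc: "continuous_on (cdom c) (coord c)" "continuous_on (cimg c) (cinv c)"
    using chart_homeomorphism[OF c] by (auto simp: homeomorphism_def)
  have sub: "cdom c \<subseteq> X" by (rule cdom_subset[OF c])
  show "homeomorphism (cdom (push g c)) (cimg (push g c)) (coord (push g c)) (cinv (push g c))"
  proof (rule homeomorphismI)
    have "continuous_on (\<rho> g ` cdom c) (\<lambda>x. coord c (\<rho> (inverse g) x))"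
    proof (rule continuous_on_compose2[OF hc(1)])
      show "continuous_on (\<rho> g ` cdom c) (\<rho> (inverse g))"
        using hg(2) by (rule continuous_on_subset) (use sub action_closed[OF g] in auto)
      show "\<rho> (inverse g) ` \<rho> g ` cdom c \<subseteq> cdom c"
        using sub action_inverse(1)[OF g] by (auto simp: subset_iff)
    qed
    then show "continuous_on (cdom (push g c)) (coord (push g c))"
      unfolding cdom_push by (rule continuous_on_eq) (simp add: push_chart_def)
    have "continuous_on (cimg c) (\<lambda>z. \<rho> g (cinv c z))"
      by (rule continuous_on_compose2[OF hg(1) hc(2)]) (use sub cinv_cdom[OF c] in auto)
    then show "continuous_on (cimg (push g c)) (cinv (push g c))"
      unfolding cimg_push[OF c g] by (rule continuous_on_eq) (simp add: cinv_push[OF c g])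
    show "coord (push g c) ` cdom (push g c) \<subseteq> cimg (push g c)" by (simp add: cimg_def)
    show "cinv (push g c) ` cimg (push g c) \<subseteq> cdom (push g c)"
      using cinv_cdom[OF c] cinv_push[OF c g] by (auto simp: cimg_push[OF c g] cdom_push)
    show "cinv (push g c) (coord (push g c) x) = x" if "x \<in> cdom (push g c)" for x
      using that by (auto simp: cdom_push coord_push[OF c g] cinv_push[OF c g] coord_cimg cinv_coord[OF c])
    show "coord (push g c) (cinv (push g c) z) = z" if "z \<in> cimg (push g c)" for z
      using that by (auto simp: cimg_push[OF c g] coord_push[OF c g] cinv_push[OF c g] cinv_cdom[OF c] coord_cinv[OF c])
  qed
qed

text \<open>The coordinate changes between \<open>push g c\<close> and \<open>d\<close> are the
  local expressions of \<open>\<rho> g\<close> and \<open>\<rho> (inverse g)\<close>, which are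
  holomorphic by \<open>action_holo\<close>.\<close>

lemma push_compatible:
  assumes c: "c \<in> A" and d: "d \<in> A" and g: "g \<in> sphere 0 1"
  shows "compatible (push g c) d"
  unfolding compatible_def
proof
  note g' = inverse_sphere[OF g]
  have S_eq: "coord (push g c) ` (cdom (push g c) \<inter> cdom d) = {z \<in> cimg c. \<rho> g (cinv c z) \<in> cdom d}"
  proof (intro set_eqI iffI)
    fix z assume "z \<in> coord (push g c) ` (cdom (push g c) \<inter> cdom d)"
    then obtain x where "x \<in> cdom c" "\<rho> g x \<in> cdom d" "z = coord c x"
      by (auto simp: cdom_push coord_push[OF c g])
    then show "z \<in> {z \<in> cimg c. \<rho> g (cinv c z) \<in> cdom d}" by (simp add: coord_cimg cinv_coord[OF c])
  next
    fix z assume z: "z \<in> {z \<in> cimg c. \<rho> g (cinv c z) \<in> cdom d}"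
    then have "z = coord (push g c) (\<rho> g (cinv c z))"
      by (simp add: coord_push[OF c g] cinv_cdom[OF c] coord_cinv[OF c])
    then show "z \<in> coord (push g c) ` (cdom (push g c) \<inter> cdom d)"
      using z cinv_cdom[OF c] by (auto simp: cdom_push)
  qed
  have "{z \<in> cimg c. \<rho> g (cinv c z) \<in> cdom d} = coord c ` (cdom c \<inter> \<rho> (inverse g) ` cdom d)"
  proof (intro set_eqI iffI)
    fix z assume z: "z \<in> {z \<in> cimg c. \<rho> g (cinv c z) \<in> cdom d}"
    then have "cinv c z \<in> cdom c" "coord c (cinv c z) = z" by (simp_all add: cinv_cdom[OF c] coord_cinv[OF c])
    moreover from this have "cinv c z = \<rho> (inverse g) (\<rho> g (cinv c z))"
      using cdom_subset[OF c] action_inverse(1)[OF g] by (metis subsetD)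
    moreover have "\<rho> g (cinv c z) \<in> cdom d" using z by simp
    ultimately show "z \<in> coord c ` (cdom c \<inter> \<rho> (inverse g) ` cdom d)" by (metis IntI image_eqI)
  next
    fix z assume "z \<in> coord c ` (cdom c \<inter> \<rho> (inverse g) ` cdom d)"
    then obtain x y where "x \<in> cdom c" "y \<in> cdom d" "x = \<rho> (inverse g) y" "z = coord c x" by blast
    moreover from this have "\<rho> g x = y" using cdom_subset[OF d] action_inverse(2)[OF g] by blast
    ultimately show "z \<in> {z \<in> cimg c. \<rho> g (cinv c z) \<in> cdom d}" by (simp add: coord_cimg cinv_coord[OF c])
  qed
  then have S_open: "openin (top_of_set (ctan c)) {z \<in> cimg c. \<rho> g (cinv c z) \<in> cdom d}"
    using openin_coord_image[OF c openin_action_image[OF g' openin_cdom[OF d]]] by simp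
  have S_holo: "holo_on (ctan c) {z \<in> cimg c. \<rho> g (cinv c z) \<in> cdom d} (coord d \<circ> \<rho> g \<circ> cinv c)"
    using action_holo[OF g] c d unfolding holo_map_def by blast
  show "holo_on (ctan (push g c)) (coord (push g c) ` (cdom (push g c) \<inter> cdom d)) (coord d \<circ> cinv (push g c))"
    unfolding cdirs_push S_eq
    by (rule holo_on_cong[OF S_open _ S_holo]) (simp add: cinv_push[OF c g])
  have S'_eq: "coord d ` (cdom (push g c) \<inter> cdom d) = {z \<in> cimg d. \<rho> (inverse g) (cinv d z) \<in> cdom c}"
  proof (intro set_eqI iffI)
    fix z assume "z \<in> coord d ` (cdom (push g c) \<inter> cdom d)"
    then obtain x where "x \<in> cdom c" "\<rho> g x \<in> cdom d" "z = coord d (\<rho> g x)" by (auto simp: cdom_push)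
    then show "z \<in> {z \<in> cimg d. \<rho> (inverse g) (cinv d z) \<in> cdom c}"
      using cdom_subset[OF c] action_inverse(1)[OF g] by (auto simp: coord_cimg cinv_coord[OF d] subset_iff)
  next
    fix z assume z: "z \<in> {z \<in> cimg d. \<rho> (inverse g) (cinv d z) \<in> cdom c}"
    then have *: "cinv d z \<in> cdom d" "coord d (cinv d z) = z" by (simp_all add: cinv_cdom[OF d] coord_cinv[OF d])
    then have "cinv d z = \<rho> g (\<rho> (inverse g) (cinv d z))"
      using cdom_subset[OF d] action_inverse(2)[OF g] by (metis subsetD)
    then have "cinv d z \<in> cdom (push g c)" using z by (auto simp: cdom_push)
    then show "z \<in> coord d ` (cdom (push g c) \<inter> cdom d)" using * by (metis IntI image_eqI)
  qed
  have S'_open: "openin (top_of_set (ctan d)) (coord d ` (cdom (push g c) \<inter> cdom d))"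
    using openin_coord_image[OF d openin_action_image[OF g openin_cdom[OF c]]]
    by (simp add: cdom_push Int_commute)
  have S'_holo: "holo_on (ctan d) (coord d ` (cdom (push g c) \<inter> cdom d)) (coord c \<circ> \<rho> (inverse g) \<circ> cinv d)"
    unfolding S'_eq using action_holo[OF g'] c d unfolding holo_map_def by blast
  show "holo_on (ctan d) (coord d ` (cdom (push g c) \<inter> cdom d)) (coord (push g c) \<circ> cinv d)"
    by (rule holo_on_cong[OF S'_open _ S'_holo]) (auto simp: cinv_coord[OF d] push_chart_def)
qed

text \<open>Maximality of the atlas is what admits the transported charts.\<close>

lemma push_atlas: "c \<in> A \<Longrightarrow> g \<in> sphere 0 1 \<Longrightarrow> push g c \<in> A"
  using manifold push_is_chart push_compatible unfolding complex_manifold_def by blast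

text \<open>A form takes the chart itself as an argument, so the two charts have to be equal as
  records and not just on their domain.\<close>

lemma push_push:
  assumes "c \<in> A" "g \<in> sphere 0 1" "h \<in> sphere 0 1"
  shows "push h (push g c) = push (h * g) c"
proof -
  have hg: "h * g \<in> sphere 0 1" using assms(2,3) by (simp add: norm_mult)
  note X = subsetD[OF cdom_subset[OF assms(1)]]
  have dom: "\<rho> h ` \<rho> g ` cdom c = \<rho> (h * g) ` cdom c"
    unfolding image_image using action_mult[OF assms(3,2)] X by (intro image_cong) auto
  have "coord (push h (push g c)) x = coord (push (h * g) c) x" for x
  proof (cases "x \<in> \<rho> (h * g) ` cdom c")
    case True
    then obtain y where y: "y \<in> cdom c" "x = \<rho> (h * g) y" by blast
    then have "x = \<rho> h (\<rho> g y)" using action_mult[OF assms(3,2)] X by simp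
    then have "coord (push h (push g c)) x = coord (push g c) (\<rho> g y)"
      using coord_push[OF push_atlas[OF assms(1,2)] assms(3)] y by (simp add: cdom_push)
    then show ?thesis using y coord_push[OF assms(1,2)] coord_push[OF assms(1) hg] by simp
  qed (simp add: push_chart_def[of \<rho> h] push_chart_def[of \<rho> "h * g"] cdom_push dom)
  then have "coord (push h (push g c)) = coord (push (h * g) c)" by blast
  moreover have "cdom (push h (push g c)) = cdom (push (h * g) c)" by (simp add: cdom_push dom)
  ultimately show ?thesis by (simp add: chart.equality)
qed

lemma meaningful_push: "c \<in> A \<Longrightarrow> g \<in> sphere 0 1 \<Longrightarrow> meaningful A (push g c) z vs \<longleftrightarrow> meaningful A c z vs"
  by (simp add: meaningful_def push_atlas cimg_push)

text \<open>In \<open>push g c\<close> the moved point \<open>\<rho> g (cinv c z)\<close> has the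
  coordinate \<open>z\<close> again, and the change to the chart picked by \<open>pullback\<close>
  is the local expression of \<open>\<rho> g\<close>. The claim is then the transition law.\<close>

lemma pullback_push:
  assumes \<eta>: "\<eta> \<in> forms A" and c: "c \<in> A" and g: "g \<in> sphere 0 1"
  shows "pullback A A (\<rho> g) \<eta> c z vs = \<eta> (push g c) z vs"
proof (cases "meaningful A c z vs")
  case False
  then show ?thesis using forms_zero[OF \<eta>] meaningful_push[OF c g] by (simp add: pullback_def)
next
  case True
  then have z: "z \<in> cimg c" and vs: "set vs \<subseteq> ctan c" by (auto simp: meaningful_def)
  define x where "x = \<rho> g (cinv c z)"
  have xc: "x \<in> cdom (push g c)" "coord (push g c) x = z"
    using cinv_cdom[OF c z] coord_push[OF c g cinv_cdom[OF c z]] coord_cinv[OF c z] by (simp_all add: x_def cdom_push)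
  define d where "d = (SOME d. d \<in> A \<and> \<rho> g (cinv c z) \<in> cdom d)"
  have d: "d \<in> A" "x \<in> cdom d"
    using someI_ex[of "\<lambda>d. d \<in> A \<and> \<rho> g (cinv c z) \<in> cdom d"] push_atlas[OF c g] xc(1)
    unfolding d_def x_def by metis+
  have "dir_deriv (coord d \<circ> cinv (push g c)) z v = dir_deriv (coord d \<circ> \<rho> g \<circ> cinv c) z v" if "v \<in> ctan c" for v
    by (rule dir_deriv_cong[OF subspace_coord_space open_cimg[OF c] z that]) (simp add: cinv_push[OF c g])
  then have map_eq: "map (dir_deriv (coord d \<circ> \<rho> g \<circ> cinv c) z) vs = map (dir_deriv (coord d \<circ> cinv (push g c)) z) vs"
    using vs by auto
  have "pullback A A (\<rho> g) \<eta> c z vs = \<eta> d ((coord d \<circ> \<rho> g \<circ> cinv c) z) (map (dir_deriv (coord d \<circ> \<rho> g \<circ> cinv c) z) vs)"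
    using True unfolding pullback_def Let_def d_def by simp
  also have "\<dots> = \<eta> d (coord d x) (map (dir_deriv (coord d \<circ> cinv (push g c)) z) vs)"
    unfolding map_eq by (simp add: x_def)
  also have "\<dots> = \<eta> (push g c) z vs"
    using forms_transition[OF \<eta> push_atlas[OF c g] d(1) xc(1) d(2), of vs] vs xc(2) by simp
  finally show ?thesis .
qed

section \<open>Smooth dependence on the group element\<close>

lemma orbit_continuous:
  assumes c: "c \<in> A"
  shows "continuous_on (UNIV \<times> cimg c) (\<lambda>(\<theta>, z). \<rho> (cis \<theta>) (cinv c z))"
proof -
  have "continuous_on (cimg c) (cinv c)" using chart_homeomorphism[OF c] by (simp add: homeomorphism_def)
  then have "continuous_on ((UNIV :: real set) \<times> cimg c) (\<lambda>p. cinv c (snd p))"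
    by (rule continuous_on_compose2) (auto intro: continuous_intros)
  then have "continuous_on (UNIV \<times> cimg c) (\<lambda>p. (cis (fst p), cinv c (snd p)))"
    by (intro continuous_intros)
  moreover have "(\<lambda>p. (cis (fst p), cinv c (snd p))) ` (UNIV \<times> cimg c) \<subseteq> sphere 0 1 \<times> X"
    using cinv_cdom[OF c] cdom_subset[OF c] by auto
  ultimately show ?thesis
    using continuous_on_compose2[OF action_continuous] by (fastforce simp: split_def)
qed

text \<open>On these sets \<open>holo_circle_action\<close> asserts smoothness. Openness in
  \<open>UNIV \<times> cimg c\<close> makes them a cover for \<open>smooth_on_local\<close>;
  openness in \<open>UNIV \<times> ctan c\<close> admits the calculus.\<close>

lemma openin_action_domain:
  assumes c: "c \<in> A" and d: "d \<in> A"
  shows "openin (top_of_set (UNIV \<times> cimg c)) {(\<theta>::real, z). z \<in> cimg c \<and> \<rho> (cis \<theta>) (cinv c z) \<in> cdom d}"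
    and "openin (top_of_set (UNIV \<times> ctan c)) {(\<theta>::real, z). z \<in> cimg c \<and> \<rho> (cis \<theta>) (cinv c z) \<in> cdom d}"
proof -
  obtain T where T: "open T" "cdom d = X \<inter> T" using openin_cdom[OF d] openin_open by metis
  have "{(\<theta>::real, z). z \<in> cimg c \<and> \<rho> (cis \<theta>) (cinv c z) \<in> cdom d} =
      (UNIV \<times> cimg c) \<inter> (\<lambda>(\<theta>, z). \<rho> (cis \<theta>) (cinv c z)) -` T"
    using T(2) cinv_cdom[OF c] subsetD[OF cdom_subset[OF c]] action_closed[OF cis_sphere] by auto
  then show 1: "openin (top_of_set (UNIV \<times> cimg c)) {(\<theta>::real, z). z \<in> cimg c \<and> \<rho> (cis \<theta>) (cinv c z) \<in> cdom d}"
    using continuous_openin_preimage_gen[OF orbit_continuous[OF c] T(1)] by simp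
  have "openin (top_of_set (UNIV \<times> ctan c)) ((UNIV :: real set) \<times> cimg c)"
    by (intro openin_Times open_cimg c) simp
  then show "openin (top_of_set (UNIV \<times> ctan c)) {(\<theta>::real, z). z \<in> cimg c \<and> \<rho> (cis \<theta>) (cinv c z) \<in> cdom d}"
    using openin_trans[OF 1] by blast
qed

lemma subspace_UNIV_Times: "subspace L \<Longrightarrow> subspace (UNIV \<times> L)"
  by (intro subspace_Times) auto

text \<open>The chart \<open>push (cis \<theta>) c\<close> varies with the angle, and smoothness of
  \<open>\<omega>\<close> within each chart says nothing about that. Near a given angle and point a
  single chart \<open>d\<close> around the moved point takes over: there the function is
  \<open>\<omega> d\<close> at the moved point on the moved vectors, which depend smoothly on both
  variables.\<close>

lemma smooth_on_push:
  assumes \<omega>: "\<omega> \<in> forms A" and c: "c \<in> A" and vs: "set vs \<subseteq> ctan c"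
  shows "smooth_on (UNIV \<times> ctan c) (UNIV \<times> cimg c) (\<lambda>(\<theta>::real, z). \<omega> (push (cis \<theta>) c) z vs)"
proof (rule smooth_on_local)
  fix p :: "real \<times> (complex ^ 'n)" assume "p \<in> UNIV \<times> cimg c"
  then obtain \<theta>0 z0 where p: "p = (\<theta>0, z0)" "z0 \<in> cimg c" by auto
  have "\<rho> (cis \<theta>0) (cinv c z0) \<in> X"
    using cinv_cdom[OF c p(2)] cdom_subset[OF c] action_closed[OF cis_sphere] by blast
  then obtain d where d: "d \<in> A" "\<rho> (cis \<theta>0) (cinv c z0) \<in> cdom d" using chart_at by blast
  define U where "U = {(\<theta>::real, z). z \<in> cimg c \<and> \<rho> (cis \<theta>) (cinv c z) \<in> cdom d}"
  define \<Phi> where "\<Phi> = (\<lambda>(\<theta>::real, z). coord d (\<rho> (cis \<theta>) (cinv c z)))"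
  have U_open: "openin (top_of_set (UNIV \<times> cimg c)) U" "openin (top_of_set (UNIV \<times> ctan c)) U"
    unfolding U_def by (rule openin_action_domain[OF c d(1)])+
  have \<Phi>_smooth: "smooth_on (UNIV \<times> ctan c) U \<Phi>" unfolding U_def \<Phi>_def by (rule action_smooth[OF c d(1)])
  have \<Phi>_img: "\<Phi> ` U \<subseteq> cimg d" by (auto simp: \<Phi>_def U_def coord_cimg)
  note L' = subspace_UNIV_Times[OF subspace_coord_space, of "cdirs c"]
  \<comment> \<open>The images of the vectors \<open>vs\<close> under the group element, as
    functions of angle and point: \<open>\<Phi>\<close> is differentiated in the point variable
    only.\<close>
  define \<Psi> where "\<Psi> = map (\<lambda>v u. dir_deriv \<Phi> u (0::real, v)) vs"
  have \<Psi>: "smooth_on (UNIV \<times> ctan c) U \<psi>" "\<psi> ` U \<subseteq> ctan d" if \<psi>: "\<psi> \<in> set \<Psi>" for \<psi>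
  proof -
    obtain v where v: "v \<in> ctan c" "\<psi> = (\<lambda>u. dir_deriv \<Phi> u (0, v))"
      using \<psi> vs by (auto simp: \<Psi>_def)
    then have v0: "(0::real, v) \<in> UNIV \<times> ctan c" by simp
    show "smooth_on (UNIV \<times> ctan c) U \<psi>" unfolding v(2) by (rule smooth_on_dir_deriv[OF \<Phi>_smooth v0])
    have "dir_deriv \<Phi> u (0, v) \<in> ctan d" if "u \<in> U" for u
      by (rule dir_deriv_in_subspace[OF L' U_open(2) that v0 subspace_coord_space
            order_trans[OF \<Phi>_img cimg_subset[OF d(1)]] smooth_on_differentiable[OF \<Phi>_smooth that v0]])
    then show "\<psi> ` U \<subseteq> ctan d" unfolding v(2) by blast
  qed
  have smooth: "smooth_on (UNIV \<times> ctan c) U (\<lambda>u. \<omega> d (\<Phi> u) ([] @ map (\<lambda>\<psi>. \<psi> u) \<Psi>))"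
    by (rule smooth_on_alternating[OF subspace_coord_space open_cimg[OF d(1)] L' U_open(2)
          forms_alternating[OF \<omega> d(1)] forms_smooth[OF \<omega> d(1)] \<Phi>_img \<Phi>_smooth _ \<Psi>]) auto
  have "smooth_on (UNIV \<times> ctan c) U (\<lambda>(\<theta>, z). \<omega> (push (cis \<theta>) c) z vs)"
  proof (rule smooth_on_cong[OF L' U_open(2) _ smooth])
    fix u assume u: "u \<in> U"
    obtain \<theta> z where u_eq: "u = (\<theta>, z)" by (cases u)
    have z: "z \<in> cimg c" "\<rho> (cis \<theta>) (cinv c z) \<in> cdom d" using u by (auto simp: U_def u_eq)
    let ?e = "push (cis \<theta>) c"
    have x: "\<rho> (cis \<theta>) (cinv c z) \<in> cdom ?e" "coord ?e (\<rho> (cis \<theta>) (cinv c z)) = z"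
      using cinv_cdom[OF c z(1)] coord_push[OF c cis_sphere cinv_cdom[OF c z(1)]] coord_cinv[OF c z(1)]
      by (simp_all add: cdom_push)
    have "dir_deriv (coord d \<circ> cinv ?e) z v = dir_deriv \<Phi> u (0, v)" if v: "v \<in> ctan c" for v
    proof -
      have "dir_deriv \<Phi> u (0, v) = dir_deriv (\<lambda>y. \<Phi> (\<theta>, y)) z v" by (simp add: dir_deriv_def u_eq)
      also have "\<dots> = dir_deriv (coord d \<circ> cinv ?e) z v"
        by (rule dir_deriv_cong[OF subspace_coord_space open_cimg[OF c] z(1) v])
          (simp add: \<Phi>_def cinv_push[OF c cis_sphere])
      finally show ?thesis by simp
    qed
    then have "map (dir_deriv (coord d \<circ> cinv ?e) z) vs = map (\<lambda>\<psi>. \<psi> u) \<Psi>"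
      using vs by (auto simp: \<Psi>_def)
    then show "\<omega> d (\<Phi> u) ([] @ map (\<lambda>\<psi>. \<psi> u) \<Psi>) = (case u of (\<theta>, z) \<Rightarrow> \<omega> (push (cis \<theta>) c) z vs)"
      using forms_transition[OF \<omega> push_atlas[OF c cis_sphere] d(1) x(1) z(2), of vs] vs x(2)
      by (simp add: u_eq \<Phi>_def)
  qed
  then show "\<exists>U. p \<in> U \<and> openin (top_of_set (UNIV \<times> cimg c)) U \<and>
      smooth_on (UNIV \<times> ctan c) U (\<lambda>(\<theta>, z). \<omega> (push (cis \<theta>) c) z vs)"
    using U_open(1) d(2) p by (intro exI[of _ U]) (auto simp: U_def)
qed

lemma push_continuous:
  assumes \<omega>: "\<omega> \<in> forms A" and c: "c \<in> A"
  shows "continuous_on S (\<lambda>\<theta>. \<omega> (push (cis \<theta>) c) z vs)"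
proof (cases "meaningful A c z vs")
  case False
  then have "\<omega> (push (cis \<theta>) c) z vs = 0" for \<theta>
    by (intro forms_zero[OF \<omega>]) (simp add: meaningful_push[OF c cis_sphere])
  then show ?thesis by simp
next
  case True
  then have "set vs \<subseteq> ctan c" "z \<in> cimg c" by (auto simp: meaningful_def)
  then have "continuous_on (UNIV \<times> cimg c) (\<lambda>(\<theta>, z). \<omega> (push (cis \<theta>) c) z vs)"
    using smooth_on_push[OF \<omega> c] unfolding smooth_on_def by (metis Ck_on_continuous)
  then have "continuous_on S (\<lambda>\<theta>. (\<lambda>(\<theta>, z). \<omega> (push (cis \<theta>) c) z vs) (\<theta>, z))"
    by (rule continuous_on_compose2) (use \<open>z \<in> cimg c\<close> in \<open>auto intro!: continuous_intros\<close>)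
  then show ?thesis by simp
qed

lemma push_integrable:
  "\<omega> \<in> forms A \<Longrightarrow> c \<in> A \<Longrightarrow> (\<lambda>\<theta>. \<omega> (push (cis \<theta>) c) z vs) integrable_on {a..b}"
  by (intro integrable_continuous_interval push_continuous)

lemma push_alternating:
  assumes \<omega>: "\<omega> \<in> forms A" and c: "c \<in> A" and "z \<in> cimg c" "g \<in> sphere 0 1"
  shows "multilinear_alternating (ctan c) (\<omega> (push g c) z)"
  using forms_alternating[OF \<omega> push_atlas[OF c assms(4)], of z] assms(3) cimg_push[OF c assms(4)] by simp

text \<open>The group element cancels: between two charts transported by the same \<open>g\<close>
  the coordinate change is that of the original charts.\<close>

lemma push_transition:
  assumes \<omega>: "\<omega> \<in> forms A" and c: "c \<in> A" and d: "d \<in> A" and g: "g \<in> sphere 0 1"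
    and x: "x \<in> cdom c" "x \<in> cdom d" and vs: "set vs \<subseteq> ctan c"
  shows "\<omega> (push g c) (coord c x) vs =
    \<omega> (push g d) (coord d x) (map (dir_deriv (coord d \<circ> cinv c) (coord c x)) vs)"
proof -
  have xov: "coord c x \<in> coord c ` (cdom c \<inter> cdom d)" using x by blast
  have "dir_deriv (coord (push g d) \<circ> cinv (push g c)) (coord c x) v = dir_deriv (coord d \<circ> cinv c) (coord c x) v"
    if "v \<in> ctan c" for v
    by (rule dir_deriv_cong[OF subspace_coord_space openin_overlap[OF c d] xov that])
      (auto simp: cinv_push[OF c g] coord_cimg cinv_coord[OF c] coord_push[OF d g])
  then have "map (dir_deriv (coord (push g d) \<circ> cinv (push g c)) (coord c x)) vs =
      map (dir_deriv (coord d \<circ> cinv c) (coord c x)) vs"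
    using vs by auto
  moreover have "\<rho> g x \<in> cdom (push g c)" "\<rho> g x \<in> cdom (push g d)" using x by (auto simp: cdom_push)
  from forms_transition[OF \<omega> push_atlas[OF c g] push_atlas[OF d g] this, of vs]
  have "\<omega> (push g c) (coord c x) vs =
    \<omega> (push g d) (coord d x) (map (dir_deriv (coord (push g d) \<circ> cinv (push g c)) (coord c x)) vs)"
    using vs by (simp add: coord_push[OF c g x(1)] coord_push[OF d g x(2)])
  ultimately show ?thesis by metis
qed

section \<open>The average of a form\<close>

lemma avg_forms:
  assumes \<omega>: "\<omega> \<in> forms A"
  shows "avg A \<rho> \<omega> \<in> forms A"
  unfolding forms_def mem_Collect_eq
proof (intro conjI ballI allI impI)
  fix c z vs assume "\<not> meaningful A c z vs"
  then have "c \<in> A \<Longrightarrow> \<omega> (push (cis \<theta>) c) z vs = 0" for \<theta>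
    using meaningful_push[OF _ cis_sphere] by (intro forms_zero[OF \<omega>]) simp
  then show "avg A \<rho> \<omega> c z vs = 0" by (simp add: avg_def)
next
  fix c z assume c: "c \<in> A" and z: "z \<in> cimg c"
  note alt = push_alternating[OF \<omega> c z cis_sphere]
  show "multilinear_alternating (ctan c) (avg A \<rho> \<omega> c z)"
    unfolding multilinear_alternating_def
  proof (intro conjI allI impI)
    fix us v w ws and a b :: real
    assume *: "set us \<subseteq> ctan c \<and> v \<in> ctan c \<and> w \<in> ctan c \<and> set ws \<subseteq> ctan c"
    have "integral {0..2 * pi} (\<lambda>\<theta>. \<omega> (push (cis \<theta>) c) z (us @ (a *\<^sub>R v + b *\<^sub>R w) # ws)) =
        integral {0..2 * pi} (\<lambda>\<theta>. complex_of_real a * \<omega> (push (cis \<theta>) c) z (us @ v # ws) +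
          complex_of_real b * \<omega> (push (cis \<theta>) c) z (us @ w # ws))"
      using multilinear_alternatingD(1)[OF alt] * by (intro integral_cong) auto
    also have "\<dots> = complex_of_real a * integral {0..2 * pi} (\<lambda>\<theta>. \<omega> (push (cis \<theta>) c) z (us @ v # ws)) +
          complex_of_real b * integral {0..2 * pi} (\<lambda>\<theta>. \<omega> (push (cis \<theta>) c) z (us @ w # ws))"
      using push_integrable[OF \<omega> c] by (simp add: integral_add integrable_on_mult_right)
    finally show "avg A \<rho> \<omega> c z (us @ (a *\<^sub>R v + b *\<^sub>R w) # ws) =
        complex_of_real a * avg A \<rho> \<omega> c z (us @ v # ws) + complex_of_real b * avg A \<rho> \<omega> c z (us @ w # ws)"
      using c by (simp add: avg_def add_divide_distrib)
  next
    fix vs assume "set vs \<subseteq> ctan c \<and> \<not> distinct vs"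
    then have "\<omega> (push (cis \<theta>) c) z vs = 0" for \<theta> using multilinear_alternatingD(2)[OF alt] by blast
    then show "avg A \<rho> \<omega> c z vs = 0" by (simp add: avg_def)
  qed
next
  fix c and vs :: "(complex ^ 'n) list" assume c: "c \<in> A" and vs: "set vs \<subseteq> ctan c"
  have "smooth_on (ctan c) (cimg c) (\<lambda>z. integral {0..2 * pi} (\<lambda>\<theta>. (\<lambda>(\<theta>, z). \<omega> (push (cis \<theta>) c) z vs) (\<theta>, z)))"
    by (rule smooth_on_integral[OF subspace_coord_space open_cimg[OF c] smooth_on_push[OF \<omega> c vs]])
  from smooth_on_bounded_linear[OF subspace_coord_space open_cimg[OF c] bounded_linear_divide this]
  show "smooth_on (ctan c) (cimg c) (\<lambda>z. avg A \<rho> \<omega> c z vs)"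
    using c by (simp add: avg_def)
next
  fix c d x and vs :: "(complex ^ 'n) list"
  assume c: "c \<in> A" and d: "d \<in> A" and x: "x \<in> cdom c \<inter> cdom d" and vs: "set vs \<subseteq> ctan c"
  show "avg A \<rho> \<omega> c (coord c x) vs = avg A \<rho> \<omega> d (coord d x) (map (dir_deriv (coord d \<circ> cinv c) (coord c x)) vs)"
    using push_transition[OF \<omega> c d cis_sphere _ _ vs] x c d by (simp add: avg_def)
qed

text \<open>The extended value of the average is, up to the factor \<open>k\<close>, an integral of
  extended values in transported charts. If it is nonzero, so is the integrand for some angle, and
  the type of \<open>\<omega>\<close> in that chart decides.\<close>

lemma avg_forms_pq:
  assumes \<omega>: "\<omega> \<in> forms_pq A p q"
  shows "avg A \<rho> \<omega> \<in> forms_pq A p q"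
proof -
  note \<omega>f = forms_pq_forms[OF \<omega>]
  have "int (length (filter fst xs)) = p \<and> int (length (filter (\<lambda>x. \<not> fst x) xs)) = q"
    if c: "c \<in> A" and z: "z \<in> cimg c" and xs: "snd ` set xs \<subseteq> ctan c"
      and nz: "ext_eval (avg A \<rho> \<omega> c z) xs \<noteq> 0" for c z xs
  proof -
    define I where "I = (\<lambda>vs. integral {0..2 * pi} (\<lambda>\<theta>. \<omega> (push (cis \<theta>) c) z vs))"
    define k where "k = inverse (complex_of_real (2 * pi))"
    have "avg A \<rho> \<omega> c z = (\<lambda>vs. k * I vs + 0 * I vs)"
      by (rule ext) (simp only: avg_def I_def k_def c if_True divide_inverse mult_zero_left add_0_right mult.commute)
    then have "ext_eval (avg A \<rho> \<omega> c z) xs = k * ext_eval I xs"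
      using ext_eval_linear_comb[of k I 0 I xs] by simp
    then have "ext_eval I xs \<noteq> 0" using nz by auto
    moreover have "ext_eval I xs = integral {0..2 * pi} (\<lambda>\<theta>. ext_eval (\<omega> (push (cis \<theta>) c) z) xs)"
      unfolding I_def
      using ext_eval_integral[where \<alpha> = "\<lambda>\<theta>. \<omega> (push (cis \<theta>) c) z", OF push_continuous[OF \<omega>f c]]
      by blast
    ultimately have "\<not> (\<forall>\<theta>. ext_eval (\<omega> (push (cis \<theta>) c) z) xs = 0)" by auto
    then obtain \<theta> where \<theta>: "ext_eval (\<omega> (push (cis \<theta>) c) z) xs \<noteq> 0" by blast
    have "push (cis \<theta>) c \<in> A" "z \<in> cimg (push (cis \<theta>) c)" "snd ` set xs \<subseteq> ctan (push (cis \<theta>) c)"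
      using push_atlas[OF c cis_sphere] cimg_push[OF c cis_sphere] z xs by simp_all
    then show ?thesis using \<omega> \<theta> unfolding forms_pq_def by blast
  qed
  then show ?thesis using avg_forms[OF \<omega>f] unfolding forms_pq_def by blast
qed

text \<open>Pullback along \<open>cis \<phi>\<close> shifts the angle in the integrand by
  \<open>\<phi>\<close>; periodicity absorbs the shift.\<close>

lemma avg_invariant:
  assumes \<omega>: "\<omega> \<in> forms A" and g: "g \<in> sphere 0 1"
  shows "pullback A A (\<rho> g) (avg A \<rho> \<omega>) = avg A \<rho> \<omega>"
proof (intro ext)
  fix c z vs
  show "pullback A A (\<rho> g) (avg A \<rho> \<omega>) c z vs = avg A \<rho> \<omega> c z vs"
  proof (cases "c \<in> A")
    case False
    then show ?thesis by (simp add: pullback_def avg_def meaningful_def)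
  next
    case c: True
    define H where "H \<theta> = \<omega> (push (cis \<theta>) c) z vs" for \<theta>
    \<comment> \<open>An angle of \<open>g\<close> between 0 and \<open>2 * pi\<close>, the range
      that \<open>integral_periodic\<close> asks for.\<close>
    define \<phi> where "\<phi> = Arg2pi g"
    have \<phi>: "0 \<le> \<phi>" "\<phi> \<le> 2 * pi" "g = cis \<phi>"
      using Arg2pi[of g] g by (auto simp: \<phi>_def cis_conv_exp is_Arg_def)
    have "pullback A A (\<rho> g) (avg A \<rho> \<omega>) c z vs = avg A \<rho> \<omega> (push g c) z vs"
      by (rule pullback_push[OF avg_forms[OF \<omega>] c g])
    also have "\<dots> = integral {0..2 * pi} (\<lambda>\<theta>. H (\<theta> + \<phi>)) / complex_of_real (2 * pi)"
      using push_atlas[OF c g] push_push[OF c g cis_sphere]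
      by (simp add: avg_def H_def \<phi>(3) cis_mult)
    also have "integral {0..2 * pi} (\<lambda>\<theta>. H (\<theta> + \<phi>)) = integral {0..2 * pi} H"
    proof (rule integral_periodic[OF _ _ \<phi>(1,2)])
      show "continuous_on UNIV H" unfolding H_def by (rule push_continuous[OF \<omega> c])
      show "H (t + 2 * pi) = H t" for t
        unfolding H_def by (simp add: cis_mult[symmetric])
    qed
    also have "\<dots> / complex_of_real (2 * pi) = avg A \<rho> \<omega> c z vs"
      using c by (simp add: avg_def H_def[abs_def])
    finally show ?thesis .
  qed
qed

lemma avg_invariant_pq: "\<omega> \<in> forms_pq A p q \<Longrightarrow> avg A \<rho> \<omega> \<in> invariant_pq A \<rho> p q"
  unfolding invariant_pq_def by (simp add: avg_forms_pq avg_invariant forms_pq_forms)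

lemma avg_zero: "avg A \<rho> 0 = 0"
  by (simp add: avg_def fun_eq_iff)

text \<open>The formula for \<open>dbar\<close> is the same in \<open>c\<close> and in
  \<open>push (cis \<theta>) c\<close>, which have the same image and directions; what remains is to
  differentiate under the integral.\<close>

lemma dbar_avg:
  assumes \<omega>: "\<omega> \<in> forms A"
  shows "dbar A (avg A \<rho> \<omega>) = avg A \<rho> (dbar A \<omega>)"
proof (intro ext)
  fix c z vs
  show "dbar A (avg A \<rho> \<omega>) c z vs = avg A \<rho> (dbar A \<omega>) c z vs"
  proof (cases "meaningful A c z vs")
    case False
    then have "c \<in> A \<Longrightarrow> dbar A \<omega> (push (cis \<theta>) c) z vs = 0" for \<theta>
      using meaningful_push[OF _ cis_sphere] by (simp add: dbar_def)
    then show ?thesis using False by (simp add: dbar_def avg_def)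
  next
    case True
    then have c: "c \<in> A" and z: "z \<in> cimg c" and vs: "set vs \<subseteq> ctan c" by (auto simp: meaningful_def)
    define D where "D us v \<theta> = dir_deriv (\<lambda>y. \<omega> (push (cis \<theta>) c) y us) z v" for us v \<theta>
    have D_int: "D us v integrable_on {0..2 * pi}"
      and D_avg: "dir_deriv (\<lambda>y. avg A \<rho> \<omega> c y us) z v = integral {0..2 * pi} (D us v) / complex_of_real (2 * pi)"
      if us: "set us \<subseteq> ctan c" and v: "v \<in> ctan c" for us v
    proof -
      let ?G = "\<lambda>(\<theta>, z). \<omega> (push (cis \<theta>) c) z us"
      have smooth: "smooth_on (UNIV \<times> ctan c) (UNIV \<times> cimg c) ?G" by (rule smooth_on_push[OF \<omega> c us])
      have "((\<lambda>t. integral {0..2 * pi} (\<lambda>\<theta>. ?G (\<theta>, z + t *\<^sub>R v))) has_vector_derivative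
          integral {0..2 * pi} (\<lambda>\<theta>. dir_deriv (\<lambda>y. ?G (\<theta>, y)) z v)) (at 0)"
        using smooth unfolding smooth_on_def
        by (intro integral_dir_deriv[OF subspace_coord_space open_cimg[OF c] _ z v]) blast
      from bounded_linear.has_vector_derivative[OF bounded_linear_divide this]
      show "dir_deriv (\<lambda>y. avg A \<rho> \<omega> c y us) z v = integral {0..2 * pi} (D us v) / complex_of_real (2 * pi)"
        using c by (intro dir_deriv_eqI) (simp add: avg_def D_def[abs_def])
      have "smooth_on (UNIV \<times> ctan c) (UNIV \<times> cimg c) (\<lambda>p. dir_deriv ?G p (0, v))"
        using v by (intro smooth_on_dir_deriv[OF smooth]) simp
      then have "continuous_on (UNIV \<times> cimg c) (\<lambda>p. dir_deriv ?G p (0, v))"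
        unfolding smooth_on_def using Ck_on_continuous by blast
      then have "continuous_on {0..2 * pi} (\<lambda>\<theta>. dir_deriv ?G (\<theta>, z) (0, v))"
        by (rule continuous_on_compose2) (use z in \<open>auto intro!: continuous_intros\<close>)
      then show "D us v integrable_on {0..2 * pi}"
        by (intro integrable_continuous_interval) (simp add: D_def[abs_def] dir_deriv_def)
    qed
    have dbar_D: "dbar_dir (\<lambda>y. \<omega> (push (cis \<theta>) c) y us) z v = (D us v \<theta> + \<i> * D us (\<i> *s v) \<theta>) / 2" for us v \<theta>
      by (simp add: dbar_dir_def D_def)
    have summand: "(\<lambda>\<theta>. (-1) ^ j * ((D us v \<theta> + \<i> * D us (\<i> *s v) \<theta>) / 2)) integrable_on {0..2 * pi}"
      "(-1) ^ j * dbar_dir (\<lambda>y. avg A \<rho> \<omega> c y us) z v =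
        integral {0..2 * pi} (\<lambda>\<theta>. (-1) ^ j * ((D us v \<theta> + \<i> * D us (\<i> *s v) \<theta>) / 2)) / complex_of_real (2 * pi)"
      if us: "set us \<subseteq> ctan c" and v: "v \<in> ctan c" for us v and j :: nat
    proof -
      note iv = coord_space_scale[OF v, of \<i>]
      have 1: "(\<lambda>\<theta>. D us v \<theta> + \<i> * D us (\<i> *s v) \<theta>) integrable_on {0..2 * pi}"
        using D_int[OF us v] D_int[OF us iv] by (intro integrable_add integrable_on_mult_right)
      then show "(\<lambda>\<theta>. (-1) ^ j * ((D us v \<theta> + \<i> * D us (\<i> *s v) \<theta>) / 2)) integrable_on {0..2 * pi}"
        by (intro integrable_on_mult_right integrable_on_divide)
      have half: "integral {0..2 * pi} (\<lambda>\<theta>. (-1) ^ j * (q \<theta> / 2)) = (-1) ^ j * (integral {0..2 * pi} q / 2)"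
        for q :: "real \<Rightarrow> complex" by simp
      have sum: "integral {0..2 * pi} (\<lambda>\<theta>. D us v \<theta> + \<i> * D us (\<i> *s v) \<theta>) =
          integral {0..2 * pi} (D us v) + \<i> * integral {0..2 * pi} (D us (\<i> *s v))"
        using D_int[OF us v] D_int[OF us iv] by (simp add: integral_add integrable_on_mult_right)
      show "(-1) ^ j * dbar_dir (\<lambda>y. avg A \<rho> \<omega> c y us) z v =
        integral {0..2 * pi} (\<lambda>\<theta>. (-1) ^ j * ((D us v \<theta> + \<i> * D us (\<i> *s v) \<theta>) / 2)) / complex_of_real (2 * pi)"
        unfolding half sum dbar_dir_def D_avg[OF us v] D_avg[OF us iv] by (simp add: field_simps)
    qed
    have us: "set (drop_nth j vs) \<subseteq> ctan c" for j by (rule order_trans[OF set_drop_nth vs])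
    have v: "vs ! j \<in> ctan c" if "j \<in> {..<length vs}" for j using that vs nth_mem by blast
    let ?f = "\<lambda>j \<theta>. (-1) ^ j * ((D (drop_nth j vs) (vs ! j) \<theta> + \<i> * D (drop_nth j vs) (\<i> *s (vs ! j)) \<theta>) / 2)"
    have "dbar A (avg A \<rho> \<omega>) c z vs =
        (\<Sum>j<length vs. (-1) ^ j * dbar_dir (\<lambda>y. avg A \<rho> \<omega> c y (drop_nth j vs)) z (vs ! j))"
      using True by (simp add: dbar_def)
    also have "\<dots> = (\<Sum>j<length vs. integral {0..2 * pi} (?f j) / complex_of_real (2 * pi))"
      by (intro sum.cong refl summand(2) us v)
    also have "\<dots> = (\<Sum>j<length vs. integral {0..2 * pi} (?f j)) / complex_of_real (2 * pi)"
      by (simp add: sum_divide_distrib)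
    also have "(\<Sum>j<length vs. integral {0..2 * pi} (?f j)) = integral {0..2 * pi} (\<lambda>\<theta>. \<Sum>j<length vs. ?f j \<theta>)"
      by (intro integral_sum[symmetric] summand(1) us v) auto
    also have "(\<lambda>\<theta>. \<Sum>j<length vs. ?f j \<theta>) = (\<lambda>\<theta>. dbar A \<omega> (push (cis \<theta>) c) z vs)"
      using True meaningful_push[OF c cis_sphere] by (simp add: dbar_def dbar_D fun_eq_iff)
    also have "integral {0..2 * pi} (\<lambda>\<theta>. dbar A \<omega> (push (cis \<theta>) c) z vs) / complex_of_real (2 * pi) =
        avg A \<rho> (dbar A \<omega>) c z vs"
      using c by (simp add: avg_def)
    finally show ?thesis .
  qed
qed

section \<open>The generating field and its contraction\<close>

lemma near_identity:
  assumes c: "c \<in> A" and y: "y \<in> cdom c"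
  shows "\<forall>\<^sub>F \<theta> in nhds (0::real). \<rho> (cis \<theta>) y \<in> cdom c"
proof -
  obtain T where T: "open T" "cdom c = X \<inter> T" using openin_cdom[OF c] openin_open by metis
  have yX: "y \<in> X" using cdom_subset[OF c] y by blast
  have "continuous_on UNIV (\<lambda>\<theta>. (\<lambda>(g, x). \<rho> g x) (cis \<theta>, y))"
    by (rule continuous_on_compose2[OF action_continuous]) (use yX in \<open>auto intro!: continuous_intros\<close>)
  then have "continuous_on UNIV (\<lambda>\<theta>. \<rho> (cis \<theta>) y)" by simp
  then have "isCont (\<lambda>\<theta>. \<rho> (cis \<theta>) y) 0" by (simp add: continuous_on_eq_continuous_at)
  then have "((\<lambda>\<theta>. \<rho> (cis \<theta>) y) \<longlongrightarrow> \<rho> (cis 0) y) (nhds 0)"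
    unfolding continuous_at using tendsto_at_iff_tendsto_nhds[of "\<lambda>\<theta>. \<rho> (cis \<theta>) y" 0] by blast
  moreover have "\<rho> (cis 0) y \<in> T" using action_one[OF yX] y T(2) by simp
  ultimately have "\<forall>\<^sub>F \<theta> in nhds (0::real). \<rho> (cis \<theta>) y \<in> T" using T(1) topological_tendstoD by blast
  then show ?thesis
    by (rule eventually_mono) (use T(2) action_closed[OF cis_sphere yX] in blast)
qed

lemma near_identity_scaled:
  assumes "c \<in> A" "y \<in> cdom c"
  shows "\<forall>\<^sub>F t in nhds (0::real). \<rho> (cis (\<xi> * (t * x))) y \<in> cdom c"
proof -
  have "filterlim (\<lambda>t. \<xi> * (t * x)) (nhds (\<xi> * (0 * x))) (nhds (0::real))"
    by (intro tendsto_intros filterlim_ident)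
  then have "filterlim (\<lambda>t. \<xi> * (t * x)) (nhds 0) (nhds (0::real))" by simp
  from eventually_compose_filterlim[OF near_identity[OF assms] this] show ?thesis .
qed

text \<open>The circle is commutative, so \<open>\<rho> g\<close> commutes with the flow, and the
  field has the same coordinates in the transported chart as in the original one.\<close>

lemma gen_field_push:
  assumes c: "c \<in> A" and z: "z \<in> cimg c" and g: "g \<in> sphere 0 1"
  shows "gen_field \<rho> \<xi> x (push g c) z = gen_field \<rho> \<xi> x c z"
  unfolding gen_field_def
proof (rule vector_derivative_cong_eq)
  have y: "cinv c z \<in> cdom c" by (rule cinv_cdom[OF c z])
  then have yX: "cinv c z \<in> X" using cdom_subset[OF c] by blast
  show "\<forall>\<^sub>F t in nhds 0. t \<in> UNIV \<longrightarrow> coord (push g c) (\<rho> (cis (\<xi> * (t * x))) (cinv (push g c) z)) =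
      coord c (\<rho> (cis (\<xi> * (t * x))) (cinv c z))"
    using near_identity_scaled[OF c y, of \<xi> x]
  proof eventually_elim
    case (elim t)
    have "\<rho> (cis (\<xi> * (t * x))) (\<rho> g (cinv c z)) = \<rho> g (\<rho> (cis (\<xi> * (t * x))) (cinv c z))"
      using action_mult[OF cis_sphere g yX] action_mult[OF g cis_sphere yX] by (metis mult.commute)
    then show ?case by (simp add: cinv_push[OF c g z] coord_push[OF c g elim])
  qed
qed auto

text \<open>The curve for \<open>x\<close> is the orbit map run at speed \<open>\<xi> * x\<close>,
  so the chain rule makes the field linear in \<open>x\<close>. Differentiability comes from
  smoothness of the action at angle 0 in the direction \<open>(1, 0)\<close>.\<close>

lemma gen_field_scale:
  assumes c: "c \<in> A" and z: "z \<in> cimg c"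
  shows "gen_field \<rho> \<xi> x c z = x *\<^sub>R gen_field \<rho> \<xi> 1 c z" and "gen_field \<rho> \<xi> x c z \<in> ctan c"
proof -
  have y: "cinv c z \<in> cdom c" by (rule cinv_cdom[OF c z])
  then have yX: "cinv c z \<in> X" using cdom_subset[OF c] by blast
  define \<gamma> where "\<gamma> \<theta> = coord c (\<rho> (cis \<theta>) (cinv c z))" for \<theta>
  have "(0::real, z) \<in> {(\<theta>::real, z). z \<in> cimg c \<and> \<rho> (cis \<theta>) (cinv c z) \<in> cdom c}"
    using z y action_one[OF yX] by simp
  moreover have "(1::real, 0) \<in> UNIV \<times> ctan c" using subspace_0[OF subspace_coord_space] by simp
  ultimately have "\<gamma> differentiable (at 0)"
    using smooth_on_differentiable[OF action_smooth[OF c c]] by (fastforce simp: \<gamma>_def[abs_def])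
  then have \<gamma>: "(\<gamma> has_vector_derivative vector_derivative \<gamma> (at 0)) (at 0)"
    by (simp add: vector_derivative_works)
  have der: "((\<lambda>t. \<gamma> (\<xi> * (t * x))) has_vector_derivative (\<xi> * x) *\<^sub>R vector_derivative \<gamma> (at 0)) (at 0)" for x
  proof -
    have "((\<lambda>t. \<xi> * (t * x)) has_vector_derivative \<xi> * x) (at 0)"
      by (auto intro!: derivative_eq_intros simp: has_real_derivative_iff_has_vector_derivative[symmetric])
    from vector_diff_chain_at[OF this] \<gamma> show ?thesis by (simp add: o_def)
  qed
  have gf: "gen_field \<rho> \<xi> x c z = (\<xi> * x) *\<^sub>R vector_derivative \<gamma> (at 0)" for x
    using vector_derivative_at[OF der] by (simp add: gen_field_def \<gamma>_def)
  show "gen_field \<rho> \<xi> x c z = x *\<^sub>R gen_field \<rho> \<xi> 1 c z" by (simp add: gf)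
  have "\<forall>\<^sub>F t in nhds 0. \<gamma> (\<xi> * (t * x)) \<in> ctan c"
    using near_identity_scaled[OF c y, of \<xi> x]
    by (rule eventually_mono) (simp add: \<gamma>_def coord_cimg subsetD[OF cimg_subset[OF c]])
  then show "gen_field \<rho> \<xi> x c z \<in> ctan c"
    unfolding gf by (rule has_vector_derivative_in_subspace[OF subspace_coord_space der])
qed

text \<open>Contraction in the equivariant differential thereby raises the power of \<open>x\<close>
  by one, which allows a comparison of coefficients.\<close>

lemma contr_scale_generator:
  assumes \<omega>: "\<omega> \<in> forms A"
  shows "contr A \<rho> \<xi> x \<omega> = form_scale (complex_of_real x) (contr A \<rho> \<xi> 1 \<omega>)"
proof (intro ext)
  fix c z vs
  show "contr A \<rho> \<xi> x \<omega> c z vs = form_scale (complex_of_real x) (contr A \<rho> \<xi> 1 \<omega>) c z vs"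
  proof (cases "meaningful A c z vs")
    case True
    then have c: "c \<in> A" and z: "z \<in> cimg c" and vs: "set vs \<subseteq> ctan c" by (auto simp: meaningful_def)
    define V where "V = gen_field \<rho> \<xi> 1 c z"
    have V: "V \<in> ctan c" unfolding V_def by (rule gen_field_scale(2)[OF c z])
    note iV = coord_space_scale[OF V, of \<i>]
    have "\<i> *s (x *\<^sub>R V) = x *\<^sub>R (\<i> *s V)" by (simp add: vec_eq_iff scaleR_conv_of_real)
    then show ?thesis
      using True gen_field_scale(1)[OF c z, of \<xi> x] alternating_scaleR[OF forms_alternating[OF \<omega> c z], of "[]"] vs V iV
      by (simp add: contr_def form_scale_def V_def[symmetric] algebra_simps)
  qed (simp add: contr_def form_scale_def)
qed

text \<open>By \<open>gen_field_push\<close> the inserted vector is the same for all angles, so the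
  contraction passes through the integral.\<close>

lemma contr_avg:
  assumes \<omega>: "\<omega> \<in> forms A"
  shows "contr A \<rho> \<xi> x (avg A \<rho> \<omega>) = avg A \<rho> (contr A \<rho> \<xi> x \<omega>)"
proof (intro ext)
  fix c z vs
  show "contr A \<rho> \<xi> x (avg A \<rho> \<omega>) c z vs = avg A \<rho> (contr A \<rho> \<xi> x \<omega>) c z vs"
  proof (cases "meaningful A c z vs")
    case False
    then have "c \<in> A \<Longrightarrow> contr A \<rho> \<xi> x \<omega> (push (cis \<theta>) c) z vs = 0" for \<theta>
      using meaningful_push[OF _ cis_sphere] by (simp add: contr_def)
    then show ?thesis using False by (simp add: contr_def avg_def)
  next
    case True
    then have c: "c \<in> A" and z: "z \<in> cimg c" by (auto simp: meaningful_def)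
    define V where "V = gen_field \<rho> \<xi> x c z"
    have contr_push: "contr A \<rho> \<xi> x \<omega> (push (cis \<theta>) c) z vs =
        (\<omega> (push (cis \<theta>) c) z (V # vs) - \<i> * \<omega> (push (cis \<theta>) c) z ((\<i> *s V) # vs)) / 2" for \<theta>
      using True meaningful_push[OF c cis_sphere] gen_field_push[OF c z cis_sphere]
      unfolding contr_def Let_def V_def by simp
    have "integral {0..2 * pi} (\<lambda>\<theta>. contr A \<rho> \<xi> x \<omega> (push (cis \<theta>) c) z vs) =
        integral {0..2 * pi} (\<lambda>\<theta>. (\<omega> (push (cis \<theta>) c) z (V # vs) - \<i> * \<omega> (push (cis \<theta>) c) z ((\<i> *s V) # vs)) / 2)"
      unfolding contr_push ..
    also have "\<dots> = (integral {0..2 * pi} (\<lambda>\<theta>. \<omega> (push (cis \<theta>) c) z (V # vs)) -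
        \<i> * integral {0..2 * pi} (\<lambda>\<theta>. \<omega> (push (cis \<theta>) c) z ((\<i> *s V) # vs))) / 2"
      using push_integrable[OF \<omega> c] by (simp add: integral_diff integrable_on_mult_right)
    finally show ?thesis
      using True c by (simp add: contr_def avg_def V_def[symmetric] diff_divide_distrib)
  qed
qed

text \<open>At a point of \<open>Z\<close> the differential of each group element is the identity on
  vectors tangent to \<open>Z\<close>, because the element fixes \<open>Z\<close> pointwise; on such
  vectors the integrand is constant in the angle.\<close>

lemma restr_avg:
  assumes \<omega>: "\<omega> \<in> forms A" and Z: "\<And>x g. x \<in> Z \<Longrightarrow> g \<in> sphere 0 1 \<Longrightarrow> \<rho> g x = x"
  shows "restr Z (avg A \<rho> \<omega>) = restr Z \<omega>"
proof (intro ext)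
  fix c' z vs
  show "restr Z (avg A \<rho> \<omega>) c' z vs = restr Z \<omega> c' z vs"
  proof (cases "meaningful (sub_atlas A Z) c' z vs")
    case False
    then show ?thesis by (simp add: restr_not_meaningful)
  next
    case True
    then have c': "c' \<in> sub_atlas A Z" "z \<in> cimg c'" "set vs \<subseteq> ctan c'" by (auto simp: meaningful_def)
    obtain c where c: "c \<in> A" "cdirs c' \<subseteq> cdirs c" "cdom c' = cdom c \<inter> Z" "coord c' = coord c"
      "cimg c' = cimg c \<inter> ctan c'" "\<forall>z\<in>cimg c'. cinv c' z = cinv c z"
      "openin (top_of_set (ctan c')) (cimg c')" "\<forall>z\<in>cimg c'. cinv c z \<in> Z"
      using sub_atlas_cases[OF c'(1)] by metis
    have sub: "ctan c' \<subseteq> ctan c" using coord_space_mono[OF c(2)] .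
    have "\<omega> (push g c) z vs = \<omega> c z vs" if g: "g \<in> sphere 0 1" for g
    proof -
      have fixed: "y \<in> cimg c" "\<rho> g (cinv c y) = cinv c y" if "y \<in> cimg c'" for y
        using that c(5,8) Z[OF _ g] by blast+
      \<comment> \<open>On the slice the coordinate change from \<open>push g c\<close> to
        \<open>c\<close> is the identity. Transverse to \<open>Z\<close> the group element may
        rotate vectors, so the restriction to \<open>ctan c'\<close> is essential.\<close>
      have "dir_deriv (coord c \<circ> cinv (push g c)) z v = v" if v: "v \<in> ctan c'" for v
      proof -
        have "dir_deriv (coord c \<circ> cinv (push g c)) z v = dir_deriv (\<lambda>y. y) z v"
          by (rule dir_deriv_cong[OF subspace_coord_space c(7) c'(2) v])
            (simp add: fixed cinv_push[OF c(1) g] coord_cinv[OF c(1)])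
        also have "\<dots> = v" by (rule dir_deriv_eqI) (auto intro!: derivative_eq_intros)
        finally show ?thesis .
      qed
      then have map_id: "map (dir_deriv (coord c \<circ> cinv (push g c)) z) vs = vs"
        using c'(3) by (intro map_idI) blast
      have x: "cinv c z \<in> cdom c" "cinv c z \<in> cdom (push g c)" "coord (push g c) (cinv c z) = z" "coord c (cinv c z) = z"
        using cinv_cdom[OF c(1) fixed(1)[OF c'(2)]] coord_push[OF c(1) g] coord_cinv[OF c(1) fixed(1)[OF c'(2)]]
          fixed(2)[OF c'(2)] by (auto simp: cdom_push image_iff) metis+
      have "\<omega> (push g c) z vs = \<omega> c z (map (dir_deriv (coord c \<circ> cinv (push g c)) z) vs)"
        using forms_transition[OF \<omega> push_atlas[OF c(1) g] c(1) x(2,1), of vs] x(3,4) order_trans[OF c'(3) sub] by simp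
      then show ?thesis unfolding map_id .
    qed
    then have "avg A \<rho> \<omega> c z vs = \<omega> c z vs" using c(1) by (simp add: avg_def scaleR_conv_of_real)
    then show ?thesis
      using restr_form[OF \<omega> c' c(1-7)] restr_form[OF avg_forms[OF \<omega>] c' c(1-7)] by simp
  qed
qed

end

section \<open>Equivariant classes and the filtration\<close>

lemma form_scale_zero: "form_scale a 0 = 0"
  by (simp add: form_scale_def fun_eq_iff)

context open_charts
begin

section \<open>Evaluation of equivariant forms at 1\<close>

text \<open>The coefficient of the \<open>j\<close>-th power has type
  \<open>(i - j, i + s - j)\<close>; renaming \<open>r = i - j\<close> yields components with
  \<open>r \<le> i\<close>, which places \<open>f 1\<close> in step \<open>i\<close> of the
  filtration.\<close>

lemma equiv_forms_eval:
  assumes "f \<in> equiv_forms A \<rho> (int i) (int i + s)"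
  shows "\<exists>a. (\<forall>r. a r \<in> forms_pq A (int r) (int r + s)) \<and> f 1 = (\<Sum>r\<le>i. a r)"
proof -
  obtain N w where w: "\<And>j. j \<le> N \<Longrightarrow> w j \<in> invariant_pq A \<rho> (int i - int j) (int i + s - int j)"
      and f: "f = (\<lambda>x. \<Sum>j\<le>(N::nat). form_scale (complex_of_real (x ^ j)) (w j))"
    using assms unfolding equiv_forms_def by blast
  have w_pq: "w j \<in> forms_pq A (int i - int j) (int i + s - int j)" if "j \<le> N" for j
    using w[OF that] by (simp add: invariant_pq_def)
  define w' where "w' j = (if j \<le> N then w j else 0)" for j
  define a where "a r = (if r \<le> i then w' (i - r) else 0)" for r
  show ?thesis
  proof (intro exI conjI allI)
    show "a r \<in> forms_pq A (int r) (int r + s)" for r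
      using w_pq[of "i - r"] by (auto simp: a_def w'_def zero_forms_pq of_nat_diff algebra_simps)
    have "f 1 = (\<Sum>j\<le>N. w j)" by (simp add: f form_scale_def)
    also have "\<dots> = (\<Sum>j\<in>{..N} \<inter> {..i}. w' j)"
    proof (intro sum.mono_neutral_cong_right ballI)
      \<comment> \<open>Beyond \<open>i\<close> the first index of the type is negative, so the
        coefficient is zero.\<close>
      fix j assume "j \<in> {..N} - {..N} \<inter> {..i}"
      then show "w j = 0" by (intro forms_pq_negative[OF w_pq]) auto
    qed (auto simp: w'_def)
    also have "\<dots> = (\<Sum>j\<le>i. w' j)" by (intro sum.mono_neutral_left) (auto simp: w'_def)
    also have "\<dots> = (\<Sum>r\<le>i. a r)"
      by (rule sum.reindex_bij_witness[where i = "\<lambda>j. i - j" and j = "\<lambda>j. i - j"]) (auto simp: a_def)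
    finally show "f 1 = (\<Sum>r\<le>i. a r)" .
  qed
qed

lemma equiv_forms_eval_koszul:
  assumes "f \<in> equiv_forms A \<rho> (int i) (int i + s)"
  shows "f 1 \<in> koszul A s"
proof -
  obtain a where "\<And>r. a r \<in> forms_pq A (int r) (int r + s)" "f 1 = (\<Sum>r\<le>i. a r)"
    using equiv_forms_eval[OF assms] by blast
  then show ?thesis by (simp add: koszul_finite_sum)
qed

lemma sum_forms_pq_filt:
  assumes "\<And>r. a r \<in> forms_pq A (int r) (int r + s)"
  shows "(\<Sum>r\<le>p. a r) \<in> filt A p"
proof -
  \<comment> \<open>\<open>filt\<close> ranges over natural \<open>q\<close>, so the components sit
    on the line \<open>q = r + s\<close>, and where \<open>r + s\<close> is negative they vanish.
    This bound contains all values of \<open>r + s\<close> for \<open>r \<le> p\<close>.\<close>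
  define N where "N = nat (int p + \<bar>s\<bar>)"
  define b where "b r q = (if int q = int r + s then a r else 0)" for r q :: nat
  have "(\<Sum>q\<le>N. b r q) = a r" if "r \<le> p" for r
  proof (cases "0 \<le> int r + s")
    case True
    have "(\<Sum>q\<le>N. b r q) = (\<Sum>q\<le>N. if q = nat (int r + s) then a r else 0)"
      using True by (intro sum.cong) (auto simp: b_def)
    moreover have "nat (int r + s) \<le> N" using that by (simp add: N_def)
    ultimately show ?thesis by simp
  next
    case False
    then have "a r = 0" by (intro forms_pq_negative[OF assms]) simp
    moreover have "b r q = 0" for q using False by (simp add: b_def)
    ultimately show ?thesis by simp
  qed
  then have "(\<Sum>r\<le>p. a r) = (\<Sum>r\<le>p. \<Sum>q\<le>N. b r q)" by (intro sum.cong) auto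
  moreover have "b r q \<in> forms_pq A (int r) (int q)" for r q
    using assms[of r] by (simp add: b_def zero_forms_pq)
  ultimately show ?thesis unfolding filt_def by blast
qed

lemma equiv_coboundaries_eval:
  assumes "f \<in> equiv_coboundaries A \<rho> \<xi> (int i) (int i + s)"
  obtains \<eta> where "\<eta> \<in> koszul A (s - 1)" "f 1 = koszul_D A \<rho> \<xi> \<eta>"
proof -
  obtain g where g: "g \<in> equiv_forms A \<rho> (int i) (int i + s - 1)" "f = equiv_dbar A \<rho> \<xi> g"
    using assms unfolding equiv_coboundaries_def by blast
  then have "g 1 \<in> koszul A (s - 1)"
    using equiv_forms_eval_koszul[of g \<rho> i "s - 1"] by (simp add: algebra_simps)
  moreover have "f 1 = koszul_D A \<rho> \<xi> (g 1)" by (simp add: g(2) equiv_dbar_def koszul_D_def)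
  ultimately show ?thesis by (rule that)
qed

lemma zero_equiv_forms: "(\<lambda>x. 0) \<in> equiv_forms A \<rho> p q"
proof -
  have "pullback A A (\<rho> g) 0 = 0" for g unfolding pullback_def Let_def by (simp add: fun_eq_iff)
  then have "0 \<in> invariant_pq A \<rho> (p - int 0) (q - int 0)"
    by (simp add: invariant_pq_def zero_forms_pq)
  then show ?thesis
    unfolding equiv_forms_def by (auto intro!: exI[of _ 0] exI[of _ "\<lambda>_. 0"] simp: form_scale_zero)
qed

text \<open>Provides the zero classes in the summands below \<open>p\<close>.\<close>

lemma zero_equiv_cocycles: "(\<lambda>x. 0) \<in> equiv_cocycles A \<rho> \<xi> p q"
  unfolding equiv_cocycles_def
  by (simp add: zero_equiv_forms) (simp add: equiv_dbar_def dbar_zero contr_zero fun_eq_iff)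

lemma zero_equiv_coboundaries: "(\<lambda>x. 0) \<in> equiv_coboundaries A \<rho> \<xi> p q"
  unfolding equiv_coboundaries_def
  by (rule image_eqI[OF _ zero_equiv_forms]) (simp add: equiv_dbar_def dbar_zero contr_zero)

end

section \<open>Maps induced on cosets\<close>

text \<open>\<open>induced\<close> takes a union over representatives. Well-definedness on classes
  means that all their images lie in one coset, and the union then collapses to it.\<close>

lemma coset_of_union:
  assumes zero: "0 \<in> B" and add: "\<And>a b. a \<in> B \<Longrightarrow> b \<in> B \<Longrightarrow> a + b \<in> (B :: 'v::ab_group_add set)"
    and sub: "\<And>w. w \<in> C \<Longrightarrow> w \<in> x +o B" and ne: "x \<in> C"
  shows "(\<Union>w\<in>C. w +o B) = x +o B"
proof
  show "(\<Union>w\<in>C. w +o B) \<subseteq> x +o B"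
    using sub add by (fastforce simp: elt_set_plus_def add.assoc)
  show "x +o B \<subseteq> (\<Union>w\<in>C. w +o B)" using ne by blast
qed

text \<open>Addition of sets is the Minkowski sum, and \<open>B + B = B\<close>. The index set
  \<open>{..p}\<close> is never empty, so the sum is a coset of \<open>B\<close> and not the neutral
  set \<open>{0}\<close>.\<close>

lemma coset_sum:
  assumes zero: "0 \<in> B" and add: "\<And>a b. a \<in> B \<Longrightarrow> b \<in> B \<Longrightarrow> a + b \<in> (B :: 'v::ab_group_add set)"
  shows "(\<Sum>i\<le>(p::nat). x i +o B) = (\<Sum>i\<le>p. x i) +o B"
proof -
  have BB: "B + B = B"
  proof
    show "B + B \<subseteq> B" using add by (auto simp: set_plus_def)
    show "B \<subseteq> B + B" using zero set_plus_intro[of 0 B _ B] by force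
  qed
  show ?thesis
    by (induction p) (simp_all only: atMost_0 sum.atMost_Suc set_plus_rearrange BB, simp)
qed

context circle_manifold
begin

section \<open>The equivariant cocycle of a filtered Koszul cocycle\<close>

lemma avg_dbar_components:
  assumes a: "\<And>r. a r \<in> forms_pq A (int r) (int r + s)" "\<And>r. p < r \<Longrightarrow> a r = 0"
    and D: "koszul_D A \<rho> \<xi> (\<Sum>r\<le>p. a r) = 0"
  shows "dbar A (avg A \<rho> (a r)) = contr A \<rho> \<xi> 1 (avg A \<rho> (a (Suc r)))"
    and "contr A \<rho> \<xi> 1 (avg A \<rho> (a 0)) = 0"
    and "contr A \<rho> \<xi> 1 (avg A \<rho> (a (Suc p))) = 0"
  using koszul_D_components[OF a D] forms_pq_forms[OF a(1)] a(2)[of "Suc p"]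
  by (simp_all only: dbar_avg contr_avg avg_zero contr_zero lessI)

text \<open>\<open>dbar\<close> of the averaged component \<open>r\<close> is the contraction of
  component \<open>Suc r\<close>, so after one shift of the index the two parts of the equivariant
  differential have equal coefficients. The exponent \<open>p - r\<close> at component
  \<open>r\<close> gives the total type \<open>(p, p + s)\<close>.\<close>

lemma equiv_cocycle_of_components:
  assumes a: "\<And>r. a r \<in> forms_pq A (int r) (int r + s)" "\<And>r. p < r \<Longrightarrow> a r = 0"
    and D: "koszul_D A \<rho> \<xi> (\<Sum>r\<le>p. a r) = 0"
  defines "f \<equiv> \<lambda>x. \<Sum>j\<le>p. form_scale (complex_of_real (x ^ j)) (avg A \<rho> (a (p - j)))"
  shows "f \<in> equiv_cocycles A \<rho> \<xi> (int p) (int p + s)"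
proof -
  have "avg A \<rho> (a (p - j)) \<in> invariant_pq A \<rho> (int p - int j) (int p + s - int j)" if "j \<le> p" for j
    using avg_invariant_pq[OF a(1)[of "p - j"]] that by (simp add: of_nat_diff algebra_simps)
  then have "f \<in> equiv_forms A \<rho> (int p) (int p + s)"
    unfolding equiv_forms_def f_def mem_Collect_eq
    by (intro exI[of _ p] exI[of _ "\<lambda>j. avg A \<rho> (a (p - j))"]) (rule conjI[OF _ refl], blast)
  moreover have "equiv_dbar A \<rho> \<xi> f x = 0" for x
  proof -
    define K where "K r = contr A \<rho> \<xi> 1 (avg A \<rho> (a r))" for r
    have af: "avg A \<rho> (a r) \<in> forms A" for r by (rule avg_forms[OF forms_pq_forms[OF a(1)]])
    have sf: "form_scale c (avg A \<rho> (a r)) \<in> forms A" for c r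
      by (rule forms_pq_forms[OF forms_pq_scale[OF avg_forms_pq[OF a(1)]]])
    have comp: "dbar A (avg A \<rho> (a r)) = K (Suc r)" for r
      unfolding K_def by (rule avg_dbar_components(1)[OF a D])
    have dbar_f: "dbar A (f x) = (\<Sum>j\<le>p. form_scale (complex_of_real (x ^ j)) (K (Suc (p - j))))"
      unfolding f_def dbar_sum[OF sf] dbar_scale[OF af] comp ..
    have contr_f: "contr A \<rho> \<xi> x (f x) = (\<Sum>j\<le>p. form_scale (complex_of_real (x ^ Suc j)) (K (p - j)))"
    proof -
      have "contr A \<rho> \<xi> x (avg A \<rho> (a r)) = form_scale (complex_of_real x) (K r)" for r
        unfolding K_def by (rule contr_scale_generator[OF af])
      then have "contr A \<rho> \<xi> x (form_scale (complex_of_real (x ^ j)) (avg A \<rho> (a r))) =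
          form_scale (complex_of_real (x ^ Suc j)) (K r)" for j r
        unfolding contr_scale by (simp add: form_scale_def fun_eq_iff mult_ac)
      then show ?thesis unfolding f_def contr_sum by simp
    qed
    \<comment> \<open>The shift by one leaves two end terms: \<open>k 0\<close> is the extra top
      term on the left, \<open>k (Suc p)\<close> the term of exponent 0, and both vanish.\<close>
    have shift: "(\<Sum>j\<le>p. y ^ j * k (Suc (p - j))) = (\<Sum>j\<le>p. y ^ Suc j * k (p - j))"
      if "k 0 = 0" "k (Suc p) = 0" for k :: "nat \<Rightarrow> complex" and y
    proof -
      have "(\<Sum>j\<le>p. y ^ j * k (Suc (p - j))) = (\<Sum>j\<le>p. y ^ j * k (Suc p - j))"
        by (intro sum.cong) (auto simp: Suc_diff_le)
      also have "\<dots> = (\<Sum>j\<le>Suc p. y ^ j * k (Suc p - j))" using that(1) by simp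
      also have "\<dots> = (\<Sum>j\<le>p. y ^ Suc j * k (p - j))"
        using that(2) by (subst sum.atMost_Suc_shift) simp
      finally show ?thesis .
    qed
    have K0: "K 0 = 0" unfolding K_def by (rule avg_dbar_components(2)[OF a D])
    have Kp: "K (Suc p) = 0" unfolding K_def by (rule avg_dbar_components(3)[OF a D])
    have "dbar A (f x) c z vs = contr A \<rho> \<xi> x (f x) c z vs" for c z vs
      using shift[of "\<lambda>r. K r c z vs" "complex_of_real x"] K0 Kp
      by (simp only: dbar_f contr_f fun_sum_apply form_scale_def of_real_power zero_fun_apply)
    then show ?thesis by (simp add: equiv_dbar_def fun_eq_iff)
  qed
  ultimately show ?thesis unfolding equiv_cocycles_def by (simp add: fun_eq_iff)
qed

context
  fixes \<xi> :: real and Z :: "'a set" and s :: int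
  assumes Z: "Z = fixed_points X \<rho>"
begin

lemma Z_fixed: "x \<in> Z \<Longrightarrow> g \<in> sphere 0 1 \<Longrightarrow> \<rho> g x = x"
  by (simp add: Z fixed_points_def)

abbreviation "BZ \<equiv> koszul_coboundaries (sub_atlas A Z) \<rho> \<xi> s"

interpretation sub: open_charts "sub_atlas A Z"
  by (rule sub_atlas_open_charts)

section \<open>Comparison of the classes on \<open>Z\<close>\<close>

lemma restr_coboundary:
  assumes "\<eta> \<in> koszul A (s - 1)"
  shows "restr Z (koszul_D A \<rho> \<xi> \<eta>) \<in> BZ"
proof -
  have "restr Z (koszul_D A \<rho> \<xi> \<eta>) = koszul_D (sub_atlas A Z) \<rho> \<xi> (restr Z \<eta>)"
    by (rule restr_koszul_D[OF assms]) (rule Z_fixed)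
  then show ?thesis
    unfolding koszul_coboundaries_def by (rule image_eqI[OF _ restr_koszul[OF assms]])
qed

lemma restr_koszul_coh_coset:
  "restr_koszul_coh A \<rho> \<xi> Z s (\<omega> +o koszul_coboundaries A \<rho> \<xi> s) = restr Z \<omega> +o BZ"
proof -
  have "restr_koszul_coh A \<rho> \<xi> Z s (\<omega> +o koszul_coboundaries A \<rho> \<xi> s) =
      (\<Union>w\<in>restr Z ` (\<omega> +o koszul_coboundaries A \<rho> \<xi> s). w +o BZ)"
    by (simp add: restr_koszul_coh_def induced_def)
  also have "\<dots> = restr Z \<omega> +o BZ"
  proof (rule coset_of_union[OF sub.koszul_coboundaries_zero sub.koszul_coboundaries_add])
    fix w assume "w \<in> restr Z ` (\<omega> +o koszul_coboundaries A \<rho> \<xi> s)"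
    then obtain \<eta> where "\<eta> \<in> koszul A (s - 1)" "w = restr Z (\<omega> + koszul_D A \<rho> \<xi> \<eta>)"
      by (auto simp: elt_set_plus_def koszul_coboundaries_def)
    then show "w \<in> restr Z \<omega> +o BZ"
      using restr_coboundary by (auto simp: restr_add intro: set_plus_intro2)
  next
    have "\<omega> + 0 \<in> \<omega> +o koszul_coboundaries A \<rho> \<xi> s"
      by (rule set_plus_intro2[OF koszul_coboundaries_zero])
    then show "restr Z \<omega> \<in> restr Z ` (\<omega> +o koszul_coboundaries A \<rho> \<xi> s)" by simp
  qed
  finally show ?thesis .
qed

text \<open>Restriction and evaluation are treated together: at 1 an equivariant coboundary on
  \<open>X\<close> becomes, after restriction, a Koszul coboundary on \<open>Z\<close>, and so does
  one on \<open>Z\<close>. All representatives thus fall into one coset of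
  \<open>BZ\<close>.\<close>

lemma eval_restr_coset:
  "induced (\<lambda>f. f 1) BZ (restr_equiv_coh A \<rho> \<xi> Z (int i) (int i + s)
      (f +o equiv_coboundaries A \<rho> \<xi> (int i) (int i + s))) = restr Z (f 1) +o BZ"
proof -
  let ?C = "equiv_coboundaries A \<rho> \<xi> (int i) (int i + s)"
  let ?CZ = "equiv_coboundaries (sub_atlas A Z) \<rho> \<xi> (int i) (int i + s)"
  let ?R = "restr_equiv_coh A \<rho> \<xi> Z (int i) (int i + s) (f +o ?C)"
  have R: "?R = {(\<lambda>x. restr Z ((f + b) x)) + b' | b b'. b \<in> ?C \<and> b' \<in> ?CZ}"
    unfolding restr_equiv_coh_def induced_def elt_set_plus_def by blast
  have "induced (\<lambda>f. f 1) BZ ?R = (\<Union>w\<in>(\<lambda>f. f 1) ` ?R. w +o BZ)"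
    by (simp add: induced_def)
  also have "\<dots> = restr Z (f 1) +o BZ"
  proof (rule coset_of_union[OF sub.koszul_coboundaries_zero sub.koszul_coboundaries_add])
    fix w assume "w \<in> (\<lambda>f. f 1) ` ?R"
    then obtain b b' where b: "b \<in> ?C" "b' \<in> ?CZ" "w = restr Z (f 1 + b 1) + b' 1"
      unfolding R by auto
    obtain \<eta> where \<eta>: "\<eta> \<in> koszul A (s - 1)" "b 1 = koszul_D A \<rho> \<xi> \<eta>"
      using equiv_coboundaries_eval[OF b(1)] .
    obtain \<eta>' where \<eta>': "\<eta>' \<in> koszul (sub_atlas A Z) (s - 1)" "b' 1 = koszul_D (sub_atlas A Z) \<rho> \<xi> \<eta>'"
      using sub.equiv_coboundaries_eval[OF b(2)] .
    have "b' 1 \<in> BZ" unfolding \<eta>'(2) koszul_coboundaries_def by (rule imageI[OF \<eta>'(1)])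
    then have "restr Z (b 1) + b' 1 \<in> BZ"
      unfolding \<eta>(2) by (rule sub.koszul_coboundaries_add[OF restr_coboundary[OF \<eta>(1)]])
    moreover have "w = restr Z (f 1) + (restr Z (b 1) + b' 1)"
      unfolding b(3) restr_add by (rule add.assoc)
    ultimately show "w \<in> restr Z (f 1) +o BZ" by (simp only: set_plus_intro2)
  next
    have "(\<lambda>x. restr Z ((f + (\<lambda>x. 0)) x)) + (\<lambda>x. 0) \<in> ?R"
      unfolding R using zero_equiv_coboundaries sub.zero_equiv_coboundaries by blast
    then have "((\<lambda>x. restr Z ((f + (\<lambda>x. 0)) x)) + (\<lambda>x. 0)) 1 \<in> (\<lambda>f. f 1) ` ?R" by (rule imageI)
    then show "restr Z (f 1) \<in> (\<lambda>f. f 1) ` ?R" by simp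
  qed
  finally show ?thesis .
qed

lemma eval_coh_cosets:
  assumes "\<And>i. i \<le> p \<Longrightarrow> h i = f i +o equiv_coboundaries A \<rho> \<xi> (int i) (int i + s)"
  shows "eval_coh (sub_atlas A Z) \<rho> \<xi> p s (\<lambda>i. restr_equiv_coh A \<rho> \<xi> Z (int i) (int i + s) (h i)) =
    restr Z (\<Sum>i\<le>p. f i 1) +o BZ"
proof -
  have "eval_coh (sub_atlas A Z) \<rho> \<xi> p s (\<lambda>i. restr_equiv_coh A \<rho> \<xi> Z (int i) (int i + s) (h i)) =
      (\<Sum>i\<le>p. restr Z (f i 1) +o BZ)"
    unfolding eval_coh_def
    by (rule sum.cong[OF refl]) (simp only: atMost_iff assms eval_restr_coset)
  also have "\<dots> = (\<Sum>i\<le>p. restr Z (f i 1)) +o BZ"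
    by (rule coset_sum[OF sub.koszul_coboundaries_zero sub.koszul_coboundaries_add])
  finally show ?thesis unfolding restr_sum .
qed

lemma eval_restr_equiv_coh_eq_filt:
  "(\<lambda>h. eval_coh (sub_atlas A Z) \<rho> \<xi> p s
        (\<lambda>i. restr_equiv_coh A \<rho> \<xi> Z (int i) (int i + s) (h i)))
      ` (\<Pi>\<^sub>E i\<in>{..p}. equiv_coh A \<rho> \<xi> (int i) (int i + s))
    = filt_coh_fixed A \<rho> \<xi> Z p s" (is "?\<Phi> ` ?H = _")
proof (intro set_eqI iffI)
  fix C assume "C \<in> ?\<Phi> ` ?H"
  then obtain h where h: "h \<in> ?H" "C = ?\<Phi> h" by blast
  have "\<exists>f. f \<in> equiv_cocycles A \<rho> \<xi> (int i) (int i + s) \<and>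
      h i = f +o equiv_coboundaries A \<rho> \<xi> (int i) (int i + s)" if "i \<le> p" for i
    using PiE_mem[OF h(1), of i] that by (auto simp: equiv_coh_def quotient_by_def)
  then obtain f where f: "\<And>i. i \<le> p \<Longrightarrow> f i \<in> equiv_cocycles A \<rho> \<xi> (int i) (int i + s)"
      "\<And>i. i \<le> p \<Longrightarrow> h i = f i +o equiv_coboundaries A \<rho> \<xi> (int i) (int i + s)"
    by metis
  define \<omega> where "\<omega> = (\<Sum>i\<le>p. f i 1)"
  have fk: "f i 1 \<in> koszul A s" if "i \<le> p" for i
    using f(1)[OF that] by (intro equiv_forms_eval_koszul[of _ \<rho> i]) (simp add: equiv_cocycles_def)
  have fD: "koszul_D A \<rho> \<xi> (f i 1) = 0" if "i \<le> p" for i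
  proof -
    have "equiv_dbar A \<rho> \<xi> (f i) 1 = 0" using f(1)[OF that] by (simp add: equiv_cocycles_def)
    then show ?thesis by (simp add: equiv_dbar_def koszul_D_def)
  qed
  have "\<exists>a. (\<forall>r. a r \<in> forms_pq A (int r) (int r + s)) \<and> f i 1 = (\<Sum>r\<le>i. a r)" if i: "i \<le> p" for i
  proof -
    have "f i \<in> equiv_forms A \<rho> (int i) (int i + s)" using f(1)[OF i] by (simp add: equiv_cocycles_def)
    then show ?thesis by (rule equiv_forms_eval)
  qed
  then obtain a where a: "\<And>i r. i \<le> p \<Longrightarrow> a i r \<in> forms_pq A (int r) (int r + s)"
      "\<And>i. i \<le> p \<Longrightarrow> f i 1 = (\<Sum>r\<le>i. a i r)"
    by metis
  \<comment> \<open>The summands \<open>f i 1\<close> end at different indices \<open>i\<close>;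
    regrouping by type gives a single family of components up to \<open>p\<close>.\<close>
  define b where "b r = (\<Sum>i\<le>p. if r \<le> i then a i r else 0)" for r
  have pq_sum: "(\<Sum>i\<in>I. g i) \<in> forms_pq A k l" if "\<And>i. i \<in> I \<Longrightarrow> g i \<in> forms_pq A k l"
    for I :: "nat set" and g k l
    using that by (induction I rule: infinite_finite_induct) (auto intro: zero_forms_pq forms_pq_add)
  have b: "b r \<in> forms_pq A (int r) (int r + s)" for r
    unfolding b_def using a(1) by (intro pq_sum) (simp add: zero_forms_pq)
  have "\<omega> = (\<Sum>i\<le>p. \<Sum>r\<le>p. if r \<le> i then a i r else 0)"
    unfolding \<omega>_def
  proof (intro sum.cong refl)
    fix i assume "i \<in> {..p}"
    then show "f i 1 = (\<Sum>r\<le>p. if r \<le> i then a i r else 0)"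
      using a(2)[of i] by (simp only: atMost_iff) (intro sum.mono_neutral_cong_left; auto)
  qed
  then have \<omega>_b: "\<omega> = (\<Sum>r\<le>p. b r)" unfolding b_def by (subst sum.swap) simp
  \<comment> \<open>Membership in \<open>forms A\<close> is carried through the induction because
    additivity of \<open>koszul_D\<close> asks for it in both summands.\<close>
  have "koszul_D A \<rho> \<xi> (\<Sum>i\<in>I. f i 1) = 0 \<and> (\<Sum>i\<in>I. f i 1) \<in> forms A" if "I \<subseteq> {..p}" for I
    using finite_subset[OF that finite_atMost] that
  proof (induction I rule: finite_induct)
    case empty
    then show ?case by (simp only: sum.empty koszul_D_zero zero_forms simp_thms)
  next
    case (insert i I)
    have "i \<le> p" using insert.prems by simp
    moreover have "koszul_D A \<rho> \<xi> (\<Sum>i\<in>I. f i 1) = 0" "(\<Sum>i\<in>I. f i 1) \<in> forms A"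
      using insert.IH insert.prems by blast+
    ultimately show ?case
      unfolding sum.insert[OF insert.hyps]
      using koszul_D_add[OF koszul_forms[OF fk] , of i "\<Sum>i\<in>I. f i 1"] fD[of i] forms_add[OF koszul_forms[OF fk]]
      by (metis add_0)
  qed
  from this[OF subset_refl] have "koszul_D A \<rho> \<xi> \<omega> = 0" unfolding \<omega>_def by (rule conjunct1)
  moreover have "\<omega> \<in> koszul A s" unfolding \<omega>_b by (rule koszul_finite_sum) (simp, rule b)
  moreover have "\<omega> \<in> filt A p" unfolding \<omega>_b by (rule sum_forms_pq_filt) (rule b)
  ultimately have "\<omega> \<in> koszul_cocycles A \<rho> \<xi> s \<inter> filt A p" by (simp add: koszul_cocycles_def)
  then have "\<omega> +o koszul_coboundaries A \<rho> \<xi> s \<in> filt_coh A \<rho> \<xi> p s"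
    unfolding filt_coh_def koszul_coh_def quotient_by_def by blast
  moreover have "C = restr_koszul_coh A \<rho> \<xi> Z s (\<omega> +o koszul_coboundaries A \<rho> \<xi> s)"
    unfolding h(2) restr_koszul_coh_coset \<omega>_def by (rule eval_coh_cosets) (rule f(2))
  ultimately show "C \<in> filt_coh_fixed A \<rho> \<xi> Z p s" unfolding filt_coh_fixed_def by blast
next
  fix C assume "C \<in> filt_coh_fixed A \<rho> \<xi> Z p s"
  then obtain \<omega> where \<omega>: "\<omega> \<in> koszul A s" "koszul_D A \<rho> \<xi> \<omega> = 0" "\<omega> \<in> filt A p"
      and C: "C = restr_koszul_coh A \<rho> \<xi> Z s (\<omega> +o koszul_coboundaries A \<rho> \<xi> s)"
    unfolding filt_coh_fixed_def filt_coh_def koszul_cocycles_def by auto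
  obtain a where a: "\<And>r. a r \<in> forms_pq A (int r) (int r + s)" "\<And>r. p < r \<Longrightarrow> a r = 0"
      and \<omega>_a: "\<omega> = (\<Sum>r\<le>p. a r)"
    using koszul_filt_decomposition[OF \<omega>(1,3)] by blast
  have D: "koszul_D A \<rho> \<xi> (\<Sum>r\<le>p. a r) = 0" using \<omega>(2) unfolding \<omega>_a .
  \<comment> \<open>At 1 all powers become 1 and \<open>F\<close> is the sum of the averaged
    components of \<open>\<omega>\<close>, listed in reverse order.\<close>
  define F where "F x = (\<Sum>j\<le>p. form_scale (complex_of_real (x ^ j)) (avg A \<rho> (a (p - j))))" for x
  \<comment> \<open>The cocycle is placed in the top summand \<open>i = p\<close>; the lower
    summands receive the class of zero.\<close>
  define f where "f i = (if i = p then F else (\<lambda>x. 0))" for i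
  define h where "h = restrict (\<lambda>i. f i +o equiv_coboundaries A \<rho> \<xi> (int i) (int i + s)) {..p}"
  have "F \<in> equiv_cocycles A \<rho> \<xi> (int p) (int p + s)"
    unfolding F_def[abs_def] by (rule equiv_cocycle_of_components[OF a D])
  then have "f i \<in> equiv_cocycles A \<rho> \<xi> (int i) (int i + s)" for i
    by (simp add: f_def zero_equiv_cocycles)
  then have "h \<in> ?H" by (auto simp: h_def equiv_coh_def quotient_by_def)
  moreover have "?\<Phi> h = C"
  proof -
    have "(\<Sum>i\<le>p. f i 1) = (\<Sum>i\<le>p. if i = p then F 1 else 0)"
      by (intro sum.cong refl) (simp add: f_def)
    also have "\<dots> = F 1" by simp
    also have "\<dots> = (\<Sum>j\<le>p. avg A \<rho> (a (p - j)))" by (simp add: F_def form_scale_def)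
    also have "\<dots> = (\<Sum>r\<le>p. avg A \<rho> (a r))"
      by (rule sum.reindex_bij_witness[where i = "\<lambda>j. p - j" and j = "\<lambda>j. p - j"]) auto
    finally have "restr Z (\<Sum>i\<le>p. f i 1) = (\<Sum>r\<le>p. restr Z (avg A \<rho> (a r)))" by (simp only: restr_sum)
    also have "\<dots> = restr Z \<omega>"
      unfolding \<omega>_a restr_sum by (simp only: restr_avg[OF forms_pq_forms[OF a(1)] Z_fixed])
    finally have "restr Z (\<Sum>i\<le>p. f i 1) = restr Z \<omega>" .
    moreover have "?\<Phi> h = restr Z (\<Sum>i\<le>p. f i 1) +o BZ"
      by (rule eval_coh_cosets) (simp add: h_def)
    ultimately show ?thesis unfolding C restr_koszul_coh_coset by simp
  qed
  ultimately show "C \<in> ?\<Phi> ` ?H" by blast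
qed

end

end

theorem corollary4p5:
  fixes X Z :: "'a::t2_space set"
    and A :: "('a, 'n::finite) chart set"
    and \<rho> :: "complex \<Rightarrow> 'a \<Rightarrow> 'a"
    and \<xi> :: real
    and p :: nat
    and s :: int
  assumes "complex_manifold X A"
    and "compact X"
    and "connected X"
    and "kaehler A"
    and "holo_circle_action X A \<rho>"
    and "\<xi> \<noteq> 0"
    and "Z = fixed_points X \<rho>"
    and "Z \<noteq> {}"
  shows "(\<lambda>h. eval_coh (sub_atlas A Z) \<rho> \<xi> p s
               (\<lambda>i. restr_equiv_coh A \<rho> \<xi> Z (int i) (int i + s) (h i)))
           ` (\<Pi>\<^sub>E i\<in>{..p}. equiv_coh A \<rho> \<xi> (int i) (int i + s))
         = filt_coh_fixed A \<rho> \<xi> Z p s"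
proof -
  interpret circle_manifold X A \<rho>
    by unfold_locales (rule assms(1), rule assms(5))
  show ?thesis by (rule eval_restr_equiv_coh_eq_filt[OF assms(7)])
qed

end
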